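(* Let $n\ge 1$ and $x\ge 0$ be integers. The number of centered vertically symmetric rhombus tilings of a $(2n,2x+1,2n)$ hexagon equals $R(n,x)\cdot ST(2n,2x+1,2n)$.
   Context: For positive integers $a,b,c$, an $(a,b,c)$ hexagon is the equi-angular hexagon (on the triangular lattice) with side lengths $a,b,c,a,b,c$ in clockwise order starting from the southwestern side, so that the sides of length $b$ are vertical. A rhombus tiling is a tiling of the hexagon by unit rhombi with angles $60^\circ$ and $120^\circ$. A tiling is vertically symmetric if it is invariant under reflection in the vertical symmetry axis of the hexagon. When $a$ and $b$ have opposite parity, an $(a,b,a)$ hexagon has a central rhombus (the unit rhombus centered at the center of the hexagon); a tiling is centered if it contains it. Notation: $(a)_k=a(a+1)\cdots(a+k-1)$, $(a)_0=1$; $m!!$ is the double factorial ($(2n)!!=2^n n!$, $(2n-1)!!=1\cdot3\cdots(2n-1)$); $ST(a,b,a)=\prod_{i=1}^a\frac{2i+b-1}{2i-1}\prod_{1\le i<j\le a}\frac{i+j+b-1}{i+j-1}$; for a positive integer $n$ and nonnegative integer $x$, $U_n(x)=\sum_{i=1}^n\big((2n-1)!!+(-1)^{i+1}(2n)!!\big)\frac{(\frac32-i)_{2n-1}}{(i-1)!(2n-i)!}\big((x+1)_{i-1}(x+i+1)_{2n-i}-(x+1)_{2n-i}(x+2n+2-i)_{i-1}\big)$ and $R(n,x)=2^{3n-2}\frac{(2x+2)!\,(x+2n)!}{n!\,(x+1)!\,(2x+4n)!}U_n(x)$. *)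

theory Defs
  imports Complex_Main
begin

text \<open>Triangular lattice with vertical edges. A lattice point (u,v) in Z^2 stands for the
  plane point u*(sqrt 3/2, 1/2) + v*(0,1). Unit triangles are represented by their vertex sets:
  right-pointing {(u,v),(u,v+1),(u+1,v)} and left-pointing {(u,v+1),(u+1,v),(u+1,v+1)}.\<close>

type_synonym pt = "int \<times> int"

definition unit_triangle :: "pt set \<Rightarrow> bool" where
  "unit_triangle t \<longleftrightarrow>
     (\<exists>u v. t = {(u,v),(u,v+1),(u+1,v)} \<or> t = {(u,v+1),(u+1,v),(u+1,v+1)})"

text \<open>The (a,b,c) hexagon: vertices (0,0),(0,b),(c,b),(c+a,b-a),(c+a,-a),(a,-a) in lattice
  coordinates; sides a (SW), b (W, vertical), c (NW), a (NE), b (E, vertical), c (SE).\<close>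

definition in_hexagon :: "nat \<Rightarrow> nat \<Rightarrow> nat \<Rightarrow> pt \<Rightarrow> bool" where
  "in_hexagon a b c p \<longleftrightarrow>
     (0 \<le> fst p \<and> fst p \<le> int a + int c \<and> - int a \<le> snd p \<and> snd p \<le> int b
      \<and> 0 \<le> fst p + snd p \<and> fst p + snd p \<le> int b + int c)"

definition hex_triangles :: "nat \<Rightarrow> nat \<Rightarrow> nat \<Rightarrow> pt set set" where
  "hex_triangles a b c = {t. unit_triangle t \<and> (\<forall>p\<in>t. in_hexagon a b c p)}"

definition unit_rhombus :: "pt set set \<Rightarrow> bool" where
  "unit_rhombus r \<longleftrightarrow>
     (\<exists>s t. r = {s, t} \<and> unit_triangle s \<and> unit_triangle t \<and> card (s \<inter> t) = 2)"

definition rhombus_tiling :: "nat \<Rightarrow> nat \<Rightarrow> nat \<Rightarrow> pt set set set \<Rightarrow> bool" where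
  "rhombus_tiling a b c T \<longleftrightarrow>
     (\<forall>r\<in>T. unit_rhombus r \<and> r \<subseteq> hex_triangles a b c) \<and>
     (\<forall>t\<in>hex_triangles a b c. \<exists>!r. r \<in> T \<and> t \<in> r)"

text \<open>Reflection in the vertical symmetry axis of the (a,b,a) hexagon (the line u = a).\<close>

definition vrefl :: "nat \<Rightarrow> pt \<Rightarrow> pt" where
  "vrefl a p = (2 * int a - fst p, snd p + fst p - int a)"

definition reflect_rhombus :: "nat \<Rightarrow> pt set set \<Rightarrow> pt set set" where
  "reflect_rhombus a r = (\<lambda>t. vrefl a ` t) ` r"

definition vertically_symmetric :: "nat \<Rightarrow> pt set set set \<Rightarrow> bool" where
  "vertically_symmetric a T \<longleftrightarrow> reflect_rhombus a ` T = T"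

text \<open>For a, b of opposite parity, the centre of the (a,b,a) hexagon is the midpoint of the
  vertical unit edge from (a,v0) to (a,v0+1), v0 = (b-1-a)/2; the central rhombus consists of
  the two unit triangles sharing this edge.\<close>

definition central_rhombus :: "nat \<Rightarrow> nat \<Rightarrow> pt set set" where
  "central_rhombus a b =
     (let v0 = (int b - 1 - int a) div 2
      in {{(int a, v0), (int a, v0 + 1), (int a + 1, v0)},
          {(int a - 1, v0 + 1), (int a, v0), (int a, v0 + 1)}})"

definition centered_sym_tilings :: "nat \<Rightarrow> nat \<Rightarrow> pt set set set set" where
  "centered_sym_tilings a b =
     {T. rhombus_tiling a b a T \<and> vertically_symmetric a T \<and> central_rhombus a b \<in> T}"

fun dfact :: "nat \<Rightarrow> nat" where
  "dfact 0 = 1"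
| "dfact (Suc 0) = 1"
| "dfact (Suc (Suc m)) = Suc (Suc m) * dfact m"

definition ST :: "nat \<Rightarrow> nat \<Rightarrow> real" where
  "ST a b = (\<Prod>i=1..a. (2 * real i + real b - 1) / (2 * real i - 1)) *
            (\<Prod>i=1..a. \<Prod>j=i+1..a. (real i + real j + real b - 1) / (real i + real j - 1))"

definition U :: "nat \<Rightarrow> nat \<Rightarrow> real" where
  "U n x = (\<Sum>i=1..n.
     (real (dfact (2*n - 1)) + (-1) ^ (i + 1) * real (dfact (2*n))) *
     pochhammer (3/2 - real i) (2*n - 1) / (fact (i - 1) * fact (2*n - i)) *
     (pochhammer (real x + 1) (i - 1) * pochhammer (real x + real i + 1) (2*n - i)
      - pochhammer (real x + 1) (2*n - i) * pochhammer (real x + 2 * real n + 2 - real i) (i - 1)))"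

definition R :: "nat \<Rightarrow> nat \<Rightarrow> real" where
  "R n x = 2 ^ (3*n - 2) * (fact (2*x + 2) * fact (x + 2*n)) /
           (fact n * fact (x + 1) * fact (2*x + 4*n)) * U n x"

end

theory Submission
  imports Defs "HOL-Computational_Algebra.Computational_Algebra"
begin

text \<open>
  The horizontal rhombi of a vertically symmetric tiling that lie on the axis form a set \<open>S\<close> of
  \<open>2n\<close> among \<open>2N + 1\<close> unit edges, \<open>N = n + x\<close>, and the left half of the tiling is an interlacing
  (Gelfand-Tsetlin) pattern with top row \<open>S\<close>. There are \<open>\<Delta>(S) / \<Prod>\<^sub>i i!\<close> of those, where \<open>\<Delta>\<close> is the
  Vandermonde product. Centering the edges at 0, one therefore has to sum \<open>\<Delta>(S)\<close> over
  all \<open>S \<subseteq> {-N, \<dots>, N}\<close> with \<open>2n\<close> elements and over those which contain 0.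

  Such sums expand like Pfaffians in the skew form
  \<open>\<langle>f, g\<rangle> = \<Sum>\<^sub>s\<^sub>,\<^sub>t sgn (t - s) f(s) g(t)\<close>. For odd \<open>g\<close> the inner sum over \<open>t\<close> is again a polynomial
  \<open>H(s)\<close>, even and with vanishing alternating sum over the grid, and every such \<open>H\<close> arises; so the
  discrete Chebyshev polynomials yield a triangular basis and the total is a product.
  Choosing \<open>H\<close> to be orthogonal to \<open>s\<^sup>2, s\<^sup>4, \<dots>, s\<^sup>2\<^sup>n\<^sup>-\<^sup>2\<close> with \<open>\<Sum>\<^sub>s H(s) = 1\<close> shows
  that the proportion of sets containing 0 is \<open>H(0)\<close>. This is an explicit sum of \<open>n\<close> terms. Up to the
  denominator it is a polynomial in \<open>x\<close>, as is \<open>U\<close>, and both agree at \<open>x = -1, \<dots>, -2n\<close>, where the sum is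
  the full reproducing kernel of a smaller grid.
\<close>

section \<open>Alternating sums over point sets\<close>

text \<open>Two steps of the overview have reasons that it does not give. Why the proportion is
  H(0): let h be the odd preimage of H and put it in place of the top power s^(2n-1). On the full
  grid h pairs to 0 with s, ..., s^(2n-2), by parity or by the choice of H, and to -1 with the
  constant 1. Without the point 0 only the last value changes, to H(0) - 1, because h and all
  positive powers vanish at 0. The remaining minors agree on both grids, so the fraction 1 - H(0) of
  the total avoids 0. This needs h of full degree, and the obstacle is to show that the top
  coefficient of H is not 0; it is an alternating sum of increasing terms. Why negative x: the sum
  depends on M = 2x + 2n + 1 through M^2 only, and x = -1, ..., -2n gives the odd M from 2n - 1 down
  to -(2n - 1). At M = 2N + 1 with N < n the terms with k > N contain a zero factor, and the others
  run over all even degrees on a grid of 2N + 1 points. There polynomials separate points, so the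
  kernel at 0 is known. These 2n values exceed the degree bound 2n - 1.\<close>

text \<open>\<open>alt_det fs T\<close> is the determinant of the matrix with entries \<open>f s\<close>, for \<open>f\<close> in \<open>fs\<close> and
  \<open>s \<in> T\<close> in increasing order, and it is 0 unless \<open>card T = length fs\<close>.\<close>

fun alt_det :: "('a::linorder \<Rightarrow> real) list \<Rightarrow> 'a set \<Rightarrow> real" where
  "alt_det [] T = (if T = {} then 1 else 0)"
| "alt_det (f # fs) T = (\<Sum>s\<in>T. (-1) ^ card {t\<in>T. t < s} * f s * alt_det fs (T - {s}))"

lemma alt_det_card: "alt_det fs T \<noteq> 0 \<Longrightarrow> finite T \<and> card T = length fs"
proof (induction fs arbitrary: T)
  case Nil
  then show ?case by (auto split: if_splits)
next
  case (Cons f fs)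
  have fT: "finite T" using Cons.prems by (rule_tac ccontr) simp
  obtain s where s: "s \<in> T" "alt_det fs (T - {s}) \<noteq> 0"
    using Cons.prems by (force intro: sum.neutral)
  then have "card (T - {s}) = length fs" using Cons.IH by blast
  then show ?case using s fT by (metis card_Suc_Diff1 length_Cons)
qed

lemma alt_det_eq_0: "card T \<noteq> length fs \<Longrightarrow> alt_det fs T = 0"
  using alt_det_card by blast

text \<open>Linearity in one slot. The slot is located by a prefix and a suffix so that row
  operations apply at any position; the induction peels off \<open>pre\<close>.\<close>

lemma alt_det_sum:
  "alt_det (pre @ (\<lambda>s. \<Sum>i\<in>I. c i * f i s) # post) T = (\<Sum>i\<in>I. c i * alt_det (pre @ f i # post) T)"
proof (induction pre arbitrary: T)
  case Nil
  have "alt_det ([] @ (\<lambda>s. \<Sum>i\<in>I. c i * f i s) # post) T =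
      (\<Sum>s\<in>T. \<Sum>i\<in>I. c i * ((-1) ^ card {t\<in>T. t < s} * f i s * alt_det post (T - {s})))"
    by (simp only: append_Nil alt_det.simps sum_distrib_left sum_distrib_right)
       (intro sum.cong refl, simp)
  then show ?case by (subst (asm) sum.swap) (simp add: sum_distrib_left)
next
  case (Cons g pre)
  have "alt_det ((g # pre) @ (\<lambda>s. \<Sum>i\<in>I. c i * f i s) # post) T =
      (\<Sum>s\<in>T. \<Sum>i\<in>I. c i * ((-1) ^ card {t\<in>T. t < s} * g s * alt_det (pre @ f i # post) (T - {s})))"
    unfolding append_Cons alt_det.simps Cons sum_distrib_left
    by (intro sum.cong refl) simp
  then show ?case by (subst (asm) sum.swap) (simp add: sum_distrib_left)
qed

lemma alt_det_scale: "alt_det (pre @ (\<lambda>s. c * f s) # post) T = c * alt_det (pre @ f # post) T"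
  using alt_det_sum[where pre = pre and I = "{()}" and c = "\<lambda>_. c" and f = "\<lambda>_. f" and post = post and T = T] by simp

lemma alt_det_add: "alt_det (pre @ (\<lambda>s. f s + g s) # post) T = alt_det (pre @ f # post) T + alt_det (pre @ g # post) T"
  using alt_det_sum[where pre = pre and I = UNIV and c = "\<lambda>_. 1" and f = "\<lambda>b. if b then f else g" and post = post and T = T] by (simp add: UNIV_bool add.commute)

lemma alt_det_diff: "alt_det (pre @ (\<lambda>s. f s - g s) # post) T = alt_det (pre @ f # post) T - alt_det (pre @ g # post) T"
  using alt_det_add[of pre f "\<lambda>s. -1 * g s" post T] alt_det_scale[of pre "-1" g post T] by simp

lemma card_less_remove:
  fixes s :: "'a::linorder"
  assumes "finite T" "s \<in> T"
  shows "card {t\<in>T. t < r} = card {t\<in>T - {s}. t < r} + (if s < r then 1 else 0)"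
proof -
  have "{t\<in>T. t < r} = {t\<in>T - {s}. t < r} \<union> (if s < r then {s} else {})" using assms by auto
  then show ?thesis using assms by (auto simp: card_insert_if)
qed

lemma card_less_insert:
  fixes s :: "'a::linorder"
  assumes "finite T" "s \<notin> T"
  shows "card {t\<in>insert s T. t < r} = card {t\<in>T. t < r} + (if s < r then 1 else 0)"
  using card_less_remove[of "insert s T" s r] assms by simp

lemma sum_pairs_antisym:
  fixes h :: "'a::linorder \<Rightarrow> 'a \<Rightarrow> real"
  assumes "\<And>s t. s \<noteq> t \<Longrightarrow> h s t = - h t s"
  shows "(\<Sum>s\<in>T. \<Sum>t\<in>T - {s}. h s t) = 0"
proof (cases "finite T")
  case True
  have "(\<Sum>s\<in>T. \<Sum>t\<in>T - {s}. h s t) = (\<Sum>s\<in>T. \<Sum>t\<in>T. if s = t then 0 else h s t)"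
    by (rule sum.cong[OF refl], rule sum.mono_neutral_cong_left) (use True in auto)
  moreover have "(\<Sum>s\<in>T. \<Sum>t\<in>T. if s = t then 0 else h s t) = (\<Sum>s\<in>T. \<Sum>t\<in>T. - (if s = t then 0 else h s t))"
  proof (subst sum.swap, intro sum.cong refl)
    fix s t show "(if t = s then 0 else h t s) = - (if s = t then 0 else h s t)"
      using assms[of s t] by (cases "s = t") auto
  qed
  ultimately show ?thesis unfolding sum_negf by linarith
qed simp

text \<open>Expanding along both equal rows, the ordered pairs (s, t) and (t, s) remove the same two
  points with opposite signs: deleting the smaller point lowers the rank of the larger by one, and
  deleting the larger changes nothing.\<close>

lemma alt_det_adjacent: "alt_det (pre @ f # f # post) T = 0"
proof (induction pre arbitrary: T)
  case Nil
  show ?case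
  proof (cases "finite T")
    case True
    define h where "h s t = (-1) ^ card {r\<in>T. r < s} * f s *
        ((-1) ^ card {r\<in>T - {s}. r < t} * f t * alt_det post (T - {s} - {t}))" for s t
    have "alt_det (f # f # post) T = (\<Sum>s\<in>T. \<Sum>t\<in>T - {s}. h s t)"
      by (simp add: h_def sum_distrib_left)
    also have "\<dots> = (\<Sum>s\<in>T. \<Sum>t\<in>T - {s}. if s \<in> T \<and> t \<in> T then h s t else 0)"
      by (intro sum.cong) auto
    also have "\<dots> = 0"
    proof (rule sum_pairs_antisym)
      fix s t :: 'a assume st: "s \<noteq> t"
      have "h s t = - h t s" if "s \<in> T" "t \<in> T"
      proof -
        have e: "T - {s} - {t} = T - {t} - {s}" by auto
        show ?thesis
          using card_less_remove[OF True that(1), of t] card_less_remove[OF True that(2), of s] st e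
          by (cases "s < t") (auto simp: h_def)
      qed
      then show "(if s \<in> T \<and> t \<in> T then h s t else 0) = - (if t \<in> T \<and> s \<in> T then h t s else 0)" by auto
    qed
    finally show ?thesis by simp
  qed simp
qed simp

lemma alt_det_swap: "alt_det (pre @ f # g # post) T = - alt_det (pre @ g # f # post) T"
proof -
  define h where "h = (\<lambda>s. f s + g s)"
  have "0 = alt_det (pre @ h # h # post) T" by (simp add: alt_det_adjacent)
  also have "\<dots> = alt_det (pre @ f # h # post) T + alt_det (pre @ g # h # post) T"
    unfolding h_def by (rule alt_det_add)
  also have "alt_det (pre @ f # h # post) T = alt_det (pre @ f # g # post) T"
    using alt_det_add[of "pre @ [f]" f g post T] alt_det_adjacent[of pre f post T] by (simp add: h_def)
  also have "alt_det (pre @ g # h # post) T = alt_det (pre @ g # f # post) T"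
    using alt_det_add[of "pre @ [g]" f g post T] alt_det_adjacent[of pre g post T] by (simp add: h_def)
  finally show ?thesis by simp
qed

lemma alt_det_repeat_gap: "alt_det (pre @ f # mid @ f # post) T = 0"
proof (induction mid arbitrary: pre)
  case (Cons g mid)
  have "alt_det (pre @ f # g # (mid @ f # post)) T = - alt_det ((pre @ [g]) @ f # mid @ f # post) T"
    by (subst alt_det_swap) simp
  then show ?case using Cons[of "pre @ [g]"] by simp
qed (simp add: alt_det_adjacent)

lemma alt_det_repeat: 
  assumes "f \<in> set pre" shows "alt_det (pre @ f # post) T = 0"
proof -
  obtain p q where "pre = p @ f # q" using assms by (meson split_list)
  then show ?thesis using alt_det_repeat_gap[of p f q post T] by simp
qed

lemma alt_det_rotate: "alt_det (pre @ [f]) T = (-1) ^ length pre * alt_det (f # pre) T"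
proof -
  have "alt_det (p @ pre @ [f]) T = (-1) ^ length pre * alt_det (p @ f # pre) T" for p
  proof (induction pre arbitrary: p)
    case (Cons g pre)
    show ?case using Cons[of "p @ [g]"] alt_det_swap[of p g f pre T] by simp
  qed simp
  from this[of "[]"] show ?thesis by simp
qed

lemma alt_det_all_zero:
  assumes "\<And>f. f \<in> set fs \<Longrightarrow> f t = 0" "t \<in> T" shows "alt_det fs T = 0"
  using assms
proof (induction fs arbitrary: T)
  case (Cons f fs)
  have "f s * alt_det fs (T - {s}) = 0" if "s \<in> T" for s
    using Cons that by (cases "s = t") auto
  then show ?case by (auto simp: mult.assoc intro!: sum.neutral)
qed auto

lemma alt_det_reindex:
  fixes h :: "'a::linorder \<Rightarrow> 'b::linorder"
  assumes "strict_mono h"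
  shows "alt_det fs (h ` T) = alt_det (map (\<lambda>f s. f (h s)) fs) T"
proof (induction fs arbitrary: T)
  case (Cons f fs)
  have inj: "inj_on h A" for A using assms by (meson inj_on_subset strict_mono_imp_inj_on top_greatest)
  have "card {t \<in> h ` T. t < h s} = card {t\<in>T. t < s}" for s
  proof -
    have "{t \<in> h ` T. t < h s} = h ` {t\<in>T. t < s}" using assms by (auto simp: strict_mono_less)
    then show ?thesis by (simp add: card_image inj)
  qed
  moreover have "h ` T - {h s} = h ` (T - {s})" for s
    using inj[of UNIV] by (auto dest: injD)
  ultimately show ?case by (simp add: sum.reindex[OF inj] Cons)
qed simp

section \<open>Laplace expansion along a column\<close>

definition delete_nth :: "nat \<Rightarrow> 'b list \<Rightarrow> 'b list" where
  "delete_nth j fs = take j fs @ drop (Suc j) fs"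

lemma delete_nth_0 [simp]: "delete_nth 0 (f # fs) = fs" by (simp add: delete_nth_def)
lemma delete_nth_Suc [simp]: "delete_nth (Suc j) (f # fs) = f # delete_nth j fs" by (simp add: delete_nth_def)

text \<open>\<open>alt_det\<close> is defined by expansion along rows; this is the expansion along
  the column of \<open>t\<close> adjoined to \<open>T\<close>. For \<open>t\<close> in
  \<open>T\<close> that column occurs twice, hence the value 0. The sign on the right moves
  \<open>t\<close> from the front to its rank.\<close>

lemma alt_det_column:
  assumes "finite T"
  shows "(\<Sum>j<length fs. (-1) ^ j * (fs ! j) t * alt_det (delete_nth j fs) T) =
    (if t \<in> T then 0 else (-1) ^ card {s\<in>T. s < t} * alt_det fs (insert t T))"
  using assms
proof (induction fs arbitrary: T)
  case Nil
  then show ?case by simp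
next
  case (Cons f fs)
  note fin = \<open>finite T\<close>
  define E where "E T = (\<Sum>j<length fs. (-1) ^ j * (fs ! j) t * alt_det (delete_nth j fs) T)" for T
  have E: "E T = (if t \<in> T then 0 else (-1) ^ card {s\<in>T. s < t} * alt_det fs (insert t T))" if "finite T" for T
    using Cons.IH[OF that] by (simp add: E_def)
  have "(\<Sum>j<length (f#fs). (-1) ^ j * ((f#fs) ! j) t * alt_det (delete_nth j (f#fs)) T) =
     f t * alt_det fs T - (\<Sum>j<length fs. \<Sum>s\<in>T. (-1) ^ j * (fs ! j) t * ((-1) ^ card {r\<in>T. r < s} * f s * alt_det (delete_nth j fs) (T - {s})))"
    unfolding length_Cons sum.lessThan_Suc_shift by (simp add: sum_negf sum_distrib_left)
  also have "(\<Sum>j<length fs. \<Sum>s\<in>T. (-1) ^ j * (fs ! j) t * ((-1) ^ card {r\<in>T. r < s} * f s * alt_det (delete_nth j fs) (T - {s})))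
     = (\<Sum>s\<in>T. (-1) ^ card {r\<in>T. r < s} * f s * E (T - {s}))"
    by (subst sum.swap) (simp add: E_def sum_distrib_left mult_ac)
  finally have eq: "(\<Sum>j<length (f#fs). (-1) ^ j * ((f#fs) ! j) t * alt_det (delete_nth j (f#fs)) T) =
      f t * alt_det fs T - (\<Sum>s\<in>T. (-1) ^ card {r\<in>T. r < s} * f s * E (T - {s}))" .
  show ?case
  proof (cases "t \<in> T")
    case True
    have "(\<Sum>s\<in>T. (-1) ^ card {r\<in>T. r < s} * f s * E (T - {s})) =
        (-1) ^ card {r\<in>T. r < t} * f t * E (T - {t})"
      by (subst sum.remove[OF fin True]) (use fin True in \<open>auto simp: E intro!: sum.neutral split: if_splits\<close>)
    also have "\<dots> = f t * alt_det fs T"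
      using card_less_remove[OF fin True, of t] fin True by (simp add: E insert_absorb)
    finally show ?thesis using eq True by simp
  next
    case False
    have step: "(-1) ^ card {r\<in>T. r < s} * f s * E (T - {s}) =
       - ((-1) ^ card {r\<in>T. r < t} * ((-1) ^ card {r\<in>insert t T. r < s} * f s * alt_det fs (insert t T - {s})))"
      if "s \<in> T" for s
    proof -
      have "insert t (T - {s}) = insert t T - {s}" using that False by auto
      then show ?thesis
        using that False fin card_less_remove[OF fin that, of t] card_less_insert[OF fin False, of s]
        by (cases "s < t") (auto simp: E)
    qed
    have "(\<Sum>s\<in>T. (-1) ^ card {r\<in>T. r < s} * f s * E (T - {s})) =
        - ((-1) ^ card {r\<in>T. r < t} * (\<Sum>s\<in>T. (-1) ^ card {r\<in>insert t T. r < s} * f s * alt_det fs (insert t T - {s})))"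
      unfolding sum_distrib_left sum_negf[symmetric] using step by (intro sum.cong refl)
    moreover have "alt_det (f # fs) (insert t T) = (-1) ^ card {r\<in>T. r < t} * f t * alt_det fs T +
        (\<Sum>s\<in>T. (-1) ^ card {r\<in>insert t T. r < s} * f s * alt_det fs (insert t T - {s}))"
      using fin False card_less_insert[OF fin False, of t] by simp
    ultimately show ?thesis using eq False by (simp add: algebra_simps)
  qed
qed

section \<open>Rank signs in point sets\<close>

lemma alternating_sum_card:
  fixes T :: "'a::linorder set"
  assumes "finite T"
  shows "(\<Sum>t\<in>T. (-1) ^ card {r\<in>T. r < t}) = (if odd (card T) then 1 else (0::real))"
  using assms
proof (induction T rule: finite_linorder_max_induct)
  case empty
  then show ?case by simp
next
  case (insert b A)
  have b: "b \<notin> A" using insert by auto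
  have "(\<Sum>t\<in>A. (-1) ^ card {r\<in>insert b A. r < t}) = (\<Sum>t\<in>A. (-1) ^ card {r\<in>A. r < t} :: real)"
    using insert b by (intro sum.cong refl) (subst card_less_insert, auto)
  moreover have "{r\<in>A. r < b} = A" using insert by auto
  moreover have "{r \<in> insert b A. r < b} = A" using insert by auto
  ultimately show ?case using insert b by auto
qed

text \<open>This is how the sign form arises: the signed indicator of \<open>s \<notin> T\<close>,
  left by a row expansion, becomes linear in the rank signs of the points of \<open>T\<close>. The
  points below and above \<open>s\<close> each contribute by the parity of their number, and odd
  cardinality forces exactly one odd block if \<open>s \<notin> T\<close> and equal parities
  otherwise.\<close>

lemma alternating_sum_sgn:
  fixes T :: "int set"
  assumes "finite T" "odd (card T)"
  shows "(\<Sum>t\<in>T. real_of_int (sgn (t - s)) * (-1) ^ card {r\<in>T. r < t}) =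
    (if s \<in> T then 0 else (-1) ^ card {r\<in>T. r < s})"
proof -
  define A where "A = {t\<in>T. t < s}"
  define B where "B = {t\<in>T. s < t}"
  define p where "p = card A + (if s \<in> T then 1 else 0)"
  have fin: "finite A" "finite B" using assms by (auto simp: A_def B_def)
  have T: "T = A \<union> (if s \<in> T then {s} else {}) \<union> B"
    by (cases "s \<in> T") (auto simp: A_def B_def not_less less_le)
  have disj: "A \<inter> B = {}" "s \<notin> A" "s \<notin> B" by (auto simp: A_def B_def)
  have cT: "card T = p + card B"
    by (subst T) (use fin disj in \<open>auto simp: p_def card_Un_disjoint card_insert_if\<close>)
  have "(\<Sum>t\<in>T. real_of_int (sgn (t - s)) * (-1) ^ card {r\<in>T. r < t}) =
     (\<Sum>t\<in>A. real_of_int (sgn (t - s)) * (-1) ^ card {r\<in>T. r < t}) +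
     (\<Sum>t\<in>B. real_of_int (sgn (t - s)) * (-1) ^ card {r\<in>T. r < t})"
    by (subst (1) T) (use fin disj in \<open>auto simp: sum.union_disjoint\<close>)
  also have "(\<Sum>t\<in>A. real_of_int (sgn (t - s)) * (-1) ^ card {r\<in>T. r < t}) = - (\<Sum>t\<in>A. (-1) ^ card {r\<in>A. r < t})"
    unfolding sum_negf[symmetric]
  proof (intro sum.cong refl)
    fix t assume "t \<in> A"
    moreover then have "{r\<in>T. r < t} = {r\<in>A. r < t}" by (auto simp: A_def)
    ultimately show "real_of_int (sgn (t - s)) * (-1) ^ card {r\<in>T. r < t} = - ((-1) ^ card {r\<in>A. r < t})"
      by (auto simp: A_def)
  qed
  also have "(\<Sum>t\<in>B. real_of_int (sgn (t - s)) * (-1) ^ card {r\<in>T. r < t}) = (-1) ^ p * (\<Sum>t\<in>B. (-1) ^ card {r\<in>B. r < t})"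
    unfolding sum_distrib_left
  proof (intro sum.cong refl)
    fix t assume t: "t \<in> B"
    have "{r\<in>T. r < t} = (A \<union> (if s \<in> T then {s} else {})) \<union> {r\<in>B. r < t}"
      using t by (cases "s \<in> T") (auto simp: A_def B_def not_less less_le)
    moreover have "A \<inter> {r\<in>B. r < t} = {}" using disj by auto
    ultimately have "card {r\<in>T. r < t} = p + card {r\<in>B. r < t}"
      using fin disj by (auto simp: p_def card_Un_disjoint card_insert_if)
    then show "real_of_int (sgn (t - s)) * (-1) ^ card {r\<in>T. r < t} = (-1) ^ p * (-1) ^ card {r\<in>B. r < t}"
      using t by (auto simp: B_def power_add)
  qed
  also have "- (\<Sum>t\<in>A. (-1) ^ card {r\<in>A. r < t}) + (-1) ^ p * (\<Sum>t\<in>B. (-1) ^ card {r\<in>B. r < t}) =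
     (if s \<in> T then 0 else (-1) ^ card A :: real)"
    using assms cT fin by (auto simp: alternating_sum_card p_def split: if_splits)
  finally show ?thesis by (simp add: A_def)
qed

section \<open>A Pfaffian-type expansion for sums over all subsets\<close>

definition subset_sum :: "(int \<Rightarrow> real) list \<Rightarrow> int set \<Rightarrow> real" where
  "subset_sum fs X = (\<Sum>T\<in>Pow X. alt_det fs T)"

definition sgn_form :: "int set \<Rightarrow> (int \<Rightarrow> real) \<Rightarrow> (int \<Rightarrow> real) \<Rightarrow> real" where
  "sgn_form X f g = (\<Sum>s\<in>X. f s * (\<Sum>t\<in>X. real_of_int (sgn (t - s)) * g t))"

text \<open>The bijection sends (T, t) with t outside T to (T with t inserted, t).\<close>

lemma sum_Pow_remove:
  assumes "finite X"
  shows "(\<Sum>T\<in>Pow X. \<Sum>t\<in>X - T. h t T) = (\<Sum>T\<in>Pow X. \<Sum>t\<in>T. (h t (T - {t}) :: real))"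
proof -
  have "(\<Sum>T\<in>Pow X. \<Sum>t\<in>X - T. h t T) = (\<Sum>(T,t)\<in>Sigma (Pow X) (\<lambda>T. X - T). h t T)"
    using assms by (subst sum.Sigma) (auto simp: finite_subset)
  also have "\<dots> = (\<Sum>(T,t)\<in>Sigma (Pow X) (\<lambda>T. T). h t (T - {t}))"
    by (rule sum.reindex_bij_witness[where i = "\<lambda>(T,t). (T - {t}, t)" and j = "\<lambda>(T,t). (insert t T, t)"]) auto
  also have "\<dots> = (\<Sum>T\<in>Pow X. \<Sum>t\<in>T. h t (T - {t}))"
    using assms by (subst sum.Sigma) (auto intro: finite_subset)
  finally show ?thesis .
qed

text \<open>Both sides become \<open>\<Sum>\<^sub>s f s \<Sum>\<^sub>T \<plusminus> alt_det fs T\<close> over \<open>T\<close> not containing \<open>s\<close>: the left-hand side by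
  expanding along the row of \<open>f\<close>, the right-hand side by the column expansion and
  \<open>alternating_sum_sgn\<close>.\<close>

lemma subset_sum_expand:
  assumes X: "finite X" and odd: "odd (length fs)"
  shows "subset_sum (f # fs) X = (\<Sum>j<length fs. (-1) ^ j * sgn_form X f (fs ! j) * subset_sum (delete_nth j fs) X)"
proof -
  define S where "S s = (\<Sum>T\<in>Pow X. alt_det fs T * (if s \<in> T then 0 else (-1) ^ card {r\<in>T. r < s}))" for s
  have finT: "finite T" if "T \<in> Pow X" for T using that X finite_subset by blast
  have "subset_sum (f # fs) X = (\<Sum>T\<in>Pow X. \<Sum>s\<in>T. (-1) ^ card {r\<in>T - {s}. r < s} * f s * alt_det fs (T - {s}))"
    unfolding subset_sum_def alt_det.simps
    by (intro sum.cong refl) (auto dest: finT simp: card_less_remove[OF finT])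
  also have "\<dots> = (\<Sum>T\<in>Pow X. \<Sum>s\<in>X - T. (-1) ^ card {r\<in>T. r < s} * f s * alt_det fs T)"
    by (rule sum_Pow_remove[OF X, symmetric])
  also have "\<dots> = (\<Sum>T\<in>Pow X. \<Sum>s\<in>X. f s * (alt_det fs T * (if s \<in> T then 0 else (-1) ^ card {r\<in>T. r < s})))"
    by (rule sum.cong[OF refl], rule sum.mono_neutral_cong_left) (auto simp: X)
  also have "\<dots> = (\<Sum>s\<in>X. f s * S s)"
    by (subst sum.swap) (simp add: S_def sum_distrib_left)
  finally have lhs: "subset_sum (f # fs) X = (\<Sum>s\<in>X. f s * S s)" .
  have S: "S s = (\<Sum>t\<in>X. real_of_int (sgn (t - s)) * (\<Sum>T\<in>Pow X. \<Sum>j<length fs. (-1) ^ j * (fs ! j) t * alt_det (delete_nth j fs) T))" for s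
  proof -
    have "S s = (\<Sum>T\<in>Pow X. alt_det fs T * (\<Sum>t\<in>T. real_of_int (sgn (t - s)) * (-1) ^ card {r\<in>T. r < t}))"
      unfolding S_def
    proof (intro sum.cong refl)
      fix T assume T: "T \<in> Pow X"
      show "alt_det fs T * (if s \<in> T then 0 else (-1) ^ card {r\<in>T. r < s}) =
        alt_det fs T * (\<Sum>t\<in>T. real_of_int (sgn (t - s)) * (-1) ^ card {r\<in>T. r < t})"
      proof (cases "alt_det fs T = 0")
        case False
        then have "odd (card T)" using alt_det_card odd by metis
        then show ?thesis using alternating_sum_sgn[OF finT[OF T]] by simp
      qed simp
    qed
    also have "\<dots> = (\<Sum>T\<in>Pow X. \<Sum>t\<in>T. real_of_int (sgn (t - s)) * ((-1) ^ card {r\<in>T - {t}. r < t} * alt_det fs (insert t (T - {t}))))"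
      unfolding sum_distrib_left
      by (intro sum.cong refl) (auto dest: finT simp: card_less_remove[OF finT] insert_absorb)
    also have "\<dots> = (\<Sum>T\<in>Pow X. \<Sum>t\<in>X - T. real_of_int (sgn (t - s)) * ((-1) ^ card {r\<in>T. r < t} * alt_det fs (insert t T)))"
      by (rule sum_Pow_remove[OF X, symmetric])
    also have "\<dots> = (\<Sum>T\<in>Pow X. \<Sum>t\<in>X. real_of_int (sgn (t - s)) * (\<Sum>j<length fs. (-1) ^ j * (fs ! j) t * alt_det (delete_nth j fs) T))"
      by (rule sum.cong[OF refl], rule sum.mono_neutral_cong_left) (auto simp: X alt_det_column[OF finT])
    also have "\<dots> = (\<Sum>t\<in>X. real_of_int (sgn (t - s)) * (\<Sum>T\<in>Pow X. \<Sum>j<length fs. (-1) ^ j * (fs ! j) t * alt_det (delete_nth j fs) T))"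
      by (subst sum.swap) (simp add: sum_distrib_left)
    finally show ?thesis .
  qed
  have "(\<Sum>T\<in>Pow X. \<Sum>j<length fs. (-1) ^ j * (fs ! j) t * alt_det (delete_nth j fs) T) = (\<Sum>j<length fs. (-1) ^ j * (fs ! j) t * subset_sum (delete_nth j fs) X)" for t
    by (subst sum.swap) (simp add: subset_sum_def sum_distrib_left)
  then have "subset_sum (f # fs) X = (\<Sum>s\<in>X. \<Sum>t\<in>X. \<Sum>j<length fs. f s * (real_of_int (sgn (t - s)) * ((-1) ^ j * (fs ! j) t * subset_sum (delete_nth j fs) X)))"
    by (simp add: lhs S sum_distrib_left)
  also have "\<dots> = (\<Sum>s\<in>X. \<Sum>j<length fs. \<Sum>t\<in>X. f s * (real_of_int (sgn (t - s)) * ((-1) ^ j * (fs ! j) t * subset_sum (delete_nth j fs) X)))"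
    by (intro sum.cong refl sum.swap)
  also have "\<dots> = (\<Sum>j<length fs. \<Sum>s\<in>X. \<Sum>t\<in>X. f s * (real_of_int (sgn (t - s)) * ((-1) ^ j * (fs ! j) t * subset_sum (delete_nth j fs) X)))"
    by (rule sum.swap)
  also have "\<dots> = (\<Sum>j<length fs. (-1) ^ j * sgn_form X f (fs ! j) * subset_sum (delete_nth j fs) X)"
    by (simp add: sgn_form_def sum_distrib_left sum_distrib_right mult_ac)
  finally show ?thesis .
qed

text \<open>The form in which the expansion is used: a row that pairs only with its neighbour splits
  off together with it, as one scalar factor.\<close>

lemma subset_sum_expand_first:
  assumes "finite X" "odd (length fs)"
    "\<And>j. 0 < j \<Longrightarrow> j \<le> length gs \<Longrightarrow> sgn_form X f ((g # gs) ! j) = 0" "fs = g # gs"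
  shows "subset_sum (f # fs) X = sgn_form X f g * subset_sum gs X"
proof -
  have "subset_sum (f # fs) X = (\<Sum>j<length fs. if j = 0 then sgn_form X f g * subset_sum gs X else 0)"
    unfolding subset_sum_expand[OF assms(1,2)] using assms(3)
    by (intro sum.cong refl) (auto simp: assms(4))
  then show ?thesis by (simp add: assms(4))
qed

text \<open>Rows are replaced from the last to the first. When row k is treated, all e_j with j < k
  already stand in the prefix, so the lower terms give repeated rows and drop out.\<close>

lemma alt_det_triangular:
  assumes "\<And>i s. i < m \<Longrightarrow> \<psi> i s = c i * e i s + (\<Sum>j<i. d i j * e j s)"
  shows "alt_det (map \<psi> [0..<m]) T = (\<Prod>i<m. c i) * alt_det (map e [0..<m]) T"
proof -
  have "alt_det (map e [0..<k] @ map \<psi> [k..<m]) T = (\<Prod>i\<in>{k..<m}. c i) * alt_det (map e [0..<m]) T" if "k \<le> m" for k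
    using that
  proof (induction k rule: inc_induct)
    case base
    then show ?case by simp
  next
    case (step k)
    let ?pre = "map e [0..<k]" and ?post = "map \<psi> [Suc k..<m]"
    have "\<psi> k = (\<lambda>s. c k * e k s + (\<Sum>j<k. d k j * e j s))" using assms step by auto
    then have "alt_det (?pre @ \<psi> k # ?post) T =
        c k * alt_det (?pre @ e k # ?post) T + (\<Sum>j<k. d k j * alt_det (?pre @ e j # ?post) T)"
      using alt_det_add[where pre = ?pre and post = ?post and f = "\<lambda>s. c k * e k s" and g = "\<lambda>s. \<Sum>j<k. d k j * e j s"]
      by (simp add: alt_det_sum alt_det_scale)
    also have "(\<Sum>j<k. d k j * alt_det (?pre @ e j # ?post) T) = 0"
      by (intro sum.neutral ballI) (simp add: alt_det_repeat)
    finally have "alt_det (?pre @ map \<psi> [k..<m]) T = c k * alt_det (map e [0..<Suc k] @ ?post) T"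
      using step by (simp add: upt_conv_Cons)
    then show ?case using step by (simp add: prod.atLeast_Suc_lessThan)
  qed
  from this[of 0] show ?thesis by (simp add: atLeast0LessThan)
qed

lemma alt_det_poly:
  assumes "\<And>i. i < m \<Longrightarrow> degree (p i) \<le> i"
  shows "alt_det (map (\<lambda>i s. poly (p i) (h s)) [0..<m]) T = (\<Prod>i<m. coeff (p i) i) * alt_det (map (\<lambda>i s. h s ^ i) [0..<m]) T"
proof (rule alt_det_triangular)
  fix i s assume "i < m"
  then have "poly (p i) (h s) = (\<Sum>j\<le>i. coeff (p i) j * h s ^ j)"
    using assms[of i] unfolding poly_altdef by (intro sum.mono_neutral_left) (auto simp: coeff_eq_0)
  then show "poly (p i) (h s) = coeff (p i) i * h s ^ i + (\<Sum>j<i. coeff (p i) j * h s ^ j)"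
    by (simp add: lessThan_Suc_atMost[symmetric])
qed

section \<open>Counting interlacing sequences\<close>

text \<open>Invariance of the determinant under transposition, with both rows and columns indexed by
  ordered sets. The column expansion is taken at the least point \<open>l\<close>, whose rank sign
  is 1, and is matched with the row expansion over \<open>J\<close>.\<close>

lemma alt_det_transpose:
  assumes "finite J" "sorted_wrt (<) ls"
  shows "alt_det (map \<phi> (sorted_list_of_set J)) (set ls) = alt_det (map (\<lambda>l i. \<phi> i l) ls) J"
  using assms
proof (induction ls arbitrary: J)
  case Nil
  then show ?case by (cases "J = {}") (auto simp: alt_det_eq_0)
next
  case (Cons l ls)
  define js where "js = sorted_list_of_set J"
  have js: "sorted_wrt (<) js" "set js = J" "distinct js" using Cons by (auto simp: js_def)
  have l: "l \<notin> set ls" "{s\<in>set ls. s < l} = {}" using Cons by auto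
  have "alt_det (map \<phi> js) (set (l # ls)) = (\<Sum>k<length js. (-1) ^ k * \<phi> (js ! k) l * alt_det (delete_nth k (map \<phi> js)) (set ls))"
    using alt_det_column[of "set ls" "map \<phi> js" l] l by simp
  also have "\<dots> = (\<Sum>k<length js. (-1) ^ card {j\<in>J. j < js ! k} * \<phi> (js ! k) l * alt_det (map (\<lambda>l i. \<phi> i l) ls) (J - {js ! k}))"
  proof (intro sum.cong refl)
    fix k assume k: "k \<in> {..<length js}"
    have e: "js = take k js @ js ! k # drop (Suc k) js" using k by (simp add: id_take_nth_drop)
    then have srt: "sorted_wrt (<) (take k js @ js ! k # drop (Suc k) js)" using js(1) by simp
    then have ord: "\<And>x. x \<in> set (take k js) \<Longrightarrow> x < js ! k" "\<And>x. x \<in> set (drop (Suc k) js) \<Longrightarrow> js ! k < x"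
      unfolding sorted_wrt_append by auto
    have J: "J = set (take k js) \<union> {js ! k} \<union> set (drop (Suc k) js)"
      using arg_cong[OF e, of set] js(2) by auto
    have sd: "sorted_wrt (<) (delete_nth k js)" using srt unfolding delete_nth_def sorted_wrt_append by auto
    have "set (delete_nth k js) = J - {js ! k}" unfolding J delete_nth_def by (auto dest: ord)
    then have "sorted_list_of_set (J - {js ! k}) = delete_nth k js"
      using sd by (metis sorted_list_of_set.idem_if_sorted_distinct strict_sorted_iff)
    moreover have "delete_nth k (map \<phi> js) = map \<phi> (delete_nth k js)" by (simp add: delete_nth_def take_map drop_map)
    moreover have "card {j\<in>J. j < js ! k} = k"
    proof -
      have "{j\<in>J. j < js ! k} = set (take k js)"
        using ord by (subst J) (auto dest: less_asym)
      then show ?thesis using js(3) k by (simp add: distinct_card)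
    qed
    ultimately show "(-1) ^ k * \<phi> (js ! k) l * alt_det (delete_nth k (map \<phi> js)) (set ls) =
        (-1) ^ card {j\<in>J. j < js ! k} * \<phi> (js ! k) l * alt_det (map (\<lambda>l i. \<phi> i l) ls) (J - {js ! k})"
      using Cons.IH[of "J - {js ! k}"] Cons.prems by simp
  qed
  also have "\<dots> = (\<Sum>j\<in>J. (-1) ^ card {i\<in>J. i < j} * \<phi> j l * alt_det (map (\<lambda>l i. \<phi> i l) ls) (J - {j}))"
    by (rule sum.reindex_bij_betw) (use js in \<open>auto simp: bij_betw_def inj_on_nth set_conv_nth\<close>)
  finally show ?case by (simp add: js_def)
qed

text \<open>The half-open condition l < r \<le> l' comes from the numbering of triangles in a
  column: edge l on its right line blocks number 2l + 1 and edge r on its left line blocks 2r. An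
  interlacing row is one shorter, hence no row for the empty list.\<close>

fun interlacing :: "int list \<Rightarrow> int list set" where
  "interlacing [] = {}"
| "interlacing [l] = {[]}"
| "interlacing (l # l' # ls) = (\<Union>r\<in>{l<..l'}. (#) r ` interlacing (l' # ls))"

lemma interlacing_finite: "finite (interlacing ls)"
  by (induction ls rule: interlacing.induct) auto

lemma interlacing_bounds: "rs \<in> interlacing (l # ls) \<Longrightarrow> sorted_wrt (<) (l # ls) \<Longrightarrow>
    r \<in> set rs \<Longrightarrow> l < r \<and> r \<le> last (l # ls)"
proof (induction ls arbitrary: rs l)
  case (Cons l' ls)
  then obtain r' rs' where rs: "rs = r' # rs'" "l < r'" "r' \<le> l'" "rs' \<in> interlacing (l' # ls)" by auto
  have "l' \<le> last (l' # ls)"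
    using Cons.prems(2) by (cases ls rule: rev_cases) (auto simp: less_imp_le)
  then show ?case using Cons rs by fastforce
qed auto

lemma interlacing_sorted: "rs \<in> interlacing ls \<Longrightarrow> sorted_wrt (<) ls \<Longrightarrow> sorted_wrt (<) rs"
proof (induction ls arbitrary: rs rule: interlacing.induct)
  case (3 l l' ls)
  then obtain r rs' where rs: "rs = r # rs'" "r \<le> l'" "rs' \<in> interlacing (l' # ls)" by auto
  then show ?case using 3 interlacing_bounds[OF rs(3)] by fastforce
qed auto

lemma sum_interlacing_Cons:
  "(\<Sum>rs\<in>interlacing (l # l' # ls). h rs) = (\<Sum>r\<in>{l<..l'}. \<Sum>rs\<in>interlacing (l' # ls). (h (r # rs) :: real))"
  by (simp, subst sum.UNION_disjoint) (auto simp: sum.reindex interlacing_finite)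

fun diffs :: "('c \<Rightarrow> int \<Rightarrow> real) \<Rightarrow> int \<Rightarrow> int list \<Rightarrow> ('c \<Rightarrow> real) list" where
  "diffs \<phi> l [] = []"
| "diffs \<phi> l (l' # ls) = (\<lambda>i. \<phi> i l' - \<phi> i l) # diffs \<phi> l' ls"

text \<open>Differences are resolved from left to right, so the row that each one subtracts already
  stands directly before it.\<close>

lemma alt_det_diffs: "alt_det (pre @ (\<lambda>i. \<phi> i l) # diffs \<phi> l ls) T = alt_det (pre @ map (\<lambda>l i. \<phi> i l) (l # ls)) T"
proof (induction ls arbitrary: pre l)
  case (Cons l' ls)
  have "alt_det (pre @ (\<lambda>i. \<phi> i l) # diffs \<phi> l (l' # ls)) T =
     alt_det ((pre @ [\<lambda>i. \<phi> i l]) @ (\<lambda>i. \<phi> i l' - \<phi> i l) # diffs \<phi> l' ls) T" by simp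
  also have "\<dots> = alt_det ((pre @ [\<lambda>i. \<phi> i l]) @ (\<lambda>i. \<phi> i l') # diffs \<phi> l' ls) T"
    using alt_det_adjacent[of pre "\<lambda>i. \<phi> i l" "diffs \<phi> l' ls" T] by (simp only: alt_det_diff) simp
  finally show ?case using Cons[of "pre @ [\<lambda>i. \<phi> i l]" l'] by simp
qed simp

lemma map_diffs: "map (\<lambda>f i. f (h i)) (diffs \<phi> l ls) = diffs (\<lambda>i. \<phi> (h i)) l ls"
  by (induction ls arbitrary: l) auto

lemma diffs_vanish: "(\<And>l. \<phi> i l = (c::real)) \<Longrightarrow> f \<in> set (diffs \<phi> l ls) \<Longrightarrow> f i = 0"
  by (induction ls arbitrary: l) auto

lemma alt_det_diffs_sum:
  assumes "\<And>i l l'. l < l' \<Longrightarrow> \<phi> i l' - \<phi> i l = (\<Sum>r\<in>{l<..l'}. \<psi> i r)" "sorted_wrt (<) (l # ls)"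
  shows "alt_det (pre @ diffs \<phi> l ls) T = (\<Sum>rs\<in>interlacing (l # ls). alt_det (pre @ map (\<lambda>r i. \<psi> i r) rs) T)"
  using assms(2)
proof (induction ls arbitrary: pre l)
  case (Cons l' ls)
  have "alt_det (pre @ diffs \<phi> l (l' # ls)) T = alt_det (pre @ (\<lambda>i. \<Sum>r\<in>{l<..l'}. 1 * \<psi> i r) # diffs \<phi> l' ls) T"
    using assms(1)[of l l'] Cons by simp
  also have "\<dots> = (\<Sum>r\<in>{l<..l'}. 1 * alt_det (pre @ (\<lambda>i. \<psi> i r) # diffs \<phi> l' ls) T)"
    by (rule alt_det_sum)
  also have "\<dots> = (\<Sum>r\<in>{l<..l'}. alt_det ((pre @ [\<lambda>i. \<psi> i r]) @ diffs \<phi> l' ls) T)" by simp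
  also have "\<dots> = (\<Sum>r\<in>{l<..l'}. \<Sum>rs\<in>interlacing (l' # ls). alt_det ((pre @ [\<lambda>i. \<psi> i r]) @ map (\<lambda>r i. \<psi> i r) rs) T)"
    using Cons by (intro sum.cong refl Cons.IH) auto
  finally show ?case by (subst sum_interlacing_Cons) simp
qed simp

text \<open>Transpose and take differences of neighbouring points. The constant function becomes (1,
  0, ..., 0), which lowers the size by one; every other difference telescopes to a sum over the
  half-open interval between the two points, and multilinearity turns the product of these sums into
  a sum over interlacing rows.\<close>

lemma alt_det_interlacing:
  fixes \<phi> :: "nat \<Rightarrow> int \<Rightarrow> real"
  assumes "\<And>l. \<phi> 0 l = 1" "\<And>i l. \<phi> (Suc i) l - \<phi> (Suc i) (l - 1) = \<phi> i l"
    "sorted_wrt (<) ls"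
  shows "alt_det (map \<phi> [0..<Suc m]) (set ls) = (\<Sum>rs\<in>interlacing ls. alt_det (map \<phi> [0..<m]) (set rs))"
proof (cases ls)
  case Nil
  then show ?thesis by (simp add: alt_det_eq_0)
next
  case (Cons l ls')
  have tele: "\<phi> (Suc i) l' - \<phi> (Suc i) l = (\<Sum>r\<in>{l<..l'}. \<phi> i r)" if "l < l'" for i l l'
  proof -
    have "\<phi> (Suc i) k - \<phi> (Suc i) l = (\<Sum>r\<in>{l<..k}. \<phi> i r)" if "l \<le> k" for k
      using that
    proof (induction k rule: int_ge_induct)
      case (step k)
      have "{l<..k + 1} = insert (k + 1) {l<..k}" using step by auto
      then show ?case using step assms(2)[of i "k + 1"] by simp
    qed simp
    then show ?thesis using that by simp
  qed
  have up: "sorted_list_of_set {0..<Suc m} = [0..<Suc m]" for m by simp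
  have "alt_det (map \<phi> [0..<Suc m]) (set ls) = alt_det (map (\<lambda>l i. \<phi> i l) ls) {0..<Suc m}"
    using alt_det_transpose[of "{0..<Suc m}" ls \<phi>] assms(3) unfolding up by simp
  also have "\<dots> = alt_det ((\<lambda>i. \<phi> i l) # diffs \<phi> l ls') {0..<Suc m}"
    using alt_det_diffs[where pre = "[]" and \<phi> = \<phi> and l = l and ls = ls' and T = "{0..<Suc m}"] Cons by simp
  also have "\<dots> = (\<Sum>s\<in>{0..<Suc m}. (-1) ^ card {t \<in> {0..<Suc m}. t < s} * \<phi> s l * alt_det (diffs \<phi> l ls') ({0..<Suc m} - {s}))"
    by (rule alt_det.simps(2))
  also have "\<dots> = alt_det (diffs \<phi> l ls') ({0..<Suc m} - {0})"
  proof -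
    \<comment> \<open>A minor that keeps the index 0 has only zeros there, because
      \<open>\<phi> 0\<close> is constant; only the term s = 0 of the first row survives.\<close>
    have "alt_det (diffs \<phi> l ls') ({0..<Suc m} - {s}) = 0" if "s \<noteq> 0" for s
      by (rule alt_det_all_zero[where t = 0]) (use that diffs_vanish[where \<phi> = \<phi> and i = 0 and c = 1, OF assms(1)] in auto)
    then have "(\<Sum>s\<in>{0..<Suc m}. (-1) ^ card {t \<in> {0..<Suc m}. t < s} * \<phi> s l * alt_det (diffs \<phi> l ls') ({0..<Suc m} - {s})) =
      (\<Sum>s\<in>{0..<Suc m}. if s = 0 then alt_det (diffs \<phi> l ls') ({0..<Suc m} - {0}) else 0)"
      by (intro sum.cong refl) (simp add: assms(1))
    then show ?thesis by simp
  qed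
  also have "{0..<Suc m} - {0} = Suc ` {0..<m}" by (auto simp: image_Suc_atLeastLessThan)
  also have "alt_det (diffs \<phi> l ls') (Suc ` {0..<m}) = alt_det (diffs (\<lambda>i. \<phi> (Suc i)) l ls') {0..<m}"
    by (subst alt_det_reindex) (auto simp: strict_mono_def map_diffs)
  also have "\<dots> = (\<Sum>rs\<in>interlacing ls. alt_det (map (\<lambda>r i. \<phi> i r) rs) {0..<m})"
    using alt_det_diffs_sum[where pre = "[]" and \<phi> = "\<lambda>i. \<phi> (Suc i)" and \<psi> = \<phi> and l = l and ls = ls'] tele assms(3) Cons
    by simp
  also have "\<dots> = (\<Sum>rs\<in>interlacing ls. alt_det (map \<phi> [0..<m]) (set rs))"
  proof (intro sum.cong refl)
    fix rs assume "rs \<in> interlacing ls"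
    then have "sorted_wrt (<) rs" using interlacing_sorted assms(3) by blast
    then show "alt_det (map (\<lambda>r i. \<phi> i r) rs) {0..<m} = alt_det (map \<phi> [0..<m]) (set rs)"
      using alt_det_transpose[of "{0..<m}" rs \<phi>] by simp
  qed
  finally show ?thesis .
qed

lemma pochhammer_diff:
  "pochhammer (real_of_int l) (Suc i) / fact (Suc i) - pochhammer (real_of_int (l - 1)) (Suc i) / fact (Suc i)
    = pochhammer (real_of_int l) i / fact i"
proof -
  have "pochhammer (real_of_int l) (Suc i) = pochhammer (real_of_int l) i * (real_of_int l + real i)"
    by (simp add: pochhammer_Suc)
  moreover have "pochhammer (real_of_int (l - 1)) (Suc i) = (real_of_int l - 1) * pochhammer (real_of_int l) i"
    by (simp add: pochhammer_rec)
  ultimately have "pochhammer (real_of_int l) (Suc i) - pochhammer (real_of_int (l - 1)) (Suc i) = real (Suc i) * pochhammer (real_of_int l) i"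
    by (simp add: algebra_simps)
  then show ?thesis by (simp add: diff_divide_distrib[symmetric] del: of_nat_Suc)
qed

section \<open>Tilings of regions\<close>

definition Rt :: "int \<Rightarrow> int \<Rightarrow> pt set" where
  "Rt u v = {(u, v), (u, v + 1), (u + 1, v)}"

definition Lt :: "int \<Rightarrow> int \<Rightarrow> pt set" where
  "Lt u v = {(u, v + 1), (u + 1, v), (u + 1, v + 1)}"

lemma mem_Rt: "p \<in> Rt u v \<longleftrightarrow> u \<le> fst p \<and> v \<le> snd p \<and> fst p + snd p \<le> u + v + 1"
  by (cases p) (auto simp: Rt_def)

lemma mem_Lt: "p \<in> Lt u v \<longleftrightarrow> fst p \<le> u + 1 \<and> snd p \<le> v + 1 \<and> u + v + 1 \<le> fst p + snd p"
  by (cases p) (auto simp: Lt_def)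

text \<open>Two distinct vertices determine a triangle of known orientation. Hence distinct
  triangles of equal orientation share at most one vertex.\<close>

lemma Rt_min:
  assumes "p \<in> Rt u v" "q \<in> Rt u v" "p \<noteq> q"
  shows "u = min (fst p) (fst q)" "v = min (snd p) (snd q)"
  using assms unfolding Rt_def by (elim insertE emptyE; simp)+

lemma Lt_max:
  assumes "p \<in> Lt u v" "q \<in> Lt u v" "p \<noteq> q"
  shows "u = max (fst p) (fst q) - 1" "v = max (snd p) (snd q) - 1"
  using assms unfolding Lt_def by (elim insertE emptyE; simp)+

lemma Rt_Lt_two:
  assumes "p \<in> Rt u v" "q \<in> Rt u v" "p \<in> Lt u' v'" "q \<in> Lt u' v'" "p \<noteq> q"
  shows "u' = u - 1 \<and> v' = v \<or> u' = u \<and> v' = v - 1 \<or> u' = u \<and> v' = v"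
  using assms(1,2,5) unfolding Lt_max[OF assms(3-5)] Rt_def by (elim insertE emptyE; simp)

lemma Rt_inject [simp]: "Rt u v = Rt u' v' \<longleftrightarrow> u = u' \<and> v = v'"
proof
  assume eq: "Rt u v = Rt u' v'"
  have "(u, v) \<in> Rt u v" "(u, v + 1) \<in> Rt u v" by (auto simp: Rt_def)
  then have "(u, v) \<in> Rt u' v'" "(u, v + 1) \<in> Rt u' v'" by (simp_all only: eq)
  from Rt_min[OF this] show "u = u' \<and> v = v'" by simp
qed simp

lemma Lt_inject [simp]: "Lt u v = Lt u' v' \<longleftrightarrow> u = u' \<and> v = v'"
proof
  assume eq: "Lt u v = Lt u' v'"
  have "(u, v + 1) \<in> Lt u v" "(u + 1, v) \<in> Lt u v" by (auto simp: Lt_def)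
  then have "(u, v + 1) \<in> Lt u' v'" "(u + 1, v) \<in> Lt u' v'" by (simp_all only: eq)
  from Lt_max[OF this] show "u = u' \<and> v = v'" by simp
qed simp

lemma Rt_neq_Lt [simp]: "Rt u v \<noteq> Lt u' v'" "Lt u' v' \<noteq> Rt u v"
proof -
  have False if "Rt u v = Lt u' v'"
  proof -
    have "(u, v) \<in> Lt u' v'" "(u, v + 1) \<in> Lt u' v'" "(u + 1, v) \<in> Lt u' v'"
      unfolding that[symmetric] by (auto simp: Rt_def)
    moreover have "(u', v' + 1) \<in> Rt u v" "(u' + 1, v') \<in> Rt u v" "(u' + 1, v' + 1) \<in> Rt u v"
      unfolding that by (auto simp: Lt_def)
    ultimately show False by (auto simp: mem_Rt mem_Lt)
  qed
  then show "Rt u v \<noteq> Lt u' v'" "Lt u' v' \<noteq> Rt u v" by auto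
qed

lemma unit_triangle_iff: "unit_triangle t \<longleftrightarrow> (\<exists>u v. t = Rt u v \<or> t = Lt u v)"
  by (simp add: unit_triangle_def Rt_def Lt_def)

text \<open>The rhombus whose short diagonal is the vertical unit edge from (u, v) to (u, v +
  1).\<close>

definition hor :: "int \<Rightarrow> int \<Rightarrow> pt set set" where
  "hor u v = {Lt (u - 1) v, Rt u v}"

text \<open>The triangles of the column between the lines \<open>u\<close> and \<open>u + 1\<close>, numbered from bottom to top;
  consecutive ones form the rhombi that do not cross a vertical lattice line.\<close>

definition node :: "int \<Rightarrow> int \<Rightarrow> pt set" where
  "node u p = (if even p then Rt u (p div 2) else Lt u (p div 2))"

definition vert :: "int \<Rightarrow> int \<Rightarrow> pt set set" where
  "vert u p = {node u p, node u (p + 1)}"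

lemma node_inject [simp]: "node u p = node u' p' \<longleftrightarrow> u = u' \<and> p = p'"
proof
  assume "node u p = node u' p'"
  then have "even p = even p' \<and> u = u' \<and> p div 2 = p' div 2"
    by (simp add: node_def split: if_splits)
  then show "u = u' \<and> p = p'" by presburger
qed simp

lemma node_Rt: "node u (2 * v) = Rt u v" and node_Lt: "node u (2 * v + 1) = Lt u v"
  by (simp_all add: node_def)

section \<open>Classification of unit rhombi\<close>

lemma card_2_obtain: "card A = 2 \<Longrightarrow> (\<And>p q. p \<in> A \<Longrightarrow> q \<in> A \<Longrightarrow> p \<noteq> q \<Longrightarrow> thesis) \<Longrightarrow> thesis"
  by (auto simp: card_2_iff)

lemma card_Rt: "card (Rt u v) = 3" and card_Lt: "card (Lt u v) = 3"
  by (auto simp: Rt_def Lt_def)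

lemma rhombus_Rt_Lt:
  assumes "card (Rt u v \<inter> Lt u' v') = 2"
  shows "(\<exists>u2 v2. {Rt u v, Lt u' v'} = hor u2 v2) \<or> (\<exists>u2 p. {Rt u v, Lt u' v'} = vert u2 p)"
proof -
  obtain p q where "p \<in> Rt u v" "q \<in> Rt u v" "p \<in> Lt u' v'" "q \<in> Lt u' v'" "p \<noteq> q"
    using card_2_obtain[OF assms] by blast
  then consider "u' = u - 1" "v' = v" | "u' = u" "v' = v - 1" | "u' = u" "v' = v"
    using Rt_Lt_two by blast
  then show ?thesis
  proof cases
    case 1
    then have "{Rt u v, Lt u' v'} = hor u v" by (auto simp: hor_def)
    then show ?thesis by blast
  next
    case 2
    then have "{Rt u v, Lt u' v'} = vert u (2 * (v - 1) + 1)"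
      using node_Rt[of u v] node_Lt[of u "v - 1"] by (auto simp: vert_def)
    then show ?thesis by blast
  next
    case 3
    then have "{Rt u v, Lt u' v'} = vert u (2 * v)"
      using node_Rt[of u v] node_Lt[of u v] by (auto simp: vert_def)
    then show ?thesis by blast
  qed
qed

text \<open>Triangles of equal orientation that share two vertices coincide and then share three, so
  the two halves have opposite orientation. The three possible relative positions give
  \<open>hor\<close> and the two parities of \<open>vert\<close>.\<close>

lemma unit_rhombus_iff: "unit_rhombus r \<longleftrightarrow> (\<exists>u v. r = hor u v) \<or> (\<exists>u p. r = vert u p)"
proof
  assume "unit_rhombus r"
  then obtain s t where r: "r = {s, t}" "unit_triangle s" "unit_triangle t" "card (s \<inter> t) = 2"
    by (auto simp: unit_rhombus_def)
  consider u v u' v' where "s = Rt u v" "t = Rt u' v'" | u v u' v' where "s = Lt u v" "t = Lt u' v'"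
    | u v u' v' where "s = Rt u v" "t = Lt u' v'" | u v u' v' where "s = Lt u v" "t = Rt u' v'"
    using r(2,3) unfolding unit_triangle_iff by blast
  then show "(\<exists>u v. r = hor u v) \<or> (\<exists>u p. r = vert u p)"
  proof cases
    case 1
    obtain p q where "p \<in> s \<inter> t" "q \<in> s \<inter> t" "p \<noteq> q" using card_2_obtain[OF r(4)] by blast
    then have "s = t" using 1 Rt_min[of p u v q] Rt_min[of p u' v' q] by simp
    then show ?thesis using r 1 card_Rt by simp
  next
    case 2
    obtain p q where "p \<in> s \<inter> t" "q \<in> s \<inter> t" "p \<noteq> q" using card_2_obtain[OF r(4)] by blast
    then have "s = t" using 2 Lt_max[of p u v q] Lt_max[of p u' v' q] by simp
    then show ?thesis using r 2 card_Lt by simp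
  next
    case 3
    then show ?thesis using rhombus_Rt_Lt r by blast
  next
    case 4
    then show ?thesis using rhombus_Rt_Lt[of u' v' u v] r by (simp add: Int_commute insert_commute)
  qed
next
  have "unit_rhombus (hor u v)" for u v
  proof -
    have "Lt (u - 1) v \<inter> Rt u v = {(u, v), (u, v + 1)}" by (auto simp: Rt_def Lt_def)
    then show ?thesis unfolding unit_rhombus_def hor_def unit_triangle_iff
      by (intro exI[of _ "Lt (u - 1) v"] exI[of _ "Rt u v"]) auto
  qed
  moreover have "unit_rhombus (vert u p)" for u p
  proof (cases "even p")
    case True
    then obtain v where p: "p = 2 * v" by blast
    have "Rt u v \<inter> Lt u v = {(u, v + 1), (u + 1, v)}" by (auto simp: Rt_def Lt_def)
    then show ?thesis unfolding unit_rhombus_def vert_def unit_triangle_iff p node_Rt node_Lt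
      by (intro exI[of _ "Rt u v"] exI[of _ "Lt u v"]) auto
  next
    case False
    then obtain v where p: "p = 2 * v + 1" using oddE by blast
    have "p + 1 = 2 * (v + 1)" using p by simp
    then have e: "node u (p + 1) = Rt u (v + 1)" by (simp only: node_Rt)
    have "Lt u v \<inter> Rt u (v + 1) = {(u, v + 1), (u + 1, v + 1)}" by (auto simp: Rt_def Lt_def)
    then show ?thesis unfolding unit_rhombus_def vert_def unit_triangle_iff e unfolding p node_Lt
      by (intro exI[of _ "Lt u v"] exI[of _ "Rt u (v + 1)"]) auto
  qed
  moreover assume "(\<exists>u v. r = hor u v) \<or> (\<exists>u p. r = vert u p)"
  ultimately show "unit_rhombus r" by auto
qed

text \<open>Exact covers of an arbitrary region, so that the hexagon can be cut into pieces whose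
  tilings are combined and restricted freely.\<close>

definition tilings_of :: "pt set set \<Rightarrow> pt set set set set" where
  "tilings_of A = {T. (\<forall>r\<in>T. unit_rhombus r) \<and> \<Union>T = A \<and> (\<forall>r\<in>T. \<forall>r'\<in>T. r \<inter> r' \<noteq> {} \<longrightarrow> r = r')}"

lemma tilings_ofI: "(\<And>r. r \<in> T \<Longrightarrow> unit_rhombus r) \<Longrightarrow> \<Union>T = A \<Longrightarrow>
   (\<And>r r' t. r \<in> T \<Longrightarrow> r' \<in> T \<Longrightarrow> t \<in> r \<Longrightarrow> t \<in> r' \<Longrightarrow> r = r') \<Longrightarrow> T \<in> tilings_of A"
  by (auto simp: tilings_of_def)

lemma tilings_ofD:
  assumes "T \<in> tilings_of A"
  shows "r \<in> T \<Longrightarrow> unit_rhombus r" "\<Union>T = A" "r \<in> T \<Longrightarrow> r' \<in> T \<Longrightarrow> t \<in> r \<Longrightarrow> t \<in> r' \<Longrightarrow> r = r'"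
  using assms by (auto simp: tilings_of_def)

lemma rhombus_tiling_iff: "rhombus_tiling a b c T \<longleftrightarrow> T \<in> tilings_of (hex_triangles a b c)"
proof
  assume "rhombus_tiling a b c T"
  then have 1: "\<And>r. r \<in> T \<Longrightarrow> unit_rhombus r \<and> r \<subseteq> hex_triangles a b c"
    and 2: "\<And>t. t \<in> hex_triangles a b c \<Longrightarrow> \<exists>!r. r \<in> T \<and> t \<in> r"
    by (auto simp: rhombus_tiling_def)
  show "T \<in> tilings_of (hex_triangles a b c)"
  proof (rule tilings_ofI)
    show "\<Union>T = hex_triangles a b c" using 1 2 by blast
  qed (use 1 2 in blast)+
next
  assume T: "T \<in> tilings_of (hex_triangles a b c)"
  show "rhombus_tiling a b c T" unfolding rhombus_tiling_def
  proof (intro conjI ballI)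
    fix r assume "r \<in> T" then show "unit_rhombus r" "r \<subseteq> hex_triangles a b c" using tilings_ofD[OF T] by auto
  next
    fix t assume "t \<in> hex_triangles a b c"
    then obtain r where "r \<in> T" "t \<in> r" using tilings_ofD(2)[OF T] by blast
    then show "\<exists>!r. r \<in> T \<and> t \<in> r" using tilings_ofD(3)[OF T] by blast
  qed
qed

lemma tilings_of_Un:
  assumes "T \<in> tilings_of A" "T' \<in> tilings_of B" "A \<inter> B = {}"
  shows "T \<union> T' \<in> tilings_of (A \<union> B)"
proof (rule tilings_ofI)
  fix r r' t assume "r \<in> T \<union> T'" "r' \<in> T \<union> T'" "t \<in> r" "t \<in> r'"
  moreover have "t \<in> A" if "r \<in> T" "t \<in> r" for r using tilings_ofD(2)[OF assms(1)] that by blast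
  moreover have "t \<in> B" if "r \<in> T'" "t \<in> r" for r using tilings_ofD(2)[OF assms(2)] that by blast
  ultimately show "r = r'" using tilings_ofD(3)[OF assms(1)] tilings_ofD(3)[OF assms(2)] assms(3) by blast
qed (use tilings_ofD[OF assms(1)] tilings_ofD[OF assms(2)] in auto)

lemma tilings_of_subset:
  assumes "T \<in> tilings_of A" "C \<subseteq> T" "\<Union>C = B"
  shows "C \<in> tilings_of B"
proof (rule tilings_ofI)
  fix r r' t assume "r \<in> C" "r' \<in> C" "t \<in> r" "t \<in> r'"
  then show "r = r'" using tilings_ofD(3)[OF assms(1), of r r' t] assms(2) by blast
qed (use assms tilings_ofD(1)[OF assms(1)] in auto)

lemma rhombus_nonempty: "unit_rhombus r \<Longrightarrow> r \<noteq> {}"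
  by (auto simp: unit_rhombus_def)

lemma tilings_of_empty: "tilings_of {} = {{}}"
proof -
  have "T = {}" if "T \<in> tilings_of {}" for T
  proof (rule ccontr)
    assume "T \<noteq> {}"
    then obtain r where "r \<in> T" by blast
    moreover have "r = {}" using \<open>r \<in> T\<close> tilings_ofD(2)[OF that] by auto
    ultimately show False using tilings_ofD(1)[OF that] rhombus_nonempty by blast
  qed
  then show ?thesis by (auto simp: tilings_of_def)
qed

lemma finite_tilings_of: "finite A \<Longrightarrow> finite (tilings_of A)"
  by (rule finite_subset[of _ "Pow (Pow A)"]) (auto simp: tilings_of_def)

section \<open>Domino tilings of a row with holes\<close>

text \<open>Perfect matchings of \<open>Y\<close> into pairs of consecutive integers, each recorded
  by its set \<open>M\<close> of lower ends.\<close>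

definition row_match :: "int set \<Rightarrow> int set set" where
  "row_match Y = {M. M \<inter> (\<lambda>p. p + 1) ` M = {} \<and> M \<union> (\<lambda>p. p + 1) ` M = Y}"

lemma row_match_mem:
  assumes "M \<in> row_match Y" shows "p \<in> M \<longleftrightarrow> p \<in> Y \<and> p - 1 \<notin> M"
proof -
  have "p \<in> (\<lambda>p. p + 1) ` M \<longleftrightarrow> p - 1 \<in> M" by force
  moreover have "M \<inter> (\<lambda>p. p + 1) ` M = {}" "M \<union> (\<lambda>p. p + 1) ` M = Y"
    using assms by (auto simp: row_match_def)
  ultimately show ?thesis by blast
qed

text \<open>A point is a lower end iff it lies in \<open>Y\<close> and its predecessor is not a
  lower end; below the minimum there are none, so everything above is forced.\<close>

lemma row_match_unique:
  assumes "finite Y" "M \<in> row_match Y" "M' \<in> row_match Y" shows "M = M'"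
proof -
  obtain lo where lo: "\<And>p. p \<in> Y \<Longrightarrow> lo \<le> p" using Min_le[OF assms(1)] by blast
  have "p \<in> M \<longleftrightarrow> p \<in> M'" if "lo - 1 \<le> p" for p
    using that
  proof (induction p rule: int_ge_induct)
    case base
    have "lo - 1 \<notin> Y" using lo[of "lo - 1"] by auto
    then show ?case using row_match_mem[OF assms(2), of "lo - 1"] row_match_mem[OF assms(3), of "lo - 1"] by simp
  next
    case (step p)
    then show ?case using row_match_mem[OF assms(2), of "p + 1"] row_match_mem[OF assms(3), of "p + 1"] by simp
  qed
  moreover have "p \<notin> M \<and> p \<notin> M'" if "\<not> lo - 1 \<le> p" for p
  proof -
    have "p \<notin> Y" using that lo[of p] by auto
    then show ?thesis using row_match_mem[OF assms(2), of p] row_match_mem[OF assms(3), of p] by simp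
  qed
  ultimately show ?thesis by blast
qed

lemma row_match_mem_iff: "M \<in> row_match Y \<longleftrightarrow> (\<forall>p. p \<in> M \<longrightarrow> p - 1 \<notin> M) \<and> (\<forall>p. p \<in> Y \<longleftrightarrow> p \<in> M \<or> p - 1 \<in> M)"
proof -
  have "p \<in> (\<lambda>p. p + 1) ` M \<longleftrightarrow> p - 1 \<in> M" for p by force
  then show ?thesis unfolding row_match_def set_eq_iff by auto
qed

lemma row_match_min:
  assumes "p \<in> Y" "\<And>q. q \<in> Y \<Longrightarrow> p \<le> q"
  shows "row_match Y \<noteq> {} \<longleftrightarrow> p + 1 \<in> Y \<and> row_match (Y - {p, p + 1}) \<noteq> {}"
proof
  assume "row_match Y \<noteq> {}"
  then obtain M where M: "M \<in> row_match Y" by blast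
  then have m: "q \<in> M \<Longrightarrow> q - 1 \<notin> M" "q \<in> Y \<longleftrightarrow> q \<in> M \<or> q - 1 \<in> M" for q
    by (auto simp: row_match_mem_iff)
  have pm: "p - 1 \<notin> M" using assms(2)[of "p - 1"] m(2)[of "p - 1"] by auto
  then have p: "p \<in> M" using m(2)[of p] assms(1) by simp
  have p1: "p + 1 \<notin> M" using m(1)[of "p + 1"] p by auto
  have "M - {p} \<in> row_match (Y - {p, p + 1})"
    unfolding row_match_mem_iff
  proof (intro conjI allI)
    fix q
    show "q \<in> M - {p} \<longrightarrow> q - 1 \<notin> M - {p}" using m(1)[of q] by blast
    consider "q = p" | "q = p + 1" | "q \<noteq> p" "q - 1 \<noteq> p" "q \<noteq> p + 1" by linarith
    then show "q \<in> Y - {p, p + 1} \<longleftrightarrow> q \<in> M - {p} \<or> q - 1 \<in> M - {p}"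
      by cases (use p p1 pm m(2)[of q] in auto)
  qed
  then show "p + 1 \<in> Y \<and> row_match (Y - {p, p + 1}) \<noteq> {}" using m(2)[of "p + 1"] p by auto
next
  assume a: "p + 1 \<in> Y \<and> row_match (Y - {p, p + 1}) \<noteq> {}"
  then obtain M where M: "M \<in> row_match (Y - {p, p + 1})" by blast
  then have m: "q \<in> M \<Longrightarrow> q - 1 \<notin> M" "q \<in> Y - {p, p + 1} \<longleftrightarrow> q \<in> M \<or> q - 1 \<in> M" for q
    unfolding row_match_mem_iff by blast+
  have no: "p - 1 \<notin> M" "p \<notin> M" "p + 1 \<notin> M"
    using m(2)[of "p - 1"] m(2)[of p] m(2)[of "p + 1"] assms(2)[of "p - 1"] by auto
  have "insert p M \<in> row_match Y"
    unfolding row_match_mem_iff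
  proof (intro conjI allI)
    fix q
    show "q \<in> insert p M \<longrightarrow> q - 1 \<notin> insert p M"
    proof (cases "q = p \<or> q = p + 1")
      case False
      then have "q - 1 \<noteq> p" by auto
      then show ?thesis using False m(1)[of q] by auto
    qed (use no in auto)
    consider "q = p" | "q = p + 1" | "q \<noteq> p" "q - 1 \<noteq> p" "q \<noteq> p + 1" by linarith
    then show "q \<in> Y \<longleftrightarrow> q \<in> insert p M \<or> q - 1 \<in> insert p M"
      by cases (use a assms(1) no m(2)[of q] in auto)
  qed
  then show "row_match Y \<noteq> {}" by blast
qed

text \<open>The point \<open>e\<close> belongs to neither piece, so no pair joins them; the least
  remaining point of the run is always matched with its successor, which removes the run two points
  at a time.\<close>

lemma row_match_run:
  assumes "lo \<le> e" "\<And>q. q \<in> Y \<Longrightarrow> e < q"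
  shows "row_match ({lo..<e} \<union> Y) \<noteq> {} \<longleftrightarrow> even (e - lo) \<and> row_match Y \<noteq> {}"
  using assms(1)
proof (induction "nat (e - lo)" arbitrary: lo rule: less_induct)
  case less
  consider "lo = e" | "e = lo + 1" | "lo + 2 \<le> e" using less.prems by linarith
  then show ?case
  proof cases
    case 1
    then show ?thesis by simp
  next
    case 2
    have eq: "{lo..<e} = {lo}" using 2 by auto
    have "row_match ({lo..<e} \<union> Y) = {}"
      using row_match_min[of lo "{lo..<e} \<union> Y"] assms(2)[of "lo + 1"] assms(2) 2 eq by fastforce
    then show ?thesis using 2 by simp
  next
    case 3
    have "row_match ({lo..<e} \<union> Y) \<noteq> {} \<longleftrightarrow> row_match ({lo..<e} \<union> Y - {lo, lo + 1}) \<noteq> {}"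
      using row_match_min[of lo "{lo..<e} \<union> Y"] assms(2) 3 by fastforce
    also have "{lo..<e} \<union> Y - {lo, lo + 1} = {lo + 2..<e} \<union> Y"
      using assms(2) 3 by fastforce
    also have "row_match \<dots> \<noteq> {} \<longleftrightarrow> even (e - (lo + 2)) \<and> row_match Y \<noteq> {}"
      using 3 by (intro less.hyps) auto
    finally show ?thesis by simp
  qed
qed

text \<open>Triangle numbers of one column from \<open>m\<close> upwards, minus those used by
  horizontal rhombi: \<open>B\<close> lists the edges crossed on the left line (right-pointing
  triangles, even numbers), \<open>A\<close> those on the right line (left-pointing triangles, odd
  numbers).\<close>

definition holes :: "int \<Rightarrow> int \<Rightarrow> int set \<Rightarrow> int set \<Rightarrow> int set" where
  "holes b m A B = {p. m \<le> p \<and> p < 2 * b \<and> (even p \<longrightarrow> p div 2 \<notin> B) \<and> (odd p \<longrightarrow> p div 2 \<notin> A)}"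

section \<open>Runs between consecutive holes\<close>

lemma holes_even:
  assumes "m \<le> 2 * r" "r < b" "\<And>x. x \<in> B \<Longrightarrow> r < x" "\<And>x. x \<in> A \<Longrightarrow> r \<le> x"
  shows "holes b m A (insert r B) = {m..<2 * r} \<union> holes b (2 * r + 1) A B"
proof (intro set_eqI)
  fix p
  have "p < 2 * r \<and> p div 2 < r \<or> p = 2 * r \<or> 2 * r < p \<and> (even p \<longrightarrow> p div 2 \<noteq> r)" by presburger
  then consider "p < 2 * r" "p div 2 < r" | "p = 2 * r" | "2 * r < p" "even p \<longrightarrow> p div 2 \<noteq> r" by blast
  then show "p \<in> holes b m A (insert r B) \<longleftrightarrow> p \<in> {m..<2 * r} \<union> holes b (2 * r + 1) A B"
  proof cases
    case 1
    then have "p div 2 \<notin> A" "p div 2 \<notin> B" "p div 2 \<noteq> r" using assms(3)[of "p div 2"] assms(4)[of "p div 2"] by auto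
    then show ?thesis using 1 assms(2) by (auto simp: holes_def)
  qed (use assms in \<open>auto simp: holes_def\<close>)
qed

lemma holes_odd:
  assumes "m \<le> 2 * l + 1" "l < b" "\<And>x. x \<in> A \<Longrightarrow> l < x" "\<And>x. x \<in> B \<Longrightarrow> l < x"
  shows "holes b m (insert l A) B = {m..<2 * l + 1} \<union> holes b (2 * l + 2) A B"
proof (intro set_eqI)
  fix p
  have "p < 2 * l + 1 \<and> (p div 2 < l \<or> p div 2 = l \<and> even p) \<or> p = 2 * l + 1
    \<or> 2 * l + 1 < p \<and> (odd p \<longrightarrow> p div 2 \<noteq> l)" by presburger
  then consider "p < 2 * l + 1" "p div 2 < l \<or> p div 2 = l \<and> even p" | "p = 2 * l + 1"
    | "2 * l + 1 < p" "odd p \<longrightarrow> p div 2 \<noteq> l" by blast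
  then show "p \<in> holes b m (insert l A) B \<longleftrightarrow> p \<in> {m..<2 * l + 1} \<union> holes b (2 * l + 2) A B"
  proof cases
    case 1
    then have "p div 2 \<notin> A" "p div 2 \<notin> B" "odd p \<longrightarrow> p div 2 \<noteq> l"
      using assms(3)[of "p div 2"] assms(4)[of "p div 2"] by auto
    then show ?thesis using 1 assms(2) by (auto simp: holes_def)
  qed (use assms in \<open>auto simp: holes_def\<close>)
qed

lemma holes_none: "holes b m {} {} = {m..<2 * b} \<union> {}"
  by (auto simp: holes_def)

lemma holes_ge: "q \<in> holes b m A B \<Longrightarrow> m \<le> q" by (simp add: holes_def)

lemma row_match_even:
  assumes "m \<le> 2 * r" "r < b" "\<And>x. x \<in> B \<Longrightarrow> r < x" "\<And>x. x \<in> A \<Longrightarrow> r \<le> x"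
  shows "row_match (holes b m A (insert r B)) \<noteq> {} \<longleftrightarrow> even m \<and> row_match (holes b (2 * r + 1) A B) \<noteq> {}"
  using row_match_run[OF assms(1), of "holes b (2 * r + 1) A B"] holes_even[OF assms] holes_ge
  by fastforce

lemma row_match_odd:
  assumes "m \<le> 2 * l + 1" "l < b" "\<And>x. x \<in> A \<Longrightarrow> l < x" "\<And>x. x \<in> B \<Longrightarrow> l < x"
  shows "row_match (holes b m (insert l A) B) \<noteq> {} \<longleftrightarrow> odd m \<and> row_match (holes b (2 * l + 2) A B) \<noteq> {}"
  using row_match_run[OF assms(1), of "holes b (2 * l + 2) A B"] holes_odd[OF assms] holes_ge
  by fastforce

lemma row_match_none:
  assumes "m \<le> 2 * b" shows "row_match (holes b m {} {}) \<noteq> {} \<longleftrightarrow> even m"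
proof -
  have "{} \<in> row_match {}" by (simp add: row_match_def)
  then show ?thesis using row_match_run[OF assms, of "{}"] unfolding holes_none by auto
qed

text \<open>Every run between holes must have even length. From the odd start 2c - 1 a run can only
  end at an odd hole 2l + 1; the next starts at the even number 2l + 2 and ends at an even hole 2r
  or at the top 2b. So holes of the two kinds alternate, beginning and ending with one from
  \<open>ls\<close>.\<close>

lemma row_match_holes:
  assumes "sorted_wrt (<) ls" "sorted_wrt (<) rs" "set ls \<subseteq> {c - 1..<b}" "set rs \<subseteq> {c..<b}" "c \<le> b"
  shows "row_match (holes b (2 * c - 1) (set ls) (set rs)) \<noteq> {} \<longleftrightarrow> rs \<in> interlacing ls"
  using assms
proof (induction ls arbitrary: c rs)
  case Nil
  show ?case
  proof (cases rs)
    case Nil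
    then show ?thesis using row_match_none[of "2 * c - 1" b] Nil.prems by simp
  next
    case (Cons r rs')
    then show ?thesis using row_match_even[of "2 * c - 1" r b "set rs'" "{}"] Nil.prems by auto
  qed
next
  case (Cons l ls)
  show ?case
  proof (cases "\<forall>r\<in>set rs. l < r")
    case False
    then obtain r rs' where rs: "rs = r # rs'" "r \<le> l" using Cons.prems(2) by (cases rs) fastforce+
    have "row_match (holes b (2 * c - 1) (set (l # ls)) (set rs)) = {}"
      using row_match_even[of "2 * c - 1" r b "set rs'" "set (l # ls)"] rs Cons.prems by fastforce
    moreover have "rs \<notin> interlacing (l # ls)" using rs by (cases ls) auto
    ultimately show ?thesis by simp
  next
    case True
    have "row_match (holes b (2 * c - 1) (set (l # ls)) (set rs)) \<noteq> {} \<longleftrightarrow> row_match (holes b (2 * l + 2) (set ls) (set rs)) \<noteq> {}"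
      using row_match_odd[of "2 * c - 1" l b "set ls" "set rs"] True Cons.prems by auto
    also have "\<dots> \<longleftrightarrow> rs \<in> interlacing (l # ls)"
    proof (cases rs)
      case Nil
      show ?thesis
      proof (cases ls)
        case Nil
        then show ?thesis using row_match_none[of "2 * l + 2" b] \<open>rs = []\<close> Cons.prems by simp
      next
        case (Cons l' ls')
        then show ?thesis
          using row_match_odd[of "2 * l + 2" l' b "set ls'" "{}"] \<open>rs = []\<close> Cons.prems by auto
      qed
    next
      case rs: (Cons r rs')
      have IH: "row_match (holes b (2 * r + 1) (set ls) (set rs')) \<noteq> {} \<longleftrightarrow> rs' \<in> interlacing ls" if "\<forall>x\<in>set ls. r \<le> x"
      proof -
        have "set ls \<subseteq> {r + 1 - 1..<b}" using that Cons.prems(3) by auto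
        moreover have "set rs' \<subseteq> {r + 1..<b}" using rs Cons.prems(2,4) by fastforce
        moreover have "2 * (r + 1) - 1 = 2 * r + 1" by simp
        ultimately show ?thesis using Cons.IH[of rs' "r + 1"] rs Cons.prems by (simp add: add.commute)
      qed
      show ?thesis
      proof (cases ls)
        case Nil
        then show ?thesis
          using row_match_even[of "2 * l + 2" r b "set rs'" "set ls"] IH rs True Cons.prems by auto
      next
        case ls: (Cons l' ls')
        show ?thesis
        proof (cases "r \<le> l'")
          case le: True
          have rls: "\<forall>x\<in>set ls. r \<le> x" using le ls Cons.prems(1) by fastforce
          have "row_match (holes b (2 * l + 2) (set ls) (set rs)) \<noteq> {} \<longleftrightarrow> row_match (holes b (2 * r + 1) (set ls) (set rs')) \<noteq> {}"
            using row_match_even[of "2 * l + 2" r b "set rs'" "set ls"] rls rs True Cons.prems by auto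
          then show ?thesis using IH[OF rls] rs ls le True by auto
        next
          case False
          then have "row_match (holes b (2 * l + 2) (set ls) (set rs)) = {}"
            using row_match_odd[of "2 * l + 2" l' b "set ls'" "set rs"] rs ls True Cons.prems by fastforce
          then show ?thesis using False rs ls by auto
        qed
      qed
    qed
    finally show ?thesis .
  qed
qed

section \<open>Tilings of a single column\<close>

lemma vert_inject: "vert u p = vert u q \<longleftrightarrow> p = q"
  by (auto simp: vert_def doubleton_eq_iff)

lemma hor_nodes: "hor u v = {node (u - 1) (2 * v + 1), node u (2 * v)}"
  by (simp add: hor_def node_Rt node_Lt)

text \<open>A horizontal rhombus needs triangles from two columns, so inside one column only pairs
  of consecutive triangles occur, and tilings are matchings.\<close>

lemma card_tilings_of_nodes:
  "card (tilings_of (node k ` Y)) = card (row_match Y)"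
proof -
  have "bij_betw (\<lambda>M. vert k ` M) (row_match Y) (tilings_of (node k ` Y))"
  proof (rule bij_betw_imageI)
    show "inj_on (\<lambda>M. vert k ` M) (row_match Y)"
    proof -
      have "inj (vert k)" by (rule injI) (simp add: vert_inject)
      then show ?thesis by (intro inj_onI) (simp add: inj_image_eq_iff)
    qed
    show "(\<lambda>M. vert k ` M) ` row_match Y = tilings_of (node k ` Y)"
    proof (intro set_eqI iffI)
      fix T assume "T \<in> (\<lambda>M. vert k ` M) ` row_match Y"
      then obtain M where T: "T = vert k ` M" and M: "M \<in> row_match Y" by blast
      have m: "q \<in> M \<Longrightarrow> q - 1 \<notin> M" "q \<in> Y \<longleftrightarrow> q \<in> M \<or> q - 1 \<in> M" for q
        using M by (auto simp: row_match_mem_iff)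
      show "T \<in> tilings_of (node k ` Y)"
      proof (rule tilings_ofI)
        fix r assume "r \<in> T" then show "unit_rhombus r" using T unit_rhombus_iff by blast
      next
        have "\<Union>T = node k ` (M \<union> (\<lambda>p. p + 1) ` M)" by (auto simp: T vert_def)
        also have "M \<union> (\<lambda>p. p + 1) ` M = Y" using M by (simp add: row_match_def)
        finally show "\<Union>T = node k ` Y" .
      next
        fix r r' t assume "r \<in> T" "r' \<in> T" "t \<in> r" "t \<in> r'"
        then obtain p q where pq: "p \<in> M" "q \<in> M" "r = vert k p" "r' = vert k q" "t \<in> vert k p" "t \<in> vert k q"
          using T by auto
        then have "p = q \<or> p = q + 1 \<or> q = p + 1" by (auto simp: vert_def)
        then show "r = r'" using m(1)[of p] m(1)[of q] pq by auto
      qed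
    next
      fix T assume T: "T \<in> tilings_of (node k ` Y)"
      define M where "M = {p. vert k p \<in> T}"
      have "\<exists>p\<in>M. r = vert k p" if r: "r \<in> T" for r
      proof -
        have sub: "r \<subseteq> node k ` Y" using tilings_ofD(2)[OF T] r by blast
        from tilings_ofD(1)[OF T r] show ?thesis unfolding unit_rhombus_iff
        proof (elim disjE exE)
          fix u v assume "r = hor u v" then show ?thesis using sub by (auto simp: hor_nodes)
        next
          fix u p assume "r = vert u p" then show ?thesis using sub r by (auto simp: vert_def M_def)
        qed
      qed
      then have TM: "T = vert k ` M" by (auto simp: M_def)
      have "M \<in> row_match Y" unfolding row_match_mem_iff
      proof (intro conjI allI impI notI)
        fix p assume "p \<in> M" "p - 1 \<in> M"
        then have "vert k p = vert k (p - 1)"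
          using tilings_ofD(3)[OF T, of "vert k p" "vert k (p - 1)" "node k p"] by (auto simp: M_def vert_def)
        then show False by (simp add: vert_inject)
      next
        fix p
        have "p \<in> Y \<longleftrightarrow> node k p \<in> \<Union>T" using tilings_ofD(2)[OF T] by auto
        also have "\<dots> \<longleftrightarrow> (\<exists>q\<in>M. p = q \<or> p = q + 1)" unfolding TM vert_def by auto
        also have "\<dots> \<longleftrightarrow> p \<in> M \<or> p - 1 \<in> M" by (auto intro: bexI[of _ "p - 1"])
        finally show "p \<in> Y \<longleftrightarrow> p \<in> M \<or> p - 1 \<in> M" .
      qed
      then show "T \<in> (\<lambda>M. vert k ` M) ` row_match Y" using TM by blast
    qed
  qed
  then show ?thesis by (rule bij_betw_same_card[symmetric])
qed

lemma finite_holes: "finite (holes b m A B)"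
  by (rule finite_subset[of _ "{m..<2 * b}"]) (auto simp: holes_def)

lemma card_tilings_of_column:
  assumes "A \<subseteq> {- k - 1..<b}" "B \<subseteq> {- k..<b}" "- k \<le> b"
  shows "card (tilings_of (node k ` holes b (- 2 * k - 1) A B)) =
    (if sorted_list_of_set B \<in> interlacing (sorted_list_of_set A) then 1 else 0)"
proof -
  let ?M = "row_match (holes b (- 2 * k - 1) A B)"
  have fin: "finite A" "finite B" using assms(1,2) by (auto intro: finite_subset)
  have "row_match (holes b (2 * (- k) - 1) (set (sorted_list_of_set A)) (set (sorted_list_of_set B))) \<noteq> {} \<longleftrightarrow>
      sorted_list_of_set B \<in> interlacing (sorted_list_of_set A)"
    by (rule row_match_holes) (use assms fin in auto)
  moreover have "2 * (- k) - 1 = - 2 * k - 1" by simp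
  ultimately have ne: "?M \<noteq> {} \<longleftrightarrow> sorted_list_of_set B \<in> interlacing (sorted_list_of_set A)"
    using fin by (simp only: set_sorted_list_of_set)
  show ?thesis
  proof (cases "?M = {}")
    case True
    then show ?thesis using ne by (simp add: card_tilings_of_nodes)
  next
    case False
    then obtain M where "M \<in> ?M" by blast
    moreover have "N = M" if "N \<in> ?M" for N using row_match_unique[OF finite_holes that \<open>M \<in> ?M\<close>] .
    ultimately have "?M = {M}" by blast
    then show ?thesis using ne by (simp add: card_tilings_of_nodes)
  qed
qed

section \<open>Tilings of the left half\<close>

text \<open>The first \<open>k\<close> columns of the hexagon, without the left-pointing triangles that protrude
  through the edges \<open>S\<close> of the line \<open>k\<close>.\<close>

definition left_part :: "int \<Rightarrow> int \<Rightarrow> int set \<Rightarrow> pt set set" where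
  "left_part b k S = {node u p | u p. 0 \<le> u \<and> u < k \<and> - 2 * u - 1 \<le> p \<and> p < 2 * b \<and>
     \<not> (u = k - 1 \<and> odd p \<and> p div 2 \<in> S)}"

definition edges :: "int \<Rightarrow> int \<Rightarrow> int set" where
  "edges b k = {v. 0 < k \<and> - k \<le> v \<and> v < b}"

lemma node_left_part: "node u p \<in> left_part b k S \<longleftrightarrow> 0 \<le> u \<and> u < k \<and> - 2 * u - 1 \<le> p \<and> p < 2 * b \<and>
     \<not> (u = k - 1 \<and> odd p \<and> p div 2 \<in> S)"
  by (auto simp: left_part_def)

lemma left_part_node: "t \<in> left_part b k S \<Longrightarrow> \<exists>u p. t = node u p"
  by (auto simp: left_part_def)

lemma left_part_mono: "left_part b k S \<subseteq> left_part b k {}"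
  by (auto simp: left_part_def)

lemma finite_left_part: "finite (left_part b k S)"
proof (rule finite_subset)
  show "left_part b k S \<subseteq> (\<lambda>(u, p). node u p) ` ({0..<k} \<times> {- 2 * k - 1..<2 * b})"
    by (auto simp: left_part_def)
qed auto

lemma finite_edges: "finite (edges b k)"
  by (rule finite_subset[of _ "{-k..<b}"]) (auto simp: edges_def)

lemma unit_rhombus_hor: "unit_rhombus (hor u v)" and unit_rhombus_vert: "unit_rhombus (vert u p)"
  unfolding unit_rhombus_iff by blast+

lemma hor_image_tilings_of: "hor k ` S \<in> tilings_of (\<Union>(hor k ` S))"
proof (rule tilings_ofI)
  fix r r' t assume "r \<in> hor k ` S" "r' \<in> hor k ` S" "t \<in> r" "t \<in> r'"
  then obtain v w where "r = hor k v" "r' = hor k w" "t \<in> hor k v" "t \<in> hor k w" by blast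
  moreover from this have "v = w" unfolding hor_nodes by fastforce
  ultimately show "r = r'" by simp
next
  fix r assume "r \<in> hor k ` S"
  then show "unit_rhombus r" using unit_rhombus_hor by blast
qed simp

lemma left_part_Suc:
  assumes "0 \<le> k" "S \<subseteq> edges b k"
  shows "left_part b (k + 1) S' =
     left_part b k S \<union> \<Union>(hor k ` S) \<union> node k ` holes b (- 2 * k - 1) S' S" (is "?l = ?r")
proof (intro set_eqI iffI)
  fix t assume "t \<in> ?l"
  then obtain u p where t: "t = node u p" "0 \<le> u" "u < k + 1" "- 2 * u - 1 \<le> p" "p < 2 * b"
     "\<not> (u = k \<and> odd p \<and> p div 2 \<in> S')" by (auto simp: left_part_def)
  show "t \<in> ?r"
  proof (cases "u = k")
    case True
    show ?thesis
    proof (cases "even p \<and> p div 2 \<in> S")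
      case True
      then have "t \<in> hor k (p div 2)" using \<open>u = k\<close> t by (simp add: hor_nodes)
      then show ?thesis using True by blast
    next
      case False
      then show ?thesis using \<open>u = k\<close> t by (auto simp: holes_def)
    qed
  next
    case False
    show ?thesis
    proof (cases "u = k - 1 \<and> odd p \<and> p div 2 \<in> S")
      case True
      then have "t \<in> hor k (p div 2)" using t by (simp add: hor_nodes)
      then show ?thesis using True by blast
    next
      case False
      then show ?thesis using \<open>u \<noteq> k\<close> t by (auto simp: node_left_part)
    qed
  qed
next
  fix t assume "t \<in> ?r"
  then consider "t \<in> left_part b k S" | v where "v \<in> S" "t \<in> hor k v" | "t \<in> node k ` holes b (- 2 * k - 1) S' S"
    by blast
  then show "t \<in> ?l"
  proof cases
    case 1
    then show ?thesis by (auto simp: left_part_def)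
  next
    case 2
    then have "v \<in> edges b k" using assms by blast
    then show ?thesis using 2 assms(1) by (auto simp: hor_nodes node_left_part edges_def)
  next
    case 3
    then show ?thesis using assms(1) by (auto simp: node_left_part holes_def)
  qed
qed

lemma left_part_disjoint:
  "left_part b k S \<inter> \<Union>(hor k ` S) = {}"
  "(left_part b k S \<union> \<Union>(hor k ` S)) \<inter> node k ` holes b m S' S = {}"
  by (auto simp: hor_nodes node_left_part holes_def)

text \<open>\<open>C\<close> and \<open>D\<close> are the earlier columns and the last one. Once the
  horizontal rhombi \<open>H\<close> are removed, a union of pieces of \<open>C\<close> and
  \<open>D\<close> determines both pieces.\<close>

lemma Un_cancel:
  assumes "A \<union> H \<union> B = A' \<union> H \<union> B'" "A \<inter> H = {}" "B \<inter> H = {}" "A' \<inter> H = {}" "B' \<inter> H = {}"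
    "A \<subseteq> C" "B \<subseteq> D" "A' \<subseteq> C" "B' \<subseteq> D" "C \<inter> D = {}"
  shows "A = A' \<and> B = B'"
proof -
  have *: "(x \<in> A \<or> x \<in> H \<or> x \<in> B) = (x \<in> A' \<or> x \<in> H \<or> x \<in> B')" for x
    using assms(1) by auto
  have "x \<in> A \<longleftrightarrow> x \<in> A'" "x \<in> B \<longleftrightarrow> x \<in> B'" for x
    using *[of x] assms(2-) by auto
  then show ?thesis by blast
qed

text \<open>Transfer across line \<open>k\<close>. The rhombi on that line determine
  \<open>S\<close>; no other rhombus crosses it, so without them the tiling splits into one of the
  earlier columns and one of the last column.\<close>

lemma left_step:
  assumes k: "0 \<le> k"
  shows "card (tilings_of (left_part b (k + 1) S')) = (\<Sum>S\<in>Pow (edges b k).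
     card (tilings_of (left_part b k S)) * card (tilings_of (node k ` holes b (- 2 * k - 1) S' S)))"
proof -
  let ?C = "\<lambda>S. node k ` holes b (- 2 * k - 1) S' S"
  let ?A = "Sigma (Pow (edges b k)) (\<lambda>S. tilings_of (left_part b k S) \<times> tilings_of (?C S))"
  let ?f = "\<lambda>(S, T1, T2). T1 \<union> hor k ` S \<union> T2"
  let ?g = "\<lambda>T. ({v. hor k v \<in> T}, {r\<in>T. r \<subseteq> left_part b k {}}, {r\<in>T. r \<subseteq> range (node k)})"
  have hor1: "\<not> hor k v \<subseteq> left_part b k {}" for v by (simp add: hor_nodes node_left_part)
  have hor2: "\<not> hor k v \<subseteq> range (node k)" for v by (auto simp: hor_nodes)
  have disj: "left_part b k {} \<inter> range (node k) = {}" by (auto simp: node_left_part)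
  have hinj: "hor k v = hor k w \<longleftrightarrow> v = w" for v w by (auto simp: hor_nodes doubleton_eq_iff)
  have "bij_betw ?f ?A (tilings_of (left_part b (k + 1) S'))"
  proof (rule bij_betw_byWitness[where f' = ?g])
    show "\<forall>x\<in>?A. ?g (?f x) = x"
    proof
      fix x assume "x \<in> ?A"
      then obtain S T1 T2 where x: "x = (S, T1, T2)" and T1: "T1 \<in> tilings_of (left_part b k S)" and T2: "T2 \<in> tilings_of (?C S)"
        by auto
      have 1: "r \<subseteq> left_part b k {}" "r \<noteq> {}" if "r \<in> T1" for r
        using tilings_ofD(2)[OF T1] left_part_mono[of b k S] that rhombus_nonempty[OF tilings_ofD(1)[OF T1 that]] by auto
      have 2: "r \<subseteq> range (node k)" "r \<noteq> {}" if "r \<in> T2" for r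
        using tilings_ofD(2)[OF T2] that rhombus_nonempty[OF tilings_ofD(1)[OF T2 that]] by auto
      have "hor k v \<notin> T1" "hor k v \<notin> T2" for v
        using 1(1)[of "hor k v"] 2(1)[of "hor k v"] hor1[of v] hor2[of v] by auto
      then have "{v. hor k v \<in> T1 \<union> hor k ` S \<union> T2} = S" by (auto simp: hinj)
      moreover have "{r \<in> T1 \<union> hor k ` S \<union> T2. r \<subseteq> left_part b k {}} = T1"
      proof -
        have "\<not> r \<subseteq> left_part b k {}" if "r \<in> T2" for r using 2[OF that] disj by blast
        then show ?thesis using 1(1) hor1 by auto
      qed
      moreover have "{r \<in> T1 \<union> hor k ` S \<union> T2. r \<subseteq> range (node k)} = T2"
      proof -
        have "\<not> r \<subseteq> range (node k)" if "r \<in> T1" for r using 1[OF that] disj by blast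
        then show ?thesis using 2(1) hor2 by auto
      qed
      ultimately show "?g (?f x) = x" by (simp add: x)
    qed
    show "?f ` ?A \<subseteq> tilings_of (left_part b (k + 1) S')"
    proof (rule image_subsetI)
      fix x assume "x \<in> ?A"
      then obtain S T1 T2 where x: "x = (S, T1, T2)" and S: "S \<subseteq> edges b k"
        and T: "T1 \<in> tilings_of (left_part b k S)" "T2 \<in> tilings_of (?C S)" by auto
      have "T1 \<union> hor k ` S \<union> T2 \<in> tilings_of (left_part b (k + 1) S')"
        unfolding left_part_Suc[OF k S]
        by (intro tilings_of_Un T hor_image_tilings_of left_part_disjoint)
      then show "?f x \<in> tilings_of (left_part b (k + 1) S')" by (simp add: x)
    qed
    have main: "{v. hor k v \<in> T} \<subseteq> edges b k \<and> ?f (?g T) = T \<and>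
       {r\<in>T. r \<subseteq> left_part b k {}} \<in> tilings_of (left_part b k {v. hor k v \<in> T}) \<and>
       {r\<in>T. r \<subseteq> range (node k)} \<in> tilings_of (?C {v. hor k v \<in> T})"
      if T: "T \<in> tilings_of (left_part b (k + 1) S')" for T
    proof -
      define S where "S = {v. hor k v \<in> T}"
      define T1 where "T1 = {r\<in>T. r \<subseteq> left_part b k {}}"
      define T2 where "T2 = {r\<in>T. r \<subseteq> range (node k)}"
      have sub: "r \<subseteq> left_part b (k + 1) S'" if "r \<in> T" for r using tilings_ofD(2)[OF T] that by blast
      have SE: "S \<subseteq> edges b k"
      proof
        fix v assume "v \<in> S"
        then have "hor k v \<subseteq> left_part b (k + 1) S'" using sub by (simp add: S_def)
        then show "v \<in> edges b k" using k by (auto simp: hor_nodes node_left_part edges_def)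
      qed
      \<comment> \<open>Only a horizontal rhombus on line \<open>k\<close> has triangles in both the
        last column and an earlier one.\<close>
      have cases: "r \<in> T1 \<or> r \<in> hor k ` S \<or> r \<in> T2" if r: "r \<in> T" for r
        using tilings_ofD(1)[OF T r] unfolding unit_rhombus_iff
      proof (elim disjE exE)
        fix u v assume uv: "r = hor u v"
        show ?thesis
        proof (cases "u = k")
          case True
          then show ?thesis using r uv by (auto simp: S_def)
        next
          case False
          then show ?thesis using sub[OF r] r uv unfolding T1_def by (auto simp: hor_nodes node_left_part)
        qed
      next
        fix u p assume up: "r = vert u p"
        show ?thesis
        proof (cases "u = k")
          case True
          then show ?thesis using r up by (auto simp: T2_def vert_def)
        next
          case False
          then show ?thesis using sub[OF r] r up unfolding T1_def by (auto simp: vert_def node_left_part)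
        qed
      qed
      have eq: "T1 \<union> hor k ` S \<union> T2 = T" using cases by (auto simp: T1_def T2_def S_def)
      have uT: "\<Union>T1 \<union> \<Union>(hor k ` S) \<union> \<Union>T2 = left_part b k S \<union> \<Union>(hor k ` S) \<union> ?C S"
        using arg_cong[OF eq, of Union] unfolding left_part_Suc[OF k SE, symmetric] tilings_ofD(2)[OF T, symmetric]
        by (simp only: Union_Un_distrib)
      have d1: "\<Union>T1 \<inter> \<Union>(hor k ` S) = {}"
      proof -
        have False if "t \<in> r" "r \<in> T1" "v \<in> S" "t \<in> hor k v" for t r v
        proof -
          have "r = hor k v" using tilings_ofD(3)[OF T, of r "hor k v" t] that by (auto simp: T1_def S_def)
          then show False using that hor1 by (auto simp: T1_def)
        qed
        then show ?thesis by blast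
      qed
      have d2: "\<Union>T2 \<inter> \<Union>(hor k ` S) = {}"
      proof -
        have False if "t \<in> r" "r \<in> T2" "v \<in> S" "t \<in> hor k v" for t r v
        proof -
          have "r = hor k v" using tilings_ofD(3)[OF T, of r "hor k v" t] that by (auto simp: T2_def S_def)
          then show False using that hor2 by (auto simp: T2_def)
        qed
        then show ?thesis by blast
      qed
      have s1: "\<Union>T1 \<subseteq> left_part b k {}" and s2: "\<Union>T2 \<subseteq> range (node k)" by (auto simp: T1_def T2_def)
      have s3: "?C S \<subseteq> range (node k)" by blast
      have d3: "?C S \<inter> \<Union>(hor k ` S) = {}" using left_part_disjoint(2)[of b k S "-2 * k - 1" S'] by blast
      have u1: "\<Union>T1 = left_part b k S" and u2: "\<Union>T2 = ?C S"
        using Un_cancel[OF uT d1 d2 left_part_disjoint(1) d3 s1 s2 left_part_mono s3 disj] by auto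
      have "T1 \<in> tilings_of (left_part b k S)" "T2 \<in> tilings_of (?C S)"
        using tilings_of_subset[OF T _ u1] tilings_of_subset[OF T _ u2] by (auto simp: T1_def T2_def)
      then show ?thesis using SE eq by (simp add: S_def T1_def T2_def)
    qed
    show "\<forall>T\<in>tilings_of (left_part b (k + 1) S'). ?f (?g T) = T" using main by blast
    show "?g ` tilings_of (left_part b (k + 1) S') \<subseteq> ?A"
    proof (rule image_subsetI)
      fix T assume "T \<in> tilings_of (left_part b (k + 1) S')"
      from main[OF this] show "?g T \<in> ?A" by simp
    qed
  qed
  then have "card (tilings_of (left_part b (k + 1) S')) = card ?A" by (rule bij_betw_same_card[symmetric])
  also have "\<dots> = (\<Sum>S\<in>Pow (edges b k). card (tilings_of (left_part b k S)) * card (tilings_of (?C S)))"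
    by (subst card_SigmaI) (auto simp: finite_edges finite_tilings_of finite_left_part finite_holes card_cartesian_product)
  finally show ?thesis .
qed

text \<open>Backward differences lower the index by one, which is the recursion required by the
  half-open intervals of \<open>interlacing\<close>.\<close>

definition rising :: "nat \<Rightarrow> int \<Rightarrow> real" where
  "rising i l = pochhammer (real_of_int l) i / fact i"

text \<open>Each column admits one tiling if the edge sets on its two sides interlace and none
  otherwise, so adding a column sums the previous count over interlacing rows. The determinant obeys
  the same recursion.\<close>

theorem card_tilings_of_left_part:
  assumes "S \<subseteq> edges b (int k)" "0 \<le> b"
  shows "real (card (tilings_of (left_part b (int k) S))) = alt_det (map rising [0..<k]) S"
  using assms(1)
proof (induction k arbitrary: S)
  case 0
  then have "S = {}" by (auto simp: edges_def)
  moreover have "left_part b 0 S = {}" by (auto simp: left_part_def)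
  ultimately show ?case by (simp add: tilings_of_empty)
next
  case (Suc k)
  define ls where "ls = sorted_list_of_set S"
  have S: "S \<subseteq> {- int k - 1..<b}" using Suc.prems by (auto simp: edges_def)
  have fS: "finite S" using Suc.prems finite_edges finite_subset by metis
  have ls: "set ls = S" "sorted_wrt (<) ls" using fS by (auto simp: ls_def)
  define I where "I = {A \<in> Pow (edges b (int k)). sorted_list_of_set A \<in> interlacing ls}"
  have "real (card (tilings_of (left_part b (int (Suc k)) S))) =
      (\<Sum>A\<in>Pow (edges b (int k)). real (card (tilings_of (left_part b (int k) A))) *
         real (card (tilings_of (node (int k) ` holes b (- 2 * int k - 1) S A))))"
    using left_step[of "int k" b S] by (simp add: add.commute)
  also have "\<dots> = (\<Sum>A\<in>Pow (edges b (int k)). if sorted_list_of_set A \<in> interlacing ls then alt_det (map rising [0..<k]) A else 0)"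
  proof (rule sum.cong[OF refl])
    fix A assume A: "A \<in> Pow (edges b (int k))"
    then have "A \<subseteq> {- int k..<b}" by (auto simp: edges_def)
    from card_tilings_of_column[OF S this] assms(2) Suc.IH[of A] A
    show "real (card (tilings_of (left_part b (int k) A))) *
         real (card (tilings_of (node (int k) ` holes b (- 2 * int k - 1) S A))) =
      (if sorted_list_of_set A \<in> interlacing ls then alt_det (map rising [0..<k]) A else 0)"
      by (simp add: ls_def)
  qed
  also have "\<dots> = (\<Sum>A\<in>I. alt_det (map rising [0..<k]) A)"
    unfolding I_def by (rule sum.inter_filter[symmetric]) (simp add: finite_edges)
  also have "\<dots> = (\<Sum>rs\<in>interlacing ls. alt_det (map rising [0..<k]) (set rs))"
  proof (rule sum.reindex_bij_witness_not_neutral[where S' = "{}" and T' = "{rs \<in> interlacing ls. set rs \<notin> Pow (edges b (int k))}"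
        and j = sorted_list_of_set and i = set])
    fix A assume A: "A \<in> I - {}"
    then have "finite A" using finite_edges finite_subset unfolding I_def by blast
    then show eq: "set (sorted_list_of_set A) = A" by auto
    show "sorted_list_of_set A \<in> interlacing ls - {rs \<in> interlacing ls. set rs \<notin> Pow (edges b (int k))}"
      using A eq by (auto simp: I_def)
  next
    fix A assume "A \<in> I"
    then have "finite A" using finite_edges finite_subset unfolding I_def by blast
    then show "alt_det (map rising [0..<k]) (set (sorted_list_of_set A)) = alt_det (map rising [0..<k]) A" by simp
  next
    fix rs assume rs: "rs \<in> interlacing ls - {rs \<in> interlacing ls. set rs \<notin> Pow (edges b (int k))}"
    then have "sorted_wrt (<) rs" using interlacing_sorted ls(2) by blast
    then show "sorted_list_of_set (set rs) = rs"
      unfolding strict_sorted_iff by (simp add: sorted_list_of_set.idem_if_sorted_distinct)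
    then show "set rs \<in> I - {}" using rs by (auto simp: I_def)
  next
    \<comment> \<open>Interlacing rows outside the admissible edges must not contribute. For k > 0
      the bounds on interlacing rows exclude them; for k = 0 there are no edges, and the empty
      determinant vanishes on a nonempty set.\<close>
    fix rs assume rs: "rs \<in> {rs \<in> interlacing ls. set rs \<notin> Pow (edges b (int k))}"
    show "alt_det (map rising [0..<k]) (set rs) = 0"
    proof (cases k)
      case 0
      then show ?thesis using rs by (cases rs) auto
    next
      case (Suc k')
      obtain l ls' where ll: "ls = l # ls'" using rs by (cases ls) auto
      have "set rs \<subseteq> edges b (int k)"
      proof
        fix r assume "r \<in> set rs"
        then have "l < r" "r \<le> last ls" using interlacing_bounds[of rs l ls' r] rs ls(2) ll by auto
        moreover have "l \<in> S" "last ls \<in> S" using ls(1) ll by auto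
        ultimately show "r \<in> edges b (int k)" using S Suc by (auto simp: edges_def)
      qed
      then show ?thesis using rs by simp
    qed
  qed (auto simp: interlacing_finite)
  also have "\<dots> = alt_det (map rising [0..<Suc k]) (set ls)"
    by (rule alt_det_interlacing[symmetric]) (use ls pochhammer_diff in \<open>auto simp: rising_def\<close>)
  finally show ?case using ls by simp
qed

section \<open>Vertically symmetric tilings\<close>

lemma vrefl_vrefl [simp]: "vrefl a (vrefl a p) = p"
  by (simp add: vrefl_def)

text \<open>The reflection reverses the order of the columns and exchanges the two orientations,
  hence the odd shift of the number.\<close>

lemma vrefl_node: "vrefl a ` node u p = node (2 * int a - u - 1) (p + 2 * (u - int a) + 1)"
proof (cases "even p")
  case True
  then obtain v where p: "p = 2 * v" by blast
  have "p + 2 * (u - int a) + 1 = 2 * (v + u - int a) + 1" using p by simp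
  then show ?thesis unfolding p node_Rt by (simp only: node_Lt) (auto simp: Rt_def Lt_def vrefl_def)
next
  case False
  then obtain v where p: "p = 2 * v + 1" using oddE by blast
  have "p + 2 * (u - int a) + 1 = 2 * (v + u + 1 - int a)" using p by simp
  then show ?thesis unfolding p node_Lt by (simp only: node_Rt) (auto simp: Rt_def Lt_def vrefl_def)
qed

lemma reflect_reflect [simp]: "reflect_rhombus a (reflect_rhombus a r) = r"
  by (simp add: reflect_rhombus_def image_image)

lemma mem_reflect: "t \<in> reflect_rhombus a r \<longleftrightarrow> vrefl a ` t \<in> r"
proof
  assume "t \<in> reflect_rhombus a r"
  then show "vrefl a ` t \<in> r" by (auto simp: reflect_rhombus_def image_image)
next
  assume "vrefl a ` t \<in> r"
  then have "vrefl a ` vrefl a ` t \<in> reflect_rhombus a r" unfolding reflect_rhombus_def by blast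
  then show "t \<in> reflect_rhombus a r" by (simp add: image_image)
qed

lemma reflect_hor: "reflect_rhombus a (hor u v) = hor (2 * int a - u) (v + u - int a)"
  unfolding reflect_rhombus_def hor_nodes by (simp add: vrefl_node insert_commute algebra_simps)

lemma reflect_vert: "reflect_rhombus a (vert u p) = vert (2 * int a - u - 1) (p + 2 * (u - int a) + 1)"
  unfolding reflect_rhombus_def vert_def by (simp add: vrefl_node algebra_simps)

lemma reflect_unit_rhombus: "unit_rhombus r \<Longrightarrow> unit_rhombus (reflect_rhombus a r)"
  by (subst (asm) unit_rhombus_iff) (auto simp: reflect_hor reflect_vert unit_rhombus_hor unit_rhombus_vert)

lemma node_hex_triangles: "node u p \<in> hex_triangles a b a \<longleftrightarrow>
   (0 \<le> u \<and> u < int a \<and> - 2 * u - 1 \<le> p \<and> p < 2 * int b) \<or>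
   (int a \<le> u \<and> u < 2 * int a \<and> - 2 * int a \<le> p \<and> p + 2 * u + 1 < 2 * int b + 2 * int a)"
proof (cases "even p")
  case True
  then obtain v where p: "p = 2 * v" by blast
  have "node u p \<in> hex_triangles a b a \<longleftrightarrow> (\<forall>q\<in>Rt u v. in_hexagon a b a q)"
    unfolding p node_Rt hex_triangles_def by (auto simp: unit_triangle_iff)
  also have "\<dots> \<longleftrightarrow> 0 \<le> u \<and> u + 1 \<le> 2 * int a \<and> - int a \<le> v \<and> v + 1 \<le> int b \<and> 0 \<le> u + v \<and> u + v + 1 \<le> int b + int a"
    by (auto simp: Rt_def in_hexagon_def)
  finally show ?thesis unfolding p by auto
next
  case False
  then obtain v where p: "p = 2 * v + 1" using oddE by blast
  have "node u p \<in> hex_triangles a b a \<longleftrightarrow> (\<forall>q\<in>Lt u v. in_hexagon a b a q)"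
    unfolding p node_Lt hex_triangles_def by (auto simp: unit_triangle_iff)
  also have "\<dots> \<longleftrightarrow> 0 \<le> u \<and> u + 1 \<le> 2 * int a \<and> - int a \<le> v \<and> v + 1 \<le> int b \<and> 0 \<le> u + v + 1 \<and> u + v + 2 \<le> int b + int a"
    by (auto simp: Lt_def in_hexagon_def)
  finally show ?thesis unfolding p by auto
qed

lemma hex_triangles_node: "t \<in> hex_triangles a b c \<Longrightarrow> \<exists>u p. t = node u p"
proof -
  assume "t \<in> hex_triangles a b c"
  then obtain u v where "t = Rt u v \<or> t = Lt u v" by (auto simp: hex_triangles_def unit_triangle_iff)
  then have "t = node u (2 * v) \<or> t = node u (2 * v + 1)" by (simp only: node_Rt node_Lt)
  then show ?thesis by blast
qed

lemma node_reflect_left: "node u p \<in> (`) (vrefl a) ` left_part b (int a) S \<longleftrightarrow>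
    node (2 * int a - u - 1) (p + 2 * (u - int a) + 1) \<in> left_part b (int a) S"
proof -
  have "t \<in> (`) (vrefl a) ` A \<longleftrightarrow> vrefl a ` t \<in> A" for t A
    using mem_reflect[of t a A] by (simp add: reflect_rhombus_def)
  then show ?thesis by (simp add: vrefl_node)
qed

lemma hex_decompose:
  assumes "S \<subseteq> edges (int b) (int a)"
  shows "hex_triangles a b a = left_part b (int a) S \<union> \<Union>(hor (int a) ` S) \<union> (`) (vrefl a) ` left_part b (int a) S"
proof (intro set_eqI)
  fix t
  show "t \<in> hex_triangles a b a \<longleftrightarrow> t \<in> left_part b (int a) S \<union> \<Union>(hor (int a) ` S) \<union> (`) (vrefl a) ` left_part b (int a) S"
  proof (cases "\<exists>u p. t = node u p")
    case False
    have "t \<notin> hex_triangles a b a" "t \<notin> left_part b (int a) S" "t \<notin> \<Union>(hor (int a) ` S)"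
      using False hex_triangles_node[of t a b a] left_part_node[of t] by (auto simp: hor_nodes)
    moreover have "t \<notin> (`) (vrefl a) ` left_part b (int a) S"
      using False by (auto simp: vrefl_node dest!: left_part_node)
    ultimately show ?thesis by simp
  next
    case True
    then obtain u p where t: "t = node u p" by blast
    have h: "t \<in> \<Union>(hor (int a) ` S) \<longleftrightarrow> (u = int a - 1 \<and> odd p \<and> p div 2 \<in> S) \<or> (u = int a \<and> even p \<and> p div 2 \<in> S)"
    proof
      assume "t \<in> \<Union>(hor (int a) ` S)"
      then show "(u = int a - 1 \<and> odd p \<and> p div 2 \<in> S) \<or> (u = int a \<and> even p \<and> p div 2 \<in> S)"
        by (auto simp: t hor_nodes)
    next
      assume "(u = int a - 1 \<and> odd p \<and> p div 2 \<in> S) \<or> (u = int a \<and> even p \<and> p div 2 \<in> S)"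
      then have "t \<in> hor (int a) (p div 2)" "p div 2 \<in> S" by (auto simp: t hor_nodes)
      then show "t \<in> \<Union>(hor (int a) ` S)" by blast
    qed
    have S: "v \<in> S \<Longrightarrow> 0 < int a \<and> - int a \<le> v \<and> v < int b" for v using assms by (auto simp: edges_def)
    have q: "odd (p + 2 * (u - int a) + 1) \<longleftrightarrow> even p" by simp
    have q2: "(p + 2 * (u - int a) + 1) div 2 = p div 2" if "u = int a" "even p" using that by auto
    show ?thesis
      unfolding Un_iff h unfolding t node_hex_triangles node_left_part node_reflect_left q
      using S[of "p div 2"] q2 by (auto 0 0; presburger)
  qed
qed

lemma reflect_tilings_of:
  assumes "T \<in> tilings_of A" shows "reflect_rhombus a ` T \<in> tilings_of ((`) (vrefl a) ` A)"
proof (rule tilings_ofI)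
  fix r assume "r \<in> reflect_rhombus a ` T" then show "unit_rhombus r"
    using tilings_ofD(1)[OF assms] reflect_unit_rhombus by auto
next
  show "\<Union>(reflect_rhombus a ` T) = (`) (vrefl a) ` A"
    unfolding tilings_ofD(2)[OF assms, symmetric] reflect_rhombus_def by auto
next
  fix r r' t assume "r \<in> reflect_rhombus a ` T" "r' \<in> reflect_rhombus a ` T" "t \<in> r" "t \<in> r'"
  then obtain s s' where "s \<in> T" "s' \<in> T" "r = reflect_rhombus a s" "r' = reflect_rhombus a s'"
     "vrefl a ` t \<in> s" "vrefl a ` t \<in> s'" by (auto simp: mem_reflect)
  then show "r = r'" using tilings_ofD(3)[OF assms, of s s' "vrefl a ` t"] by simp
qed

text \<open>Restricts an equality of two decomposed regions to the left half \<open>C\<close>, which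
  the mirror images \<open>B\<close> and \<open>B'\<close> do not meet.\<close>

lemma Un_restrict:
  assumes "A \<union> H \<union> B = A' \<union> H \<union> B'" "A \<inter> H = {}" "A' \<inter> H = {}" "A \<subseteq> C" "A' \<subseteq> C"
    "B \<inter> C = {}" "B' \<inter> C = {}"
  shows "A = A'"
proof -
  have *: "(x \<in> A \<or> x \<in> H \<or> x \<in> B) = (x \<in> A' \<or> x \<in> H \<or> x \<in> B')" for x
    using assms(1) by auto
  have "x \<in> A \<longleftrightarrow> x \<in> A'" for x
    using *[of x] assms(2-) by auto
  then show ?thesis by blast
qed

lemma central_rhombus_hor: "central_rhombus a b = hor (int a) ((int b - 1 - int a) div 2)"
  unfolding central_rhombus_def hor_def Let_def Rt_def Lt_def by (auto simp: insert_commute)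

text \<open>A symmetric tiling is its left part, the rhombi across the axis, and the mirror image of
  the left part. Rhombi across the axis are fixed by the reflection, so \<open>S\<close> is
  unrestricted except that it must contain the central edge.\<close>

theorem card_centered_sym_tilings:
  "card (centered_sym_tilings a b) =
    (\<Sum>S | S \<in> Pow (edges (int b) (int a)) \<and> (int b - 1 - int a) div 2 \<in> S. card (tilings_of (left_part (int b) (int a) S)))"
proof -
  let ?E = "{S. S \<in> Pow (edges (int b) (int a)) \<and> (int b - 1 - int a) div 2 \<in> S}"
  let ?H = "left_part (int b) (int a)"
  let ?A = "Sigma ?E (\<lambda>S. tilings_of (?H S))"
  let ?f = "\<lambda>(S, T). T \<union> hor (int a) ` S \<union> reflect_rhombus a ` T"
  let ?g = "\<lambda>T. ({v. hor (int a) v \<in> T}, {r\<in>T. r \<subseteq> ?H {}})"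
  have hor1: "\<not> hor (int a) v \<subseteq> ?H {}" for v by (simp add: hor_nodes node_left_part)
  have hinj: "hor (int a) v = hor (int a) w \<longleftrightarrow> v = w" for v w by (auto simp: hor_nodes doubleton_eq_iff)
  have hrefl: "reflect_rhombus a (hor (int a) v) = hor (int a) v" for v by (simp add: reflect_hor)
  have refl_left: "\<not> reflect_rhombus a r \<subseteq> ?H {}" if r: "r \<subseteq> ?H {}" "r \<noteq> {}" for r
  proof -
    obtain t where t: "t \<in> r" using r by blast
    then obtain u p where up: "t = node u p" "u < int a" using r(1) by (auto simp: left_part_def)
    have "vrefl a ` t \<in> reflect_rhombus a r" using t by (auto simp: reflect_rhombus_def)
    moreover have "vrefl a ` t \<notin> ?H {}" using up by (simp add: vrefl_node node_left_part)
    ultimately show ?thesis by blast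
  qed
  have "bij_betw ?f ?A (centered_sym_tilings a b)"
  proof (rule bij_betw_byWitness[where f' = ?g])
    show "\<forall>x\<in>?A. ?g (?f x) = x"
    proof
      fix x assume "x \<in> ?A"
      then obtain S T where x: "x = (S, T)" and T: "T \<in> tilings_of (?H S)" by auto
      have 1: "r \<subseteq> ?H {}" "r \<noteq> {}" if "r \<in> T" for r
        using tilings_ofD(2)[OF T] left_part_mono[of b a S] that rhombus_nonempty[OF tilings_ofD(1)[OF T that]] by auto
      have 2: "hor (int a) v \<notin> T" for v using 1(1)[of "hor (int a) v"] hor1[of v] by blast
      have 3: "hor (int a) v \<notin> reflect_rhombus a ` T" for v
      proof
        assume "hor (int a) v \<in> reflect_rhombus a ` T"
        then obtain r where "r \<in> T" "hor (int a) v = reflect_rhombus a r" by blast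
        then have "r = hor (int a) v" using hrefl[of v] reflect_reflect[of a r] by simp
        then show False using \<open>r \<in> T\<close> 2 by simp
      qed
      have 4: "\<not> r \<subseteq> ?H {}" if "r \<in> reflect_rhombus a ` T" for r
        using that 1 refl_left by auto
      have "{v. hor (int a) v \<in> T \<union> hor (int a) ` S \<union> reflect_rhombus a ` T} = S"
        using 2 3 by (auto simp: hinj)
      moreover have "{r \<in> T \<union> hor (int a) ` S \<union> reflect_rhombus a ` T. r \<subseteq> ?H {}} = T"
      proof -
        have "r \<subseteq> ?H {} \<longleftrightarrow> r \<in> T" if "r \<in> T \<union> hor (int a) ` S \<union> reflect_rhombus a ` T" for r
          using that 1(1)[of r] 4[of r] hor1 2 by blast
        then show ?thesis by blast
      qed
      ultimately show "?g (?f x) = x" by (simp add: x)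
    qed
    show "?f ` ?A \<subseteq> centered_sym_tilings a b"
    proof (rule image_subsetI)
      fix x assume "x \<in> ?A"
      then obtain S T where x: "x = (S, T)" and S: "S \<subseteq> edges (int b) (int a)" "(int b - 1 - int a) div 2 \<in> S"
        and T: "T \<in> tilings_of (?H S)" by auto
      have d1: "(?H S \<union> \<Union>(hor (int a) ` S)) \<inter> (`) (vrefl a) ` ?H S = {}"
      proof -
        have "t \<notin> (`) (vrefl a) ` ?H S" if "t \<in> ?H S \<union> \<Union>(hor (int a) ` S)" for t
        proof -
          from that have "\<exists>u p. t = node u p" by (auto simp: hor_nodes dest: left_part_node)
          then obtain u p where "t = node u p" by blast
          then show ?thesis using that by (auto simp: hor_nodes node_reflect_left node_left_part)
        qed
        then show ?thesis by blast
      qed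
      have "T \<union> hor (int a) ` S \<union> reflect_rhombus a ` T \<in> tilings_of (hex_triangles a b a)"
        unfolding hex_decompose[OF S(1)]
        by (intro tilings_of_Un T hor_image_tilings_of left_part_disjoint reflect_tilings_of d1)
      moreover have "reflect_rhombus a ` (T \<union> hor (int a) ` S \<union> reflect_rhombus a ` T) = T \<union> hor (int a) ` S \<union> reflect_rhombus a ` T"
        by (auto simp: image_Un image_image hrefl)
      ultimately have "T \<union> hor (int a) ` S \<union> reflect_rhombus a ` T \<in> centered_sym_tilings a b"
        using S(2) by (auto simp: centered_sym_tilings_def rhombus_tiling_iff vertically_symmetric_def central_rhombus_hor)
      then show "?f x \<in> centered_sym_tilings a b" by (simp add: x)
    qed
    have main: "?g T \<in> ?A \<and> ?f (?g T) = T" if "T \<in> centered_sym_tilings a b" for T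
    proof -
      have T: "T \<in> tilings_of (hex_triangles a b a)" and sym: "reflect_rhombus a ` T = T"
        and cent: "hor (int a) ((int b - 1 - int a) div 2) \<in> T"
        using that by (auto simp: centered_sym_tilings_def rhombus_tiling_iff vertically_symmetric_def central_rhombus_hor)
      define S where "S = {v. hor (int a) v \<in> T}"
      define T1 where "T1 = {r\<in>T. r \<subseteq> ?H {}}"
      have sub: "r \<subseteq> hex_triangles a b a" if "r \<in> T" for r using tilings_ofD(2)[OF T] that by blast
      have refl_T: "reflect_rhombus a r \<in> T" if "r \<in> T" for r using sym that by blast
      have SE: "S \<subseteq> edges (int b) (int a)"
      proof
        fix v assume "v \<in> S"
        then have "hor (int a) v \<subseteq> hex_triangles a b a" using sub by (simp add: S_def)
        then show "v \<in> edges (int b) (int a)" by (auto simp: hor_nodes node_hex_triangles edges_def)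
      qed
      have left: "r \<in> T1 \<or> r \<in> hor (int a) ` S \<or> (\<exists>u v. int a < u \<and> r = hor u v) \<or> (\<exists>u p. int a \<le> u \<and> r = vert u p)"
        if r: "r \<in> T" for r
        using tilings_ofD(1)[OF T r] unfolding unit_rhombus_iff
      proof (elim disjE exE)
        fix u v assume uv: "r = hor u v"
        consider "u < int a" | "u = int a" | "int a < u" by linarith
        then show ?thesis
        proof cases
          case 1
          then show ?thesis using sub[OF r] r uv unfolding T1_def by (auto simp: hor_nodes node_hex_triangles node_left_part)
        qed (use r uv in \<open>auto simp: S_def\<close>)
      next
        fix u p assume up: "r = vert u p"
        show ?thesis
        proof (cases "u < int a")
          case True
          then show ?thesis using sub[OF r] r up unfolding T1_def by (auto simp: vert_def node_hex_triangles node_left_part)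
        next
          case False
          then have "int a \<le> u" by simp
          then show ?thesis using up by blast
        qed
      qed
      \<comment> \<open>What is neither on the left nor on the axis is reflected to the left, and by
        symmetry the image is again in \<open>T\<close>.\<close>
      have right: "reflect_rhombus a r \<in> T1" if r: "r \<in> T" "r \<notin> T1" "r \<notin> hor (int a) ` S" for r
      proof -
        have h: "hor u v \<notin> hor (int a) ` S" if "u < int a" for u v
          using that by (auto simp: hor_nodes doubleton_eq_iff)
        have "(\<exists>u v. int a < u \<and> r = hor u v) \<or> (\<exists>u p. int a \<le> u \<and> r = vert u p)"
          using left[OF r(1)] r by blast
        then show ?thesis
        proof (elim disjE exE conjE)
          fix u v assume uv: "int a < u" "r = hor u v"
          have "hor (2 * int a - u) (v + u - int a) \<in> T" using refl_T[OF r(1)] uv by (simp add: reflect_hor)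
          from left[OF this] uv have "hor (2 * int a - u) (v + u - int a) \<in> T1"
            by (auto simp: hor_nodes vert_def doubleton_eq_iff)
          then show ?thesis using uv by (simp add: reflect_hor)
        next
          fix u p assume up: "int a \<le> u" "r = vert u p"
          have "vert (2 * int a - u - 1) (p + 2 * (u - int a) + 1) \<in> T" using refl_T[OF r(1)] up by (simp add: reflect_vert)
          from left[OF this] up have "vert (2 * int a - u - 1) (p + 2 * (u - int a) + 1) \<in> T1"
            by (auto simp: hor_nodes vert_def doubleton_eq_iff)
          then show ?thesis using up by (simp add: reflect_vert)
        qed
      qed
      have eq: "T1 \<union> hor (int a) ` S \<union> reflect_rhombus a ` T1 = T"
      proof (intro set_eqI iffI)
        fix r assume "r \<in> T1 \<union> hor (int a) ` S \<union> reflect_rhombus a ` T1"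
        then show "r \<in> T" using refl_T by (auto simp: T1_def S_def)
      next
        fix r assume "r \<in> T"
        moreover have "r \<in> reflect_rhombus a ` T1" if "reflect_rhombus a r \<in> T1"
          using imageI[OF that, of "reflect_rhombus a"] by simp
        ultimately show "r \<in> T1 \<union> hor (int a) ` S \<union> reflect_rhombus a ` T1" using right by blast
      qed
      have uT: "\<Union>T1 \<union> \<Union>(hor (int a) ` S) \<union> \<Union>(reflect_rhombus a ` T1) =
          ?H S \<union> \<Union>(hor (int a) ` S) \<union> (`) (vrefl a) ` ?H S"
        using arg_cong[OF eq, of Union] unfolding hex_decompose[OF SE, symmetric] tilings_ofD(2)[OF T, symmetric]
        by (simp only: Union_Un_distrib)
      have d: "\<Union>T1 \<inter> \<Union>(hor (int a) ` S) = {}"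
      proof -
        have False if "t \<in> r" "r \<in> T1" "v \<in> S" "t \<in> hor (int a) v" for t r v
        proof -
          have "r = hor (int a) v" using tilings_ofD(3)[OF T, of r "hor (int a) v" t] that by (auto simp: T1_def S_def)
          then show False using that hor1 by (auto simp: T1_def)
        qed
        then show ?thesis by blast
      qed
      have s1: "\<Union>T1 \<subseteq> ?H {}" by (auto simp: T1_def)
      have refl_H: "(`) (vrefl a) ` A \<inter> ?H {} = {}" if "A \<subseteq> ?H {}" for A
      proof -
        have "vrefl a ` t \<notin> ?H {}" if "t \<in> A" for t
        proof -
          have "t \<in> ?H {}" using that \<open>A \<subseteq> ?H {}\<close> by blast
          then obtain u p where "t = node u p" "u < int a" by (auto simp: left_part_def)
          then show ?thesis by (simp add: vrefl_node node_left_part)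
        qed
        then show ?thesis by blast
      qed
      have rU: "\<Union>(reflect_rhombus a ` T1) = (`) (vrefl a) ` \<Union>T1" by (auto simp: reflect_rhombus_def)
      have "\<Union>T1 = ?H S"
      proof (rule Un_restrict[OF uT d left_part_disjoint(1) s1 left_part_mono])
        show "\<Union>(reflect_rhombus a ` T1) \<inter> ?H {} = {}" unfolding rU by (rule refl_H[OF s1])
        show "(`) (vrefl a) ` ?H S \<inter> ?H {} = {}" by (rule refl_H[OF left_part_mono])
      qed
      then have "T1 \<in> tilings_of (?H S)"
        using tilings_of_subset[OF T] by (auto simp: T1_def)
      then show ?thesis using SE eq cent by (simp add: S_def T1_def)
    qed
    show "\<forall>T\<in>centered_sym_tilings a b. ?f (?g T) = T" using main by blast
    show "?g ` centered_sym_tilings a b \<subseteq> ?A" using main by blast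
  qed
  then have "card (centered_sym_tilings a b) = card ?A" by (rule bij_betw_same_card[symmetric])
  also have "\<dots> = (\<Sum>S\<in>?E. card (tilings_of (?H S)))"
    by (subst card_SigmaI) (auto simp: finite_edges finite_tilings_of finite_left_part)
  finally show ?thesis .
qed

section \<open>Central differences and means of polynomials\<close>

text \<open>The top coefficient is unaffected by a shift and the next one changes linearly in
  \<open>c\<close>; this gives both the loss of one degree under a difference and the new leading
  coefficient.\<close>

lemma coeff_shift:
  fixes p :: "real poly"
  assumes "degree p \<le> n"
  shows "coeff (pcompose p [:c, 1:]) n = coeff p n \<and>
    (0 < n \<longrightarrow> coeff (pcompose p [:c, 1:]) (n - 1) = coeff p (n - 1) + real n * c * coeff p n)"
  using assms
proof (induction p arbitrary: n)
  case 0
  then show ?case by simp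
next
  case (pCons a p)
  let ?P = "pcompose p [:c, 1:]"
  have P: "pcompose (pCons a p) [:c, 1:] = pCons a 0 + smult c ?P + pCons 0 ?P"
    by (simp add: pcompose_pCons algebra_simps)
  show ?case
  proof (cases n)
    case 0
    then have "p = 0" using pCons by (auto split: if_splits)
    then show ?thesis using 0 by simp
  next
    case (Suc m)
    have d: "degree p \<le> m" using pCons.prems Suc by (auto split: if_splits)
    then have "coeff ?P (Suc m) = 0" by (intro coeff_eq_0) (simp add: degree_pcompose)
    then show ?thesis
      using pCons.IH[OF d] Suc by (cases m) (auto simp: P coeff_pCons algebra_simps)
  qed
qed

definition cdiff :: "real poly \<Rightarrow> real poly" where
  "cdiff p = pcompose p [:1/2, 1:] - pcompose p [:-1/2, 1:]"

definition cmean :: "real poly \<Rightarrow> real poly" where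
  "cmean p = pcompose p [:1/2, 1:] + pcompose p [:-1/2, 1:]"

lemma poly_cdiff: "poly (cdiff p) s = poly p (s + 1/2) - poly p (s - 1/2)"
  by (simp add: cdiff_def poly_pcompose algebra_simps)

lemma poly_cmean: "poly (cmean p) s = poly p (s + 1/2) + poly p (s - 1/2)"
  by (simp add: cmean_def poly_pcompose algebra_simps)

lemma cdiff_degree:
  assumes "degree p \<le> Suc d"
  shows "degree (cdiff p) \<le> d" "coeff (cdiff p) d = real (Suc d) * coeff p (Suc d)"
proof -
  show "degree (cdiff p) \<le> d"
  proof (rule degree_le, intro allI impI)
    fix i assume "d < i"
    show "coeff (cdiff p) i = 0"
    proof (cases "i = Suc d")
      case True
      then show ?thesis using coeff_shift[OF assms] by (simp add: cdiff_def)
    next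
      case False
      then have "degree p < i" using \<open>d < i\<close> assms by simp
      then show ?thesis by (simp add: cdiff_def coeff_eq_0 degree_pcompose)
    qed
  qed
  show "coeff (cdiff p) d = real (Suc d) * coeff p (Suc d)"
    using coeff_shift[OF assms, of "1/2"] coeff_shift[OF assms, of "-1/2"] by (simp add: cdiff_def field_simps)
qed

lemma cdiff_funpow_degree:
  "degree p \<le> d + k \<Longrightarrow> degree ((cdiff ^^ k) p) \<le> d \<and> coeff ((cdiff ^^ k) p) d = fact (d + k) / fact d * coeff p (d + k)"
proof (induction k arbitrary: d)
  case (Suc k)
  have "degree p \<le> Suc d + k" using Suc.prems by simp
  from Suc.IH[OF this] have IH: "degree ((cdiff ^^ k) p) \<le> Suc d"
    "coeff ((cdiff ^^ k) p) (Suc d) = fact (Suc d + k) / fact (Suc d) * coeff p (Suc d + k)" by auto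
  have f: "real (Suc d) * (fact (Suc d + k) / fact (Suc d)) = fact (d + Suc k) / fact d"
    by (subst fact_Suc[of d]) (simp del: fact_Suc of_nat_Suc)
  have "coeff ((cdiff ^^ Suc k) p) d = real (Suc d) * (fact (Suc d + k) / fact (Suc d)) * coeff p (Suc d + k)"
    using cdiff_degree(2)[OF IH(1)] IH(2) by (simp del: fact_Suc of_nat_Suc)
  then show ?case using cdiff_degree(1)[OF IH(1)] unfolding f by simp
qed simp

lemma cmean_degree:
  assumes "degree p \<le> d"
  shows "degree (cmean p) \<le> d" "coeff (cmean p) d = 2 * coeff p d"
proof -
  show "degree (cmean p) \<le> d"
    unfolding cmean_def using assms by (intro degree_add_le) (simp_all add: degree_pcompose)
  show "coeff (cmean p) d = 2 * coeff p d"
    using coeff_shift[OF assms, of "1/2"] coeff_shift[OF assms, of "-1/2"] by (simp add: cmean_def)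
qed

text \<open>On polynomials of bounded degree the mean is triangular with 2 on the diagonal; the
  preimage is built from the top coefficient downwards.\<close>

lemma cmean_surj: "degree p \<le> d \<Longrightarrow> \<exists>q. degree q \<le> d \<and> cmean q = p"
proof (induction d arbitrary: p)
  case 0
  then obtain c where "p = [:c:]" by (auto elim!: degree_eq_zeroE)
  then have "cmean [:c / 2:] = p" by (simp add: cmean_def)
  then show ?case by (intro exI[of _ "[:c / 2:]"]) simp
next
  case (Suc d)
  define m where "m = monom (coeff p (Suc d) / 2) (Suc d)"
  have m: "degree m \<le> Suc d" "coeff m (Suc d) = coeff p (Suc d) / 2"
    by (auto simp: m_def degree_monom_le)
  have "degree (p - cmean m) \<le> d"
  proof (rule degree_le, intro allI impI)
    fix i assume "d < i"
    show "coeff (p - cmean m) i = 0"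
    proof (cases "i = Suc d")
      case True
      then show ?thesis using cmean_degree(2)[OF m(1)] m(2) by simp
    next
      case False
      then have "degree p < i" "degree (cmean m) < i" using \<open>d < i\<close> Suc.prems cmean_degree(1)[OF m(1)] by auto
      then show ?thesis by (simp add: coeff_eq_0)
    qed
  qed
  then obtain q where q: "degree q \<le> d" "cmean q = p - cmean m" using Suc.IH by blast
  have "cmean (m + q) = p" using q(2) by (simp add: cmean_def pcompose_add algebra_simps)
  moreover have "degree (m + q) \<le> Suc d" using m(1) q(1) by (intro degree_add_le) auto
  ultimately show ?case by blast
qed

definition preflect :: "real poly \<Rightarrow> real poly" where
  "preflect p = pcompose p [:0, -1:]"

lemma poly_preflect [simp]: "poly (preflect p) s = poly p (- s)"
  by (simp add: preflect_def poly_pcompose)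

section \<open>Sums over symmetric grids\<close>

text \<open>The points are centred at 0, integers for odd M and half-integers for even M. Half-step
  differences therefore pass between the grids of M and M + 1 points.\<close>

definition grid_sum :: "nat \<Rightarrow> (real \<Rightarrow> real) \<Rightarrow> real" where
  "grid_sum M f = (\<Sum>i<M. f (real i - (real M - 1) / 2))"

definition alt_grid_sum :: "nat \<Rightarrow> (real \<Rightarrow> real) \<Rightarrow> real" where
  "alt_grid_sum M f = (\<Sum>i<M. (-1) ^ i * f (real i - (real M - 1) / 2))"

text \<open>Summation by parts. As \<open>u\<close> vanishes at the two points just outside the
  smaller grid, no boundary terms remain.\<close>

lemma grid_sum_by_parts:
  assumes "u ((real M + 1) / 2) = 0" "u (- ((real M + 1) / 2)) = 0"
  shows "grid_sum (Suc M) (\<lambda>s. f s * (u (s + 1/2) - u (s - 1/2))) = - grid_sum M (\<lambda>s. (f (s + 1/2) - f (s - 1/2)) * u s)"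
proof -
  define s where "s i = real i - real M / 2" for i
  have "grid_sum (Suc M) (\<lambda>s. f s * (u (s + 1/2) - u (s - 1/2))) =
      (\<Sum>i<Suc M. f (s i) * u (s i + 1/2)) - (\<Sum>i<Suc M. f (s i) * u (s i - 1/2))"
    by (simp add: grid_sum_def s_def sum_subtractf algebra_simps)
  also have "(\<Sum>i<Suc M. f (s i) * u (s i + 1/2)) = (\<Sum>i<M. f (s i) * u (s i + 1/2))"
    using assms(1) by (simp add: s_def field_simps)
  also have "(\<Sum>i<Suc M. f (s i) * u (s i - 1/2)) = (\<Sum>i<M. f (s (Suc i)) * u (s (Suc i) - 1/2))"
  proof -
    have "s 0 - 1/2 = - ((real M + 1) / 2)" by (simp add: s_def field_simps)
    then have "u (s 0 - 1/2) = 0" using assms(2) by simp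
    then show ?thesis unfolding sum.lessThan_Suc_shift by simp
  qed
  also have "(\<Sum>i<M. f (s i) * u (s i + 1/2)) - (\<Sum>i<M. f (s (Suc i)) * u (s (Suc i) - 1/2)) =
      - grid_sum M (\<lambda>s. (f (s + 1/2) - f (s - 1/2)) * u s)"
    unfolding grid_sum_def sum_subtractf[symmetric] sum_negf[symmetric]
  proof (intro sum.cong refl)
    fix i
    have e: "s i + 1/2 = real i - (real M - 1) / 2" "s (Suc i) - 1/2 = real i - (real M - 1) / 2"
       "real i - (real M - 1) / 2 + 1/2 = s (Suc i)" "real i - (real M - 1) / 2 - 1/2 = s i"
      by (simp_all add: s_def field_simps)
    show "f (s i) * u (s i + 1/2) - f (s (Suc i)) * u (s (Suc i) - 1/2) =
       - ((f (real i - (real M - 1) / 2 + 1/2) - f (real i - (real M - 1) / 2 - 1/2)) * u (real i - (real M - 1) / 2))"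
      unfolding e by (simp add: algebra_simps)
  qed
  finally show ?thesis .
qed

text \<open>Covers both uses: c = 1 is the mean, where only boundary values survive, and c = -1 is
  the difference, which doubles the alternating sum when the boundary values vanish.\<close>

lemma alt_grid_sum_telescope:
  fixes u :: "real \<Rightarrow> real"
  shows "alt_grid_sum (Suc M) (\<lambda>s. u (s + 1/2) + c * u (s - 1/2)) =
    c * u (- ((real M + 1) / 2)) + (-1) ^ M * u ((real M + 1) / 2) + (1 - c) * alt_grid_sum M u"
proof -
  define r where "r i = real i - (real M + 1) / 2" for i
  have r: "r 0 = - ((real M + 1) / 2)" "r (Suc M) = (real M + 1) / 2" "r (Suc i) = real i - (real M - 1) / 2" for i
    by (simp_all add: r_def field_simps)
  have "alt_grid_sum (Suc M) (\<lambda>s. u (s + 1/2) + c * u (s - 1/2)) =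
      (\<Sum>i<Suc M. (-1) ^ i * u (r (Suc i))) + c * (\<Sum>i<Suc M. (-1) ^ i * u (r i))"
    unfolding alt_grid_sum_def sum_distrib_left sum.distrib[symmetric]
  proof (intro sum.cong refl)
    fix i
    have "real i - (real (Suc M) - 1) / 2 + 1/2 = r (Suc i)" "real i - (real (Suc M) - 1) / 2 - 1/2 = r i"
      by (simp_all add: r_def field_simps)
    then show "(-1) ^ i * (u (real i - (real (Suc M) - 1) / 2 + 1/2) + c * u (real i - (real (Suc M) - 1) / 2 - 1/2)) =
        (-1) ^ i * u (r (Suc i)) + c * ((-1) ^ i * u (r i))"
      by (simp only: distrib_left mult.left_commute)
  qed
  also have "(\<Sum>i<Suc M. (-1) ^ i * u (r (Suc i))) = alt_grid_sum M u + (-1) ^ M * u ((real M + 1) / 2)"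
    unfolding sum.lessThan_Suc r(2) by (simp only: alt_grid_sum_def r(3))
  also have "(\<Sum>i<Suc M. (-1) ^ i * u (r i)) = u (- ((real M + 1) / 2)) - alt_grid_sum M u"
    unfolding sum.lessThan_Suc_shift r(1) alt_grid_sum_def r(3) by (simp add: sum_negf)
  finally show ?thesis by (simp add: algebra_simps)
qed

lemma grid_sum_scale: "grid_sum M (\<lambda>s. c * f s) = c * grid_sum M f"
  by (simp add: grid_sum_def sum_distrib_left algebra_simps)

lemma grid_sum_reflect: "grid_sum M (\<lambda>s. f (- s)) = grid_sum M f"
  unfolding grid_sum_def
proof (rule sum.reindex_bij_witness[where i = "\<lambda>i. M - 1 - i" and j = "\<lambda>i. M - 1 - i"])
  fix i assume "i \<in> {..<M}"
  then have "real (M - 1 - i) - (real M - 1) / 2 = - (real i - (real M - 1) / 2)"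
    by (simp add: of_nat_diff field_simps)
  then show "f (real (M - 1 - i) - (real M - 1) / 2) = f (- (real i - (real M - 1) / 2))" by (simp only:)
qed auto

text \<open>Keeps track of k consecutive zeros on each side, the innermost at distance c. A
  difference costs one zero per side and moves the innermost out by 1/2, which matches the growth of
  the grid by one point.\<close>

definition vanish :: "(real \<Rightarrow> real) \<Rightarrow> real \<Rightarrow> nat \<Rightarrow> bool" where
  "vanish u c k \<longleftrightarrow> (\<forall>i<k. u (c + real i) = 0 \<and> u (- (c + real i)) = 0)"

lemma vanish_cdiff: "vanish (poly u) c (Suc k) \<Longrightarrow> vanish (poly (cdiff u)) (c + 1/2) k"
proof -
  assume v: "vanish (poly u) c (Suc k)"
  show ?thesis unfolding vanish_def
  proof (intro allI impI)
    fix i assume "i < k"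
    then have "poly u (c + real i) = 0 \<and> poly u (- (c + real i)) = 0"
      "poly u (c + real (Suc i)) = 0 \<and> poly u (- (c + real (Suc i))) = 0"
      using v unfolding vanish_def by (meson less_SucI Suc_less_eq)+
    moreover have e: "c + 1/2 + real i + 1/2 = c + real (Suc i)" "c + 1/2 + real i - 1/2 = c + real i"
      "- (c + 1/2 + real i) + 1/2 = - (c + real i)" "- (c + 1/2 + real i) - 1/2 = - (c + real (Suc i))"
      by auto
    ultimately show "poly (cdiff u) (c + 1/2 + real i) = 0 \<and> poly (cdiff u) (- (c + 1/2 + real i)) = 0"
      unfolding poly_cdiff e by (simp only:) simp
  qed
qed

lemma vanish_cdiff_funpow: "vanish (poly u) c (k + j) \<Longrightarrow> vanish (poly ((cdiff ^^ j) u)) (c + real j / 2) k"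
proof (induction j arbitrary: k)
  case (Suc j)
  have "vanish (poly ((cdiff ^^ j) u)) (c + real j / 2) (Suc k)" using Suc.IH[of "Suc k"] Suc.prems by simp
  from vanish_cdiff[OF this] show ?case by (simp add: algebra_simps add_divide_distrib)
qed simp

lemma vanish_top:
  assumes "vanish (poly w) ((real m + 1) / 2) (Suc k)"
  shows "poly ((cdiff ^^ k) w) ((real (m + k) + 1) / 2) = 0" "poly ((cdiff ^^ k) w) (- ((real (m + k) + 1) / 2)) = 0"
proof -
  have "vanish (poly ((cdiff ^^ k) w)) ((real m + 1) / 2 + real k / 2) 1"
    using vanish_cdiff_funpow[of w _ 1 k] assms by simp
  moreover have "(real m + 1) / 2 + real k / 2 = (real (m + k) + 1) / 2" by (simp add: field_simps)
  ultimately show "poly ((cdiff ^^ k) w) ((real (m + k) + 1) / 2) = 0" "poly ((cdiff ^^ k) w) (- ((real (m + k) + 1) / 2)) = 0"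
    by (auto simp: vanish_def)
qed

lemma vanish_less: "vanish u c k \<Longrightarrow> j \<le> k \<Longrightarrow> vanish u c j"
  by (auto simp: vanish_def)

section \<open>Iterated differences under plain and alternating sums\<close>

lemma grid_sum_by_parts_funpow:
  "vanish (poly w) ((real m + 1) / 2) k \<Longrightarrow>
    grid_sum (m + k) (\<lambda>s. poly f s * poly ((cdiff ^^ k) w) s) = (-1) ^ k * grid_sum m (\<lambda>s. poly ((cdiff ^^ k) f) s * poly w s)"
proof (induction k arbitrary: f)
  case (Suc k)
  have "grid_sum (m + Suc k) (\<lambda>s. poly f s * poly ((cdiff ^^ Suc k) w) s) = - grid_sum (m + k) (\<lambda>s. poly (cdiff f) s * poly ((cdiff ^^ k) w) s)"
    using grid_sum_by_parts[of "poly ((cdiff ^^ k) w)" "m + k" "poly f"] vanish_top[OF Suc.prems] by (simp add: poly_cdiff)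
  also have "\<dots> = - ((-1) ^ k * grid_sum m (\<lambda>s. poly ((cdiff ^^ k) (cdiff f)) s * poly w s))"
    using Suc.IH[of "cdiff f"] vanish_less[OF Suc.prems] by simp
  finally show ?case by (simp add: funpow_swap1)
qed simp

lemma alt_grid_sum_cdiff_funpow:
  "vanish (poly w) ((real m + 1) / 2) k \<Longrightarrow> alt_grid_sum (m + k) (poly ((cdiff ^^ k) w)) = 2 ^ k * alt_grid_sum m (poly w)"
proof (induction k)
  case (Suc k)
  have "alt_grid_sum (Suc (m + k)) (\<lambda>s. poly ((cdiff ^^ k) w) (s + 1/2) + (- 1) * poly ((cdiff ^^ k) w) (s - 1/2)) = 2 * alt_grid_sum (m + k) (poly ((cdiff ^^ k) w))"
    unfolding alt_grid_sum_telescope using vanish_top[OF Suc.prems] by simp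
  also have "(\<lambda>s. poly ((cdiff ^^ k) w) (s + 1/2) + (- 1) * poly ((cdiff ^^ k) w) (s - 1/2)) = poly ((cdiff ^^ Suc k) w)"
    by (simp add: poly_cdiff fun_eq_iff)
  finally show ?case using Suc.IH vanish_less[OF Suc.prems, of k] by simp
qed simp

section \<open>Convolutions of binomial coefficients\<close>

text \<open>The three series are (1 - X)^(-k-1), (1 + X)^(-k-1) and (1 - X^2)^(-k-1). The
  convolution identities compare the square of the first, or its product with the second, with a
  single power.\<close>

definition binom_fps :: "nat \<Rightarrow> real fps" where "binom_fps k = Abs_fps (\<lambda>i. real ((i + k) choose k))"
definition alt_binom_fps :: "nat \<Rightarrow> real fps" where "alt_binom_fps k = Abs_fps (\<lambda>i. (-1) ^ i * real ((i + k) choose k))"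
definition even_binom_fps :: "nat \<Rightarrow> real fps" where "even_binom_fps k = Abs_fps (\<lambda>i. if even i then real ((i div 2 + k) choose k) else 0)"

lemma binom_fps_Suc: "(1 - fps_X) * binom_fps (Suc k) = binom_fps k"
proof (rule fps_ext)
  fix n show "fps_nth ((1 - fps_X) * binom_fps (Suc k)) n = fps_nth (binom_fps k) n"
    by (cases n) (simp_all add: binom_fps_def algebra_simps)
qed

lemma alt_binom_fps_Suc: "(1 + fps_X) * alt_binom_fps (Suc k) = alt_binom_fps k"
proof (rule fps_ext)
  fix n show "fps_nth ((1 + fps_X) * alt_binom_fps (Suc k)) n = fps_nth (alt_binom_fps k) n"
    by (cases n) (simp_all add: alt_binom_fps_def algebra_simps)
qed

lemma fps_nth_one_minus_X2: "fps_nth ((1 - fps_X ^ 2) * (f :: real fps)) n = fps_nth f n - (if n < 2 then 0 else fps_nth f (n - 2))"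
proof -
  have "(1 - fps_X ^ 2) * f = f - fps_X ^ 2 * f" by (simp add: algebra_simps)
  then show ?thesis by (simp add: fps_X_power_mult_nth)
qed

lemma even_binom_fps_Suc: "(1 - fps_X ^ 2) * even_binom_fps (Suc k) = even_binom_fps k"
proof (rule fps_ext)
  fix n
  show "fps_nth ((1 - fps_X ^ 2) * even_binom_fps (Suc k)) n = fps_nth (even_binom_fps k) n"
  proof (cases "even n \<and> 2 \<le> n")
    case True
    then obtain m where "n = 2 * m" "m \<noteq> 0" by (auto elim!: evenE)
    then obtain m' where "n = 2 * Suc m'" by (cases m) auto
    then show ?thesis unfolding fps_nth_one_minus_X2 by (simp add: even_binom_fps_def algebra_simps)
  next
    case False
    then show ?thesis unfolding fps_nth_one_minus_X2 by (auto simp: even_binom_fps_def less_2_cases_iff)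
  qed
qed

lemma binom_fps_0: "(1 - fps_X) * binom_fps 0 = 1" and alt_binom_fps_0: "(1 + fps_X) * alt_binom_fps 0 = 1" and even_binom_fps_0: "(1 - fps_X ^ 2) * even_binom_fps 0 = 1"
proof -
  show "(1 - fps_X) * binom_fps 0 = 1"
    by (rule fps_ext) (auto simp: binom_fps_def algebra_simps split: nat.split)
  show "(1 + fps_X) * alt_binom_fps 0 = 1"
  proof (rule fps_ext)
    fix n show "fps_nth ((1 + fps_X) * alt_binom_fps 0) n = fps_nth 1 n" by (cases n) (simp_all add: alt_binom_fps_def algebra_simps)
  qed
  show "(1 - fps_X ^ 2) * even_binom_fps 0 = 1"
    by (rule fps_ext, unfold fps_nth_one_minus_X2) (auto simp: even_binom_fps_def less_2_cases_iff)
qed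

lemma fps_cancels: "(1 - fps_X :: real fps) \<noteq> 0" "(1 + fps_X :: real fps) \<noteq> 0"
proof -
  have "fps_nth (1 - fps_X :: real fps) 0 = 1" "fps_nth (1 + fps_X :: real fps) 0 = 1" by simp_all
  then show "(1 - fps_X :: real fps) \<noteq> 0" "(1 + fps_X :: real fps) \<noteq> 0" by fastforce+
qed

lemma binom_fps_square: "binom_fps k * binom_fps k = binom_fps (2 * k + 1)"
proof (induction k)
  case 0
  have "(1 - fps_X) * (binom_fps 0 * binom_fps 0) = (1 - fps_X) * binom_fps 1" using binom_fps_0 binom_fps_Suc[of 0] by (simp add: mult.assoc[symmetric])
  then show ?case using fps_cancels by simp
next
  case (Suc k)
  have "(1 - fps_X) * ((1 - fps_X) * (binom_fps (Suc k) * binom_fps (Suc k))) = ((1 - fps_X) * binom_fps (Suc k)) * ((1 - fps_X) * binom_fps (Suc k))"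
    by (simp only: mult_ac)
  also have "\<dots> = (1 - fps_X) * binom_fps (Suc (2 * k + 1))" unfolding binom_fps_Suc using Suc by (simp add: binom_fps_Suc)
  also have "\<dots> = (1 - fps_X) * ((1 - fps_X) * binom_fps (Suc (Suc (2 * k + 1))))" unfolding binom_fps_Suc by simp
  finally have "binom_fps (Suc k) * binom_fps (Suc k) = binom_fps (Suc (Suc (2 * k + 1)))" using fps_cancels by simp
  then show ?case by simp
qed

lemma binom_fps_mult_alt: "binom_fps k * alt_binom_fps k = even_binom_fps k"
proof (induction k)
  case 0
  have "(1 - fps_X) * ((1 + fps_X) * (binom_fps 0 * alt_binom_fps 0)) = ((1 - fps_X) * binom_fps 0) * ((1 + fps_X) * alt_binom_fps 0)" by (simp only: mult_ac)
  also have "\<dots> = (1 - fps_X ^ 2) * even_binom_fps 0" by (simp add: binom_fps_0 alt_binom_fps_0 even_binom_fps_0)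
  also have "\<dots> = (1 - fps_X) * ((1 + fps_X) * even_binom_fps 0)" by (simp add: algebra_simps power2_eq_square)
  finally show ?case using fps_cancels by simp
next
  case (Suc k)
  have "(1 - fps_X) * ((1 + fps_X) * (binom_fps (Suc k) * alt_binom_fps (Suc k))) = ((1 - fps_X) * binom_fps (Suc k)) * ((1 + fps_X) * alt_binom_fps (Suc k))"
    by (simp only: mult_ac)
  also have "\<dots> = (1 - fps_X ^ 2) * even_binom_fps (Suc k)" using Suc by (simp add: binom_fps_Suc alt_binom_fps_Suc even_binom_fps_Suc)
  also have "\<dots> = (1 - fps_X) * ((1 + fps_X) * even_binom_fps (Suc k))" by (simp add: algebra_simps power2_eq_square)
  finally show ?case using fps_cancels by simp
qed

lemma sum_choose_convolution:
  "(\<Sum>i\<le>n. real ((i + k) choose k) * real ((n - i + k) choose k)) = real ((n + 2 * k + 1) choose (2 * k + 1))"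
  using arg_cong[OF binom_fps_square[of k], of "\<lambda>f. fps_nth f n"] by (simp add: binom_fps_def fps_mult_nth atLeast0AtMost)

lemma sum_choose_convolution_alternating:
  "(\<Sum>i\<le>2 * l. (-1) ^ i * (real ((i + k) choose k) * real ((2 * l - i + k) choose k))) = real ((l + k) choose k)"
proof -
  have "fps_nth (alt_binom_fps k * binom_fps k) (2 * l) = real ((l + k) choose k)"
    using binom_fps_mult_alt[of k] by (simp add: mult.commute even_binom_fps_def)
  then show ?thesis by (simp add: binom_fps_def alt_binom_fps_def fps_mult_nth atLeast0AtMost mult.assoc)
qed

section \<open>Discrete Chebyshev polynomials\<close>

text \<open>The discrete analogue of (s^2 - 1)^k in Rodrigues' formula: its zeros are the k points
  on either side directly outside the grid of M - k points, so that k differences reach the grid of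
  M points without boundary terms.\<close>

definition cheb_weight :: "nat \<Rightarrow> nat \<Rightarrow> real poly" where
  "cheb_weight M k = (\<Prod>i<k. [:- (((real M + real k - 1) / 2 - real i) ^ 2), 0, 1:])"

text \<open>The orthogonal polynomials for the uniform weight on the \<open>M\<close> points
  \<open>-(M-1)/2, \<dots>, (M-1)/2\<close>, by their Rodrigues formula.\<close>

definition cheb :: "nat \<Rightarrow> nat \<Rightarrow> real poly" where
  "cheb M k = smult (1 / fact k) ((cdiff ^^ k) (cheb_weight M k))"

definition psum :: "nat \<Rightarrow> real poly \<Rightarrow> real" where "psum M p = grid_sum M (poly p)"
definition apsum :: "nat \<Rightarrow> real poly \<Rightarrow> real" where "apsum M p = alt_grid_sum M (poly p)"

section \<open>Sums of polynomials and of the weight over the grid\<close>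

lemma psum_add: "psum M (p + q) = psum M p + psum M q"
  and psum_diff: "psum M (p - q) = psum M p - psum M q"
  and psum_smult: "psum M (smult c p) = c * psum M p"
  and apsum_add: "apsum M (p + q) = apsum M p + apsum M q"
  and apsum_smult: "apsum M (smult c p) = c * apsum M p"
  by (simp_all add: psum_def apsum_def grid_sum_def alt_grid_sum_def sum.distrib sum_subtractf sum_distrib_left algebra_simps)

lemma psum_0 [simp]: "psum M 0 = 0" and apsum_0 [simp]: "apsum M 0 = 0"
  by (simp_all add: psum_def apsum_def grid_sum_def alt_grid_sum_def)

lemma psum_sum: "psum M (\<Sum>i\<in>I. p i) = (\<Sum>i\<in>I. psum M (p i))"
  by (induction I rule: infinite_finite_induct) (simp_all add: psum_add)

lemma apsum_sum: "apsum M (\<Sum>i\<in>I. p i) = (\<Sum>i\<in>I. apsum M (p i))"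
  by (induction I rule: infinite_finite_induct) (simp_all add: apsum_add)

lemma cheb_weight_degree: "degree (cheb_weight M k) = 2 * k" "coeff (cheb_weight M k) (2 * k) = 1"
proof -
  show d: "degree (cheb_weight M k) = 2 * k"
    unfolding cheb_weight_def by (subst degree_prod_eq_sum_degree) auto
  have "lead_coeff (cheb_weight M k) = 1"
    unfolding cheb_weight_def by (subst lead_coeff_prod) simp
  then show "coeff (cheb_weight M k) (2 * k) = 1" by (simp add: d)
qed

lemma cheb_weight_poly: "poly (cheb_weight M k) s = (\<Prod>i<k. s ^ 2 - ((real M + real k - 1) / 2 - real i) ^ 2)"
  unfolding cheb_weight_def poly_prod by (intro prod.cong refl) (simp add: power2_eq_square algebra_simps)

lemma cheb_weight_even: "poly (cheb_weight M k) (- s) = poly (cheb_weight M k) s"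
  by (simp add: cheb_weight_poly)

lemma cheb_weight_vanish: "vanish (poly (cheb_weight (m + k) k)) ((real m + 1) / 2) k"
  unfolding vanish_def
proof (intro allI impI)
  fix i assume "i < k"
  then have "(real m + 1) / 2 + real i = (real (m + k) + real k - 1) / 2 - real (k - 1 - i)" "k - 1 - i < k"
    by (simp_all add: of_nat_diff field_simps)
  then have "poly (cheb_weight (m + k) k) ((real m + 1) / 2 + real i) = 0"
    unfolding cheb_weight_poly by (intro prod_zero) auto
  then show "poly (cheb_weight (m + k) k) ((real m + 1) / 2 + real i) = 0 \<and> poly (cheb_weight (m + k) k) (- ((real m + 1) / 2 + real i)) = 0"
    by (simp only: cheb_weight_even)
qed

text \<open>Factoring each difference of squares splits the weight into two falling products, one
  counted from each end of the grid; its sums are then convolutions of binomial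
  coefficients.\<close>

lemma cheb_weight_grid:
  assumes "i < m"
  shows "poly (cheb_weight (m + k) k) (real i - (real m - 1) / 2) =
    (-1) ^ k * ((fact k) ^ 2 * (real ((i + k) choose k) * real ((m - 1 - i + k) choose k)))"
proof -
  have poch: "(\<Prod>j<k. real (n + k) - real j) = fact k * real ((n + k) choose k)" for n
  proof -
    have "real ((n + k) choose k) = (\<Prod>j<k. real (n + k) - real j) / fact k"
      by (simp add: binomial_gbinomial gbinomial_prod_rev atLeast0LessThan)
    then show ?thesis by simp
  qed
  have "poly (cheb_weight (m + k) k) (real i - (real m - 1) / 2) =
     (\<Prod>j<k. (-1) * ((real (m - 1 - i + k) - real j) * (real (i + k) - real j)))"
    unfolding cheb_weight_poly
  proof (intro prod.cong refl)
    fix j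
    have "real (m - 1 - i + k) = real m - 1 - real i + real k" using assms by (simp add: of_nat_diff)
    then show "(real i - (real m - 1) / 2) ^ 2 - ((real (m + k) + real k - 1) / 2 - real j) ^ 2 =
        (-1) * ((real (m - 1 - i + k) - real j) * (real (i + k) - real j))"
      by (simp only:) (simp add: power2_eq_square field_simps)
  qed
  also have "\<dots> = (-1) ^ k * ((\<Prod>j<k. real (m - 1 - i + k) - real j) * (\<Prod>j<k. real (i + k) - real j))"
    unfolding prod.distrib by simp
  finally show ?thesis unfolding poch by (simp add: power2_eq_square)
qed

text \<open>For k \<le> M, the pairing of \<open>cheb M k\<close> with any monic polynomial of
  degree k.\<close>

definition cheb_moment :: "nat \<Rightarrow> nat \<Rightarrow> real" where
  "cheb_moment M k = (fact k) ^ 2 * real ((M + k) choose (2 * k + 1))"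

lemma grid_sum_weight: "grid_sum m (poly (cheb_weight (m + k) k)) = (-1) ^ k * cheb_moment (m + k) k"
proof (cases m)
  case 0
  then show ?thesis by (simp add: grid_sum_def cheb_moment_def)
next
  case (Suc n)
  have "grid_sum m (poly (cheb_weight (m + k) k)) = (-1) ^ k * (fact k) ^ 2 * (\<Sum>i\<le>n. real ((i + k) choose k) * real ((n - i + k) choose k))"
    unfolding grid_sum_def sum_distrib_left
  proof (rule sum.cong)
    fix i assume "i \<in> {..n}"
    then show "poly (cheb_weight (m + k) k) (real i - (real m - 1) / 2) = (-1) ^ k * (fact k) ^ 2 * (real ((i + k) choose k) * real ((n - i + k) choose k))"
      using cheb_weight_grid[of i m k] Suc by (simp add: mult.assoc)
  qed (use Suc in auto)
  then show ?thesis unfolding sum_choose_convolution using Suc by (simp add: cheb_moment_def mult_2 add_ac)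
qed

lemma alt_grid_sum_weight:
  assumes "m = 2 * l + 1"
  shows "alt_grid_sum m (poly (cheb_weight (m + k) k)) = (-1) ^ k * ((fact k) ^ 2 * real ((l + k) choose k))"
proof -
  have "alt_grid_sum m (poly (cheb_weight (m + k) k)) = (-1) ^ k * (fact k) ^ 2 *
      (\<Sum>i\<le>2 * l. (-1) ^ i * (real ((i + k) choose k) * real ((2 * l - i + k) choose k)))"
    unfolding alt_grid_sum_def sum_distrib_left
  proof (rule sum.cong)
    fix i assume "i \<in> {..2 * l}"
    then have "i < m" "m - 1 - i = 2 * l - i" using assms by auto
    then show "(-1) ^ i * poly (cheb_weight (m + k) k) (real i - (real m - 1) / 2) =
        (-1) ^ k * (fact k) ^ 2 * ((-1) ^ i * (real ((i + k) choose k) * real ((2 * l - i + k) choose k)))"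
      using cheb_weight_grid[of i m k] by (simp only:) (simp add: mult_ac)
  qed (use assms in auto)
  then show ?thesis unfolding sum_choose_convolution_alternating by simp
qed

lemma cheb_degree: "degree (cheb M k) \<le> k" "coeff (cheb M k) k = real ((2 * k) choose k)"
proof -
  have "degree (cheb_weight M k) \<le> k + k" using cheb_weight_degree(1)[of M k] by simp
  from cdiff_funpow_degree[OF this] cheb_weight_degree(2)[of M k]
  show "degree (cheb M k) \<le> k" "coeff (cheb M k) k = real ((2 * k) choose k)"
    by (auto simp: cheb_def mult_2 binomial_fact)
qed

lemma cdiff_parity: "(\<And>s. poly p (- s) = c * poly p s) \<Longrightarrow> poly ((cdiff ^^ k) p) (- s) = (-1) ^ k * c * poly ((cdiff ^^ k) p) s"
proof (induction k arbitrary: s)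
  case (Suc k)
  have "- s + 1/2 = - (s - 1/2)" "- s - 1/2 = - (s + 1/2)" by auto
  then show ?case unfolding funpow.simps o_apply poly_cdiff using Suc.IH[OF Suc.prems]
    by (simp only:) (simp add: algebra_simps)
qed simp

lemma cheb_parity: "poly (cheb M k) (- s) = (-1) ^ k * poly (cheb M k) s"
  using cdiff_parity[of "cheb_weight M k" 1 k s] by (simp add: cheb_def cheb_weight_even)

text \<open>Summing by parts k times moves every difference onto \<open>f\<close>, where it leaves
  the constant k! times the coefficient of degree k. Orthogonality to lower degrees is the case of
  coefficient 0.\<close>

lemma psum_cheb:
  assumes "k \<le> M" "degree f \<le> k"
  shows "psum M (f * cheb M k) = coeff f k * cheb_moment M k"
proof -
  obtain m where m: "M = m + k" using assms(1) by (metis add.commute le_Suc_ex)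
  have "degree ((cdiff ^^ k) f) = 0" "coeff ((cdiff ^^ k) f) 0 = fact k * coeff f k"
    using cdiff_funpow_degree[of f 0 k] assms(2) by auto
  then have "(cdiff ^^ k) f = [:fact k * coeff f k:]" by (auto elim!: degree_eq_zeroE)
  then have "grid_sum M (\<lambda>s. poly f s * poly ((cdiff ^^ k) (cheb_weight M k)) s) = (-1) ^ k * ((fact k * coeff f k) * grid_sum m (poly (cheb_weight M k)))"
    using grid_sum_by_parts_funpow[OF cheb_weight_vanish[of m k], of f] grid_sum_scale[of m "fact k * coeff f k" "poly (cheb_weight M k)"]
    by (simp add: m)
  also have "\<dots> = fact k * coeff f k * cheb_moment M k" unfolding m grid_sum_weight by simp
  finally have "grid_sum M (\<lambda>s. (1 / fact k) * (poly f s * poly ((cdiff ^^ k) (cheb_weight M k)) s)) = coeff f k * cheb_moment M k"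
    unfolding grid_sum_scale by simp
  moreover have "(\<lambda>s. (1 / fact k) * (poly f s * poly ((cdiff ^^ k) (cheb_weight M k)) s)) = poly (f * cheb M k)"
    by (simp add: cheb_def fun_eq_iff)
  ultimately show ?thesis by (simp add: psum_def)
qed

text \<open>Each of the 2j differences in Rodrigues' formula doubles the alternating sum, which
  gives 4^j; the weight itself is summed by the alternating convolution.\<close>

lemma apsum_cheb:
  assumes "j \<le> N"
  shows "apsum (2 * N + 1) (cheb (2 * N + 1) (2 * j)) = 4 ^ j * fact (2 * j) * real ((N + j) choose (2 * j))"
proof -
  define m where "m = 2 * (N - j) + 1"
  have M: "2 * N + 1 = m + 2 * j" using assms by (simp add: m_def)
  have "alt_grid_sum (m + 2 * j) (poly ((cdiff ^^ (2 * j)) (cheb_weight (m + 2 * j) (2 * j)))) = 2 ^ (2 * j) * alt_grid_sum m (poly (cheb_weight (m + 2 * j) (2 * j)))"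
    by (rule alt_grid_sum_cdiff_funpow[OF cheb_weight_vanish])
  also have "\<dots> = 2 ^ (2 * j) * ((fact (2 * j)) ^ 2 * real ((N - j + 2 * j) choose (2 * j)))"
    by (subst alt_grid_sum_weight[of m "N - j"]) (auto simp: m_def)
  also have "N - j + 2 * j = N + j" using assms by simp
  finally have "apsum (2 * N + 1) ((cdiff ^^ (2 * j)) (cheb_weight (2 * N + 1) (2 * j))) = 2 ^ (2 * j) * ((fact (2 * j)) ^ 2 * real ((N + j) choose (2 * j)))"
    unfolding apsum_def M .
  then show ?thesis unfolding cheb_def apsum_smult by (simp add: power_mult power2_eq_square)
qed

section \<open>Norms, orthogonality and the recurrence at 0\<close>

definition cheb_norm :: "nat \<Rightarrow> nat \<Rightarrow> real" where
  "cheb_norm M k = real ((2 * k) choose k) * cheb_moment M k"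

lemma cheb_moment_pos: "k < M \<Longrightarrow> 0 < cheb_moment M k" and cheb_norm_pos: "k < M \<Longrightarrow> 0 < cheb_norm M k"
  by (auto simp: cheb_moment_def cheb_norm_def)

lemma psum_cheb_square: "k \<le> M \<Longrightarrow> psum M (cheb M k * cheb M k) = cheb_norm M k"
  using psum_cheb[OF _ cheb_degree(1)] cheb_degree(2) by (simp add: cheb_norm_def)

lemma psum_cheb_less: "j < k \<Longrightarrow> k \<le> M \<Longrightarrow> psum M (cheb M j * cheb M k) = 0"
  using psum_cheb[of k M "cheb M j"] cheb_degree(1)[of M j] by (simp add: coeff_eq_0)

lemma psum_cheb_orthogonal: "j \<noteq> k \<Longrightarrow> k \<le> M \<Longrightarrow> j \<le> M \<Longrightarrow> psum M (cheb M j * cheb M k) = 0"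
  using psum_cheb_less[of j k M] psum_cheb_less[of k j M] by (cases "j < k") (auto simp: mult.commute)

text \<open>A strict degree bound that admits m = 0, where it says f = 0. \<open>degree\<close>
  cannot express this, being 0 on the zero polynomial.\<close>

definition deglt :: "nat \<Rightarrow> real poly \<Rightarrow> bool" where
  "deglt m f \<longleftrightarrow> (\<forall>i\<ge>m. coeff f i = 0)"

lemma deglt_0: "deglt 0 f \<longleftrightarrow> f = 0" by (auto simp: deglt_def poly_eq_iff)

lemma deglt_Suc: "deglt (Suc k) f \<longleftrightarrow> degree f \<le> k"
  by (auto simp: deglt_def intro: degree_le coeff_eq_0)

lemma deglt_reduce:
  assumes "deglt (Suc k) f"
  obtains c f' where "f = smult c (cheb M k) + f'" "deglt k f'"
proof
  let ?c = "coeff f k / real ((2 * k) choose k)"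
  show "f = smult ?c (cheb M k) + (f - smult ?c (cheb M k))" by simp
  show "deglt k (f - smult ?c (cheb M k))"
    unfolding deglt_def
  proof (intro allI impI)
    fix i assume "k \<le> i"
    show "coeff (f - smult ?c (cheb M k)) i = 0"
    proof (cases "i = k")
      case False
      then have "degree f < i" "degree (cheb M k) < i" using \<open>k \<le> i\<close> assms cheb_degree(1)[of M k] by (auto simp: deglt_Suc)
      then show ?thesis by (simp add: coeff_eq_0)
    qed (simp add: cheb_degree(2))
  qed
qed

lemma psum_deglt: "deglt k f \<Longrightarrow> k \<le> M \<Longrightarrow> psum M (f * cheb M k) = 0"
proof (cases k)
  case (Suc k')
  assume "deglt k f" "k \<le> M"
  then show ?thesis using Suc psum_cheb[of k M f] by (simp add: deglt_Suc coeff_eq_0)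
qed (simp add: deglt_0)

text \<open>A sum of squares vanishes termwise, and 0 is the middle point of a grid of odd
  size.\<close>

lemma psum_square_zero:
  assumes "psum (2 * N + 1) (p * p) = 0" shows "poly p 0 = 0"
proof -
  have "(\<Sum>i<2 * N + 1. (poly p (real i - (real (2 * N + 1) - 1) / 2)) ^ 2) = 0"
    using assms by (simp add: psum_def grid_sum_def power2_eq_square)
  then have "\<forall>i\<in>{..<2 * N + 1}. (poly p (real i - (real (2 * N + 1) - 1) / 2)) ^ 2 = 0"
    by (subst (asm) sum_nonneg_eq_0_iff) simp_all
  from bspec[OF this, of N] show ?thesis by simp
qed

text \<open>The three-term recurrence at 0: \<open>X t\<^sub>k - \<alpha> t\<^sub>k\<^sub>+\<^sub>1 - \<gamma> t\<^sub>k\<^sub>-\<^sub>1\<close> has degree at most \<open>k\<close> and is orthogonal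
  to all polynomials of degree at most \<open>k\<close>, so it vanishes on the grid.\<close>

lemma cheb_recurrence:
  assumes "k + 2 \<le> 2 * N + 1"
  defines "M \<equiv> 2 * N + 1" and "\<tau> \<equiv> \<lambda>k. real ((2 * k) choose k)"
  shows "poly (cheb M (k + 2)) 0 = - (cheb_moment M (k + 1) / cheb_moment M k) * (\<tau> (k + 2) / \<tau> (k + 1)) * poly (cheb M k) 0"
proof -
  define \<alpha> where "\<alpha> = \<tau> (k + 1) / \<tau> (k + 2)"
  define \<gamma> where "\<gamma> = cheb_moment M (k + 1) / cheb_moment M k"
  define X where "X = [:0, 1 :: real:]"
  define e where "e = X * cheb M (k + 1) - smult \<alpha> (cheb M (k + 2)) - smult \<gamma> (cheb M k)"
  have g: "cheb_moment M k > 0" using assms(1) by (intro cheb_moment_pos) (simp add: M_def)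
  have \<tau>: "\<tau> k > 0" for k by (simp add: \<tau>_def)
  have kM: "k + 2 \<le> M" using assms(1) by (simp add: M_def)
  have Xc: "coeff (X * p) (Suc i) = coeff p i" for p i by (simp add: X_def)
  have orth1: "psum M (f * e) = 0" if f: "deglt (k + 1) f" for f
  proof -
    have "degree f \<le> k" using f by (simp add: deglt_Suc)
    have d: "degree (f * X) \<le> k + 1" using \<open>degree f \<le> k\<close> degree_mult_le[of f X] by (simp add: X_def)
    have 1: "psum M (f * X * cheb M (k + 1)) = coeff f k * cheb_moment M (k + 1)"
      using psum_cheb[OF _ d, of M] kM Xc[of f k] by (simp add: mult.commute)
    have 2: "psum M (f * cheb M (k + 2)) = 0"
      by (rule psum_deglt) (use f kM in \<open>auto simp: deglt_def\<close>)
    have 3: "psum M (f * cheb M k) = coeff f k * cheb_moment M k"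
      by (rule psum_cheb) (use \<open>degree f \<le> k\<close> kM in auto)
    have "f * e = f * X * cheb M (k + 1) - smult \<alpha> (f * cheb M (k + 2)) - smult \<gamma> (f * cheb M k)"
      by (simp add: e_def algebra_simps)
    then have "psum M (f * e) = coeff f k * cheb_moment M (k + 1) - \<alpha> * 0 - \<gamma> * (coeff f k * cheb_moment M k)"
      by (simp only: psum_diff psum_smult 1 2 3)
    then show ?thesis using g by (simp add: \<gamma>_def)
  qed
  have orth2: "psum M (cheb M (k + 1) * e) = 0"
  proof -
    have "grid_sum M (\<lambda>s. poly (cheb M (k + 1) * X * cheb M (k + 1)) (- s)) = grid_sum M (poly (cheb M (k + 1) * X * cheb M (k + 1)))"
      by (rule grid_sum_reflect)
    moreover have "poly (cheb M (k + 1) * X * cheb M (k + 1)) (- s) = (-1) * poly (cheb M (k + 1) * X * cheb M (k + 1)) s" for s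
    proof -
      have "(-1 :: real) ^ (k + 1) * (-1) ^ (k + 1) = 1" by (simp add: power_mult_distrib[symmetric])
      then have "((-1) ^ (k + 1) * a) * (- x) * ((-1) ^ (k + 1) * a) = (-1) * (a * x * a)" for a x :: real
        by (metis (no_types, opaque_lifting) mult.commute mult.left_commute mult_1 mult_minus1 mult_minus_right)
      then show ?thesis by (simp only: poly_mult cheb_parity X_def) (simp add: mult_ac)
    qed
    ultimately have 1: "psum M (cheb M (k + 1) * X * cheb M (k + 1)) = 0"
      unfolding psum_def by (simp only: grid_sum_scale)
    have "cheb M (k + 1) * e = cheb M (k + 1) * X * cheb M (k + 1) - smult \<alpha> (cheb M (k + 1) * cheb M (k + 2)) - smult \<gamma> (cheb M (k + 1) * cheb M k)"
      by (simp add: e_def algebra_simps)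
    moreover have "psum M (cheb M (k + 1) * cheb M (k + 2)) = 0" "psum M (cheb M (k + 1) * cheb M k) = 0"
      using kM by (auto intro!: psum_cheb_orthogonal)
    ultimately show ?thesis by (simp only: psum_diff psum_smult 1)
  qed
  have "deglt (Suc (k + 1)) e"
    unfolding deglt_def
  proof (intro allI impI)
    fix i assume i: "Suc (k + 1) \<le> i"
    show "coeff e i = 0"
    proof (cases "i = k + 2")
      case True
      have "coeff (cheb M k) (k + 2) = 0" using cheb_degree(1)[of M k] by (intro coeff_eq_0) simp
      then show ?thesis using True Xc[of "cheb M (k + 1)" "k + 1"] cheb_degree(2)[of M "k + 1"] cheb_degree(2)[of M "k + 2"] \<tau>[of "k + 2"]
        by (simp add: e_def \<alpha>_def \<tau>_def)
    next
      case False
      then obtain i' where "i = Suc i'" "k + 1 < i'" using i by (cases i) auto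
      then have "coeff (X * cheb M (k + 1)) i = 0" "coeff (cheb M (k + 2)) i = 0" "coeff (cheb M k) i = 0"
        using cheb_degree(1)[of M k] cheb_degree(1)[of M "k + 1"] cheb_degree(1)[of M "k + 2"] by (auto simp: Xc intro!: coeff_eq_0)
      then show ?thesis by (simp add: e_def)
    qed
  qed
  then obtain c f' where e: "e = smult c (cheb M (k + 1)) + f'" "deglt (k + 1) f'" by (rule deglt_reduce)
  have "psum M (e * e) = c * psum M (cheb M (k + 1) * e) + psum M (f' * e)"
    by (subst (1) e(1)) (simp add: distrib_right psum_add psum_smult)
  then have "psum M (e * e) = 0" using orth1[OF e(2)] orth2 by simp
  then have "poly e 0 = 0" unfolding M_def by (rule psum_square_zero)
  then have "\<alpha> * poly (cheb M (k + 2)) 0 = - \<gamma> * poly (cheb M k) 0" by (simp add: e_def X_def)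
  then show ?thesis using \<tau>[of "k + 1"] \<tau>[of "k + 2"] unfolding \<gamma>_def[symmetric]
    by (simp add: \<alpha>_def field_simps)
qed

text \<open>For linear \<open>\<phi>\<close>, the polynomial of degree below m that represents
  \<open>\<phi>\<close> with respect to the grid sum; evaluation at 0 gives the section at 0 of the
  usual reproducing kernel.\<close>

definition kernel :: "nat \<Rightarrow> (real poly \<Rightarrow> real) \<Rightarrow> nat \<Rightarrow> real poly" where
  "kernel M \<phi> m = (\<Sum>k<m. smult (\<phi> (cheb M k) / cheb_norm M k) (cheb M k))"

lemma psum_kernel:
  assumes "\<And>p q. \<phi> (p + q) = \<phi> p + \<phi> q" "\<And>c p. \<phi> (smult c p) = c * \<phi> p"
  shows "deglt m f \<Longrightarrow> m \<le> M \<Longrightarrow> psum M (f * kernel M \<phi> m) = \<phi> f"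
proof (induction m arbitrary: f)
  case 0
  have "\<phi> 0 = 0" using assms(2)[of 0 0] by simp
  then show ?case using 0 by (simp add: deglt_0)
next
  case (Suc m)
  obtain c f' where f: "f = smult c (cheb M m) + f'" "deglt m f'" using deglt_reduce[OF Suc.prems(1)] .
  have h: "cheb_norm M m > 0" using Suc.prems by (intro cheb_norm_pos) simp
  have K: "kernel M \<phi> (Suc m) = kernel M \<phi> m + smult (\<phi> (cheb M m) / cheb_norm M m) (cheb M m)" by (simp add: kernel_def)
  have 1: "psum M (cheb M m * kernel M \<phi> m) = 0"
    unfolding kernel_def sum_distrib_left psum_sum
    using Suc.prems by (intro sum.neutral ballI) (simp add: psum_smult psum_cheb_orthogonal)
  have 2: "psum M (f' * cheb M m) = 0" using f(2) Suc.prems by (intro psum_deglt) auto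
  have 3: "psum M (f' * kernel M \<phi> m) = \<phi> f'" using Suc.IH[OF f(2)] Suc.prems by simp
  have 4: "psum M (cheb M m * cheb M m) = cheb_norm M m" using Suc.prems by (intro psum_cheb_square) simp
  have "psum M (f * kernel M \<phi> (Suc m)) = c * \<phi> (cheb M m) + \<phi> f'"
    unfolding f(1) K using h by (simp add: distrib_left distrib_right psum_add psum_smult 1 2 3 4)
  then show ?case unfolding f(1) assms .
qed

text \<open>Polynomials of degree below 2N + 1 interpolate arbitrary values on the 2N + 1 points.
  Pairing the kernel with the polynomial that vanishes at every grid point but 0 isolates its value
  there.\<close>

lemma kernel_full:
  assumes "\<And>p q. \<phi> (p + q) = \<phi> p + \<phi> q" "\<And>c p. \<phi> (smult c p) = c * \<phi> p"
    "\<And>p. (\<And>i. i < 2 * N + 1 \<Longrightarrow> i \<noteq> N \<Longrightarrow> poly p (real i - real N) = 0) \<Longrightarrow> \<phi> p = c * poly p 0"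
  shows "poly (kernel (2 * N + 1) \<phi> (2 * N + 1)) 0 = c"
proof -
  let ?M = "2 * N + 1"
  define I where "I = {..<2 * N + 1} - {N}"
  define f where "f = (\<Prod>i\<in>I. [:- (real i - real N), 1:])"
  have "degree f = 2 * N" unfolding f_def by (subst degree_prod_eq_sum_degree) (auto simp: I_def)
  then have d: "deglt (2 * N + 1) f" using deglt_Suc[of "2 * N" f] by simp
  have z: "poly f (real i - real N) = 0" if "i < 2 * N + 1" "i \<noteq> N" for i
    unfolding f_def poly_prod using that by (intro prod_zero) (auto simp: I_def)
  have nz: "poly f 0 \<noteq> 0" unfolding f_def poly_prod by (auto simp: I_def)
  have "c * poly f 0 = psum ?M (f * kernel ?M \<phi> ?M)"
    using psum_kernel[OF assms(1,2) d, of ?M] assms(3)[OF z] by simp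
  also have "\<dots> = (\<Sum>i<2 * N + 1. if i = N then poly f 0 * poly (kernel ?M \<phi> ?M) 0 else 0)"
    unfolding psum_def grid_sum_def by (intro sum.cong refl) (auto simp: z)
  also have "\<dots> = poly f 0 * poly (kernel ?M \<phi> ?M) 0" by simp
  finally show ?thesis using nz by simp
qed

text \<open>The value of \<open>cheb (2 * N + 1) (2 * k)\<close> at 0 will be (-1)^k times
  \<open>central_ratio k\<close>, which is (2k - 1)!!/(2k)!!, times its alternating sum
  \<open>alt_moment N k\<close>; its squared norm is \<open>norm_fact N k\<close> over 4k +
  1.\<close>

definition central_ratio :: "nat \<Rightarrow> real" where "central_ratio k = real ((2 * k) choose k) / 4 ^ k"
definition alt_moment :: "nat \<Rightarrow> nat \<Rightarrow> real" where "alt_moment N k = 4 ^ k * fact (N + k) / fact (N - k)"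
definition norm_fact :: "nat \<Rightarrow> nat \<Rightarrow> real" where "norm_fact N k = fact (2 * N + 1 + 2 * k) / fact (2 * N - 2 * k)"

section \<open>Closed forms for norms, alternating sums and values at 0\<close>

lemma central_choose_Suc: "real (Suc k) * real ((2 * Suc k) choose Suc k) = 2 * (2 * real k + 1) * real ((2 * k) choose k)"
proof -
  have "real ((2 * k) choose k) = fact (2 * k) / (fact k * fact k)" by (simp add: binomial_fact)
  moreover have "real ((2 * Suc k) choose Suc k) = fact (2 * Suc k) / (fact (Suc k) * fact (Suc k))"
  proof -
    have a: "2 * Suc k - Suc k = Suc k" and b: "Suc k \<le> 2 * Suc k" by simp_all
    show ?thesis using binomial_fact[OF b, where 'a = real] unfolding a .
  qed
  moreover have "fact (2 * Suc k) = 2 * real (Suc k) * (2 * real k + 1) * fact (2 * k)" by (simp add: algebra_simps)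
  moreover have "fact (Suc k) = real (Suc k) * fact k" by simp
  moreover have "real (Suc k) \<noteq> 0" "(fact k :: real) \<noteq> 0" by simp_all
  ultimately show ?thesis by (simp only:) (simp add: divide_simps del: of_nat_Suc fact_Suc)
qed

lemma central_ratio_Suc: "central_ratio (Suc k) = central_ratio k * (2 * real k + 1) / (2 * real k + 2)"
proof -
  have "real ((2 * Suc k) choose Suc k) = 2 * (2 * real k + 1) * real ((2 * k) choose k) / real (Suc k)"
    unfolding central_choose_Suc[symmetric] by simp
  then have "central_ratio (Suc k) = 2 * (2 * real k + 1) * real ((2 * k) choose k) / real (Suc k) / 4 ^ Suc k"
    unfolding central_ratio_def by simp
  then show ?thesis by (simp add: central_ratio_def divide_simps) (simp add: algebra_simps)
qed

lemma central_ratio_pos: "0 < central_ratio k" by (simp add: central_ratio_def)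

lemma central_ratio_0 [simp]: "central_ratio 0 = 1" by (simp add: central_ratio_def)

lemma fact_diff_Suc: "k < N \<Longrightarrow> (fact (N - k) :: real) = (real N - real k) * fact (N - Suc k)"
  by (metis Suc_diff_Suc fact_Suc of_nat_diff less_imp_le)

lemma alt_moment_Suc: "k < N \<Longrightarrow> alt_moment N (Suc k) = 4 * (real N + real k + 1) * (real N - real k) * alt_moment N k"
  by (simp add: alt_moment_def fact_diff_Suc field_simps)

lemma alt_moment_pos: "0 < alt_moment N k" by (simp add: alt_moment_def)
lemma norm_fact_pos: "0 < norm_fact N k" by (simp add: norm_fact_def)

lemma norm_fact_Suc:
  assumes "k < N"
  shows "norm_fact N (Suc k) = 4 * (real N + real k + 1) * (real N - real k) *
    ((2 * real N + 1) ^ 2 - (2 * real k + 2) ^ 2) * norm_fact N k"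
proof -
  have "fact (2 * N - 2 * k) = (2 * real N - 2 * real k) * ((2 * real N - 2 * real k - 1) * fact (2 * N - 2 * Suc k))"
  proof -
    have a: "fact (2 * N - 2 * k) = (real (2 * N) - real (2 * k)) * fact (2 * N - Suc (2 * k))"
      by (rule fact_diff_Suc) (use assms in simp)
    have b: "fact (2 * N - Suc (2 * k)) = (real (2 * N) - real (Suc (2 * k))) * fact (2 * N - Suc (Suc (2 * k)))"
      by (rule fact_diff_Suc) (use assms in simp)
    have c: "2 * Suc k = Suc (Suc (2 * k))" by simp
    show ?thesis unfolding a b c by simp
  qed
  moreover have "fact (2 * N + 1 + 2 * Suc k) = (2 * real N + 2 * real k + 3) * ((2 * real N + 2 * real k + 2) * fact (2 * N + 1 + 2 * k))"
    by (simp add: algebra_simps)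
  moreover have "real k < real N" "real k + 1 \<le> real N" using assms by auto
  ultimately show ?thesis unfolding norm_fact_def by (simp add: divide_simps del: fact_Suc) (simp add: algebra_simps power2_eq_square)
qed

lemma apsum_cheb_even: "k \<le> N \<Longrightarrow> apsum (2 * N + 1) (cheb (2 * N + 1) (2 * k)) = alt_moment N k"
proof -
  assume "k \<le> N"
  then have "real ((N + k) choose (2 * k)) = fact (N + k) / (fact (2 * k) * fact (N - k))"
    by (simp add: binomial_fact)
  then show ?thesis using apsum_cheb[OF \<open>k \<le> N\<close>] by (simp add: alt_moment_def)
qed

lemma cheb_moment_fact: "k < M \<Longrightarrow> cheb_moment M k = (fact k) ^ 2 * (fact (M + k) / (fact (2 * k + 1) * fact (M - k - 1)))"
  unfolding cheb_moment_def by (subst binomial_fact) auto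

lemma cheb_norm_even:
  assumes "k \<le> N" shows "cheb_norm (2 * N + 1) (2 * k) = norm_fact N k / (4 * real k + 1)"
proof -
  have 1: "real ((2 * (2 * k)) choose (2 * k)) = fact (2 * (2 * k)) / (fact (2 * k) * fact (2 * k))"
    by (simp add: binomial_fact)
  have 2: "2 * N + 1 - 2 * k - 1 = 2 * N - 2 * k" by simp
  have 3: "fact (2 * (2 * k) + 1) = (4 * real k + 1) * fact (2 * (2 * k))" by (simp add: algebra_simps)
  have 4: "2 * k < 2 * N + 1" using assms by simp
  have alg: "A / (B * B) * (B ^ 2 * (C / (x * A * D))) = C / D / x" if "A \<noteq> 0" "B \<noteq> 0" for A B C D x :: real
    using that by (simp add: power2_eq_square)
  show ?thesis unfolding cheb_norm_def cheb_moment_fact[OF 4] 1 2 3 norm_fact_def by (rule alg) simp_all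
qed

lemma cheb_moment_ratio:
  assumes "Suc k < M"
  shows "cheb_moment M (k + 1) / cheb_moment M k = (real k + 1) * (real M + real k + 1) * (real M - real k - 1) / (2 * (2 * real k + 3))"
proof -
  have 1: "fact (M - k - 1) = (real M - real k - 1) * fact (M - (k + 1) - 1)"
    using fact_diff_Suc[of "Suc k" M] assms by simp
  have 2: "fact (2 * (k + 1) + 1) = (2 * real k + 3) * (2 * (real k + 1)) * fact (2 * k + 1)" by (simp add: algebra_simps)
  have 3: "fact (M + (k + 1)) = (real M + real k + 1) * fact (M + k)" by (simp add: algebra_simps)
  have 4: "fact (k + 1) = (real k + 1) * fact k" by (simp add: algebra_simps)
  have pos: "real M - real k - 1 > 0" "fact (M - (k + 1) - 1) > (0::real)" "fact (2 * k + 1) > (0::real)" "fact (M + k) > (0::real)" "fact k > (0::real)"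
    using assms by auto
  have "cheb_moment M (k + 1) = ((real k + 1) * fact k) ^ 2 * ((real M + real k + 1) * fact (M + k) / ((2 * real k + 3) * (2 * (real k + 1)) * fact (2 * k + 1) * fact (M - (k + 1) - 1)))"
    using cheb_moment_fact[of "k + 1" M] assms unfolding 2 3 4 by simp
  moreover have "cheb_moment M k = (fact k) ^ 2 * (fact (M + k) / (fact (2 * k + 1) * ((real M - real k - 1) * fact (M - (k + 1) - 1))))"
    using cheb_moment_fact[of k M] assms unfolding 1 by simp
  moreover have "((x * f) ^ 2 * (y * P / (z * (2 * x) * q * r))) / (f ^ 2 * (P / (q * (w * r)))) = x * y * w / (2 * z)"
    if "x > 0" "f > 0" "P > 0" "z > 0" "q > 0" "r > 0" "w > 0" for x f y P z q r w :: real
    using that by (simp add: power2_eq_square field_simps)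
  ultimately show ?thesis using pos by (simp only:)
qed

text \<open>The recurrence at 0 links degrees that differ by two. Each step contributes a sign, (2k
  + 1)/(2k + 2) and 4(N + k + 1)(N - k).\<close>

lemma cheb_at_0: "k \<le> N \<Longrightarrow> poly (cheb (2 * N + 1) (2 * k)) 0 = (-1) ^ k * central_ratio k * alt_moment N k"
proof (induction k)
  case 0
  then show ?case by (simp add: cheb_def cheb_weight_def alt_moment_def)
next
  case (Suc k)
  let ?M = "2 * N + 1"
  define c where "c = real ((2 * (2 * k + 1)) choose (2 * k + 1))"
  have c: "c > 0" unfolding c_def of_nat_0_less_iff by (rule zero_less_binomial) simp
  have "(2 * real k + 2) * real ((2 * (2 * k + 2)) choose (2 * k + 2)) = 2 * (4 * real k + 3) * c"
    using central_choose_Suc[of "2 * k + 1"] by (simp add: c_def algebra_simps del: binomial_Suc_Suc)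
  then have r: "real ((2 * (2 * k + 2)) choose (2 * k + 2)) / c = 2 * (4 * real k + 3) / (2 * real k + 2)"
    using c by (simp add: field_simps)
  have "poly (cheb ?M (2 * k + 2)) 0 = - (cheb_moment ?M (2 * k + 1) / cheb_moment ?M (2 * k)) *
     (real ((2 * (2 * k + 2)) choose (2 * k + 2)) / c) * poly (cheb ?M (2 * k)) 0"
    unfolding c_def by (rule cheb_recurrence) (use Suc.prems in simp)
  also have "\<dots> = - ((2 * real k + 1) * (2 * real N + 2 * real k + 2) * (2 * real N - 2 * real k) / (2 * (4 * real k + 3))) *
     (2 * (4 * real k + 3) / (2 * real k + 2)) * ((-1) ^ k * central_ratio k * alt_moment N k)"
    unfolding r using cheb_moment_ratio[of "2 * k" ?M] Suc by (simp add: algebra_simps)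
  also have "\<dots> = (-1) ^ Suc k * central_ratio (Suc k) * alt_moment N (Suc k)"
    using alt_moment_Suc[of k N] Suc.prems by (simp add: central_ratio_Suc divide_simps) (simp add: algebra_simps)
  finally show ?case by simp
qed

text \<open>Up to the factor M it is the squared alternating sum over \<open>norm_fact\<close>, for
  M = 2N + 1. As a rational function of M it shows what the interpolation needs: zeros at odd
  integers cut the sums off on small grids, poles at even integers give the common
  denominator.\<close>

definition rho :: "real \<Rightarrow> nat \<Rightarrow> real" where
  "rho M k = (\<Prod>j<k. (M ^ 2 - (2 * real j + 1) ^ 2) / (M ^ 2 - (2 * real j + 2) ^ 2))"

lemma rho_eq: "k \<le> N \<Longrightarrow> alt_moment N k ^ 2 / norm_fact N k = rho (2 * real N + 1) k / (2 * real N + 1)"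
proof (induction k)
  case 0
  then show ?case by (simp add: alt_moment_def norm_fact_def rho_def)
next
  case (Suc k)
  define D where "D = (2 * real N + 1) ^ 2 - (2 * real k + 2) ^ 2"
  define E where "E = 4 * (real N + real k + 1) * (real N - real k)"
  have E: "E = (2 * real N + 1) ^ 2 - (2 * real k + 1) ^ 2" by (simp add: E_def power2_eq_square algebra_simps)
  have k: "real k + 1 \<le> real N" using Suc.prems by simp
  have "E > 0" using k by (simp add: E_def)
  have "D > 0" using k by (auto simp: D_def intro!: power_strict_mono)
  have "alt_moment N (Suc k) ^ 2 / norm_fact N (Suc k) = (E * alt_moment N k) ^ 2 / (E * D * norm_fact N k)"
    using alt_moment_Suc[of k N] norm_fact_Suc[of k N] Suc.prems by (simp add: E_def D_def)
  also have "\<dots> = E / D * (alt_moment N k ^ 2 / norm_fact N k)"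
    using \<open>E > 0\<close> \<open>D > 0\<close> norm_fact_pos[of N k] by (simp add: field_simps power2_eq_square)
  also have "\<dots> = rho (2 * real N + 1) (Suc k) / (2 * real N + 1)"
    using Suc unfolding E D_def by (simp add: rho_def)
  finally show ?case .
qed

section \<open>Kernel sums over full and partial ranges of degrees\<close>

lemma sum_even_indices:
  fixes f :: "nat \<Rightarrow> real"
  assumes "\<And>k. odd k \<Longrightarrow> f k = 0"
  shows "(\<Sum>k<2 * n. f k) = (\<Sum>k<n. f (2 * k))" "(\<Sum>k<2 * n + 1. f k) = (\<Sum>k<Suc n. f (2 * k))"
proof -
  show 1: "(\<Sum>k<2 * n. f k) = (\<Sum>k<n. f (2 * k))" for n
    by (induction n) (auto simp: assms)
  show "(\<Sum>k<2 * n + 1. f k) = (\<Sum>k<Suc n. f (2 * k))"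
    using 1[of n] by simp
qed

lemma cheb_odd_at_0: "odd k \<Longrightarrow> poly (cheb M k) 0 = 0"
  using cheb_parity[of M k 0] by simp

lemma poly_kernel_0:
  "poly (kernel M \<phi> m) 0 = (\<Sum>k<m. \<phi> (cheb M k) / cheb_norm M k * poly (cheb M k) 0)"
  by (simp add: kernel_def poly_sum)

lemma tp_0_square_term:
  assumes "k \<le> N"
  shows "poly (cheb (2 * N + 1) (2 * k)) 0 / cheb_norm (2 * N + 1) (2 * k) * poly (cheb (2 * N + 1) (2 * k)) 0 =
    (4 * real k + 1) * central_ratio k ^ 2 * rho (2 * real N + 1) k / (2 * real N + 1)"
proof -
  have "(-1 :: real) ^ k * (-1) ^ k = 1" by (simp add: power_mult_distrib[symmetric])
  then have "poly (cheb (2 * N + 1) (2 * k)) 0 / cheb_norm (2 * N + 1) (2 * k) * poly (cheb (2 * N + 1) (2 * k)) 0 =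
      (4 * real k + 1) * central_ratio k ^ 2 * (alt_moment N k ^ 2 / norm_fact N k)"
    unfolding cheb_at_0[OF assms] cheb_norm_even[OF assms] by (simp add: power2_eq_square)
  then show ?thesis unfolding rho_eq[OF assms] by simp
qed

text \<open>With all degrees up to 2N present, the kernel of evaluation at 0 takes the value 1 at 0.
  Only even degrees contribute there.\<close>

lemma sum_full_1: "(\<Sum>k<Suc N. (4 * real k + 1) * central_ratio k ^ 2 * rho (2 * real N + 1) k) = 2 * real N + 1"
proof -
  let ?M = "2 * N + 1"
  have "1 = poly (kernel ?M (\<lambda>p. poly p 0) ?M) 0"
    by (rule kernel_full[symmetric]) auto
  also have "\<dots> = (\<Sum>k<Suc N. poly (cheb ?M (2 * k)) 0 / cheb_norm ?M (2 * k) * poly (cheb ?M (2 * k)) 0)"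
    unfolding poly_kernel_0 by (rule sum_even_indices(2)) (simp add: cheb_odd_at_0)
  also have "\<dots> = (\<Sum>k<Suc N. (4 * real k + 1) * central_ratio k ^ 2 * rho (2 * real N + 1) k / (2 * real N + 1))"
    by (intro sum.cong refl tp_0_square_term) simp
  finally show ?thesis unfolding sum_divide_distrib[symmetric] by (simp add: field_simps)
qed

lemma apsum_cheb_term:
  assumes "k \<le> N"
  shows "apsum (2 * N + 1) (cheb (2 * N + 1) (2 * k)) / cheb_norm (2 * N + 1) (2 * k) * poly (cheb (2 * N + 1) (2 * k)) 0 =
    (-1) ^ k * (4 * real k + 1) * central_ratio k * rho (2 * real N + 1) k / (2 * real N + 1)"
proof -
  have "apsum (2 * N + 1) (cheb (2 * N + 1) (2 * k)) / cheb_norm (2 * N + 1) (2 * k) * poly (cheb (2 * N + 1) (2 * k)) 0 =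
      (-1) ^ k * (4 * real k + 1) * central_ratio k * (alt_moment N k ^ 2 / norm_fact N k)"
    unfolding cheb_at_0[OF assms] cheb_norm_even[OF assms] apsum_cheb_even[OF assms] by (simp add: power2_eq_square)
  then show ?thesis unfolding rho_eq[OF assms] by simp
qed

text \<open>The same for the alternating sum, where the value at 0 is the sign (-1)^N of the central
  grid point.\<close>

lemma sum_full_2: "(\<Sum>k<Suc N. (-1) ^ k * (4 * real k + 1) * central_ratio k * rho (2 * real N + 1) k) = (-1) ^ N * (2 * real N + 1)"
proof -
  let ?M = "2 * N + 1"
  have "(-1) ^ N = poly (kernel ?M (apsum ?M) ?M) 0"
  proof (rule kernel_full[symmetric])
    fix p assume z: "\<And>i. i < 2 * N + 1 \<Longrightarrow> i \<noteq> N \<Longrightarrow> poly p (real i - real N) = 0"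
    have "apsum ?M p = (\<Sum>i<2 * N + 1. if i = N then (-1) ^ N * poly p 0 else 0)"
      unfolding apsum_def alt_grid_sum_def by (intro sum.cong refl) (auto simp: z)
    then show "apsum ?M p = (-1) ^ N * poly p 0" by simp
  qed (simp_all add: apsum_add apsum_smult)
  also have "\<dots> = (\<Sum>k<Suc N. apsum ?M (cheb ?M (2 * k)) / cheb_norm ?M (2 * k) * poly (cheb ?M (2 * k)) 0)"
    unfolding poly_kernel_0 by (rule sum_even_indices(2)) (simp add: cheb_odd_at_0)
  also have "\<dots> = (\<Sum>k<Suc N. (-1) ^ k * (4 * real k + 1) * central_ratio k * rho (2 * real N + 1) k / (2 * real N + 1))"
    by (intro sum.cong refl apsum_cheb_term) simp
  finally show ?thesis unfolding sum_divide_distrib[symmetric] by (simp add: field_simps)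
qed

lemma alternating_increasing:
  fixes b :: "nat \<Rightarrow> real"
  assumes "\<And>k. k \<le> m \<Longrightarrow> 0 < b k" "\<And>k. k < m \<Longrightarrow> b k < b (Suc k)"
  shows "0 < (-1) ^ m * (\<Sum>k<Suc m. (-1) ^ k * b k) \<and> (-1) ^ m * (\<Sum>k<Suc m. (-1) ^ k * b k) \<le> b m"
  using assms
proof (induction m)
  case (Suc m)
  have "(-1) ^ Suc m * (\<Sum>k<Suc (Suc m). (-1) ^ k * b k) = b (Suc m) - (-1) ^ m * (\<Sum>k<Suc m. (-1) ^ k * b k)"
    by (simp add: algebra_simps power_mult_distrib[symmetric])
  moreover have "b m < b (Suc m)" using Suc.prems(2)[of m] by simp
  moreover have "0 < (-1) ^ m * (\<Sum>k<Suc m. (-1) ^ k * b k) \<and> (-1) ^ m * (\<Sum>k<Suc m. (-1) ^ k * b k) \<le> b m"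
    using Suc.prems by (intro Suc.IH) auto
  ultimately show ?case by linarith
qed auto

lemma Ap_ker:
  assumes "n \<le> N"
  shows "apsum (2 * N + 1) (kernel (2 * N + 1) (\<lambda>p. poly p 0) (2 * n)) =
    (\<Sum>k<n. (-1) ^ k * ((4 * real k + 1) * central_ratio k * rho (2 * real N + 1) k / (2 * real N + 1)))"
proof -
  let ?M = "2 * N + 1"
  have "apsum ?M (kernel ?M (\<lambda>p. poly p 0) (2 * n)) = (\<Sum>k<2 * n. poly (cheb ?M k) 0 / cheb_norm ?M k * apsum ?M (cheb ?M k))"
    by (simp add: kernel_def apsum_sum apsum_smult)
  also have "\<dots> = (\<Sum>k<n. poly (cheb ?M (2 * k)) 0 / cheb_norm ?M (2 * k) * apsum ?M (cheb ?M (2 * k)))"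
    by (rule sum_even_indices(1)) (simp add: cheb_odd_at_0)
  also have "\<dots> = (\<Sum>k<n. (-1) ^ k * ((4 * real k + 1) * central_ratio k * rho (2 * real N + 1) k / (2 * real N + 1)))"
  proof (intro sum.cong refl)
    fix k assume "k \<in> {..<n}"
    then have "k \<le> N" using assms by auto
    from apsum_cheb_term[OF this]
    show "poly (cheb ?M (2 * k)) 0 / cheb_norm ?M (2 * k) * apsum ?M (cheb ?M (2 * k)) =
        (-1) ^ k * ((4 * real k + 1) * central_ratio k * rho (2 * real N + 1) k / (2 * real N + 1))"
      by (simp add: mult_ac)
  qed
  finally show ?thesis .
qed

text \<open>This number decides the top coefficient of the polynomial constructed below. It is an
  alternating sum with positive, strictly increasing absolute terms, so it has the sign of its last
  term.\<close>

lemma apsum_kernel_nonzero: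
  assumes "1 \<le> n" "n \<le> N"
  shows "apsum (2 * N + 1) (kernel (2 * N + 1) (\<lambda>p. poly p 0) (2 * n)) \<noteq> 0"
proof -
  obtain m where n: "n = Suc m" using assms(1) by (cases n) auto
  define b where "b k = (4 * real k + 1) * central_ratio k * rho (2 * real N + 1) k / (2 * real N + 1)" for k
  have eq: "apsum (2 * N + 1) (kernel (2 * N + 1) (\<lambda>p. poly p 0) (2 * n)) = (\<Sum>k<Suc m. (-1) ^ k * b k)"
    unfolding Ap_ker[OF assms(2)] b_def by (simp only: n)
  have bpos: "0 < b k" if "k \<le> m" for k
  proof -
    have "k \<le> N" using that assms n by simp
    then have "b k = (4 * real k + 1) * central_ratio k * (alt_moment N k ^ 2 / norm_fact N k)" by (simp add: b_def rho_eq)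
    then show ?thesis using central_ratio_pos[of k] alt_moment_pos[of N k] norm_fact_pos[of N k] by simp
  qed
  have binc: "b k < b (Suc k)" if "k < m" for k
  proof -
    define x where "x = (2 * real N + 1) ^ 2 - (2 * real k + 1) ^ 2"
    define y where "y = (2 * real N + 1) ^ 2 - (2 * real k + 2) ^ 2"
    have "real k + 2 \<le> real N" using that assms n by simp
    then have y: "0 < y" by (auto simp: y_def intro!: power_strict_mono)
    have xy: "y < x" by (simp add: x_def y_def power2_eq_square algebra_simps)
    have "b (Suc k) * ((4 * real k + 1) * (2 * real k + 2) * y) = b k * ((4 * real k + 5) * (2 * real k + 1) * x)"
      using y by (simp add: b_def central_ratio_Suc rho_def x_def[symmetric] y_def[symmetric] divide_simps)
    \<comment> \<open>The ratio of consecutive terms is (4k + 5)(2k + 1) x over (4k + 1)(2k + 2) y;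
      here x > y, and the other two products differ by 4k + 3.\<close>
    moreover have "(4 * real k + 1) * (2 * real k + 2) * y < (4 * real k + 5) * (2 * real k + 1) * x"
    proof (rule mult_strict_mono[OF _ xy])
      have "(4 * real k + 5) * (2 * real k + 1) = (4 * real k + 1) * (2 * real k + 2) + (4 * real k + 3)"
        by (simp add: algebra_simps)
      then show "(4 * real k + 1) * (2 * real k + 2) < (4 * real k + 5) * (2 * real k + 1)" by linarith
    qed (use y in auto)
    moreover have "0 < (4 * real k + 1) * (2 * real k + 2) * y" using y by simp
    moreover have "0 < b k" using bpos that by simp
    ultimately show ?thesis
      by (metis mult_less_cancel_left_pos mult_less_cancel_right_pos)
  qed
  show ?thesis using alternating_increasing[of m b, OF bpos binc] unfolding eq by auto
qed

text \<open>The evaluation at 0, divided by the sum, of this polynomial is the proportion of point sets that contain 0.\<close>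

lemma obtain_evaluation_poly:
  assumes n: "1 \<le> n" "n \<le> N"
  obtains H where "degree H \<le> 2 * n" "coeff H (2 * n) \<noteq> 0" "\<And>s. poly H (- s) = poly H s"
    "apsum (2 * N + 1) H = 0" "\<And>f. degree f < 2 * n \<Longrightarrow> psum (2 * N + 1) (f * H) = poly f 0"
    "poly H 0 = (\<Sum>k<n. (4 * real k + 1) * (central_ratio k ^ 2 - (-1) ^ (n + k) * central_ratio n * central_ratio k) * rho (2 * real N + 1) k) / (2 * real N + 1)"
proof -
  let ?M = "2 * N + 1"
  define K where "K = kernel ?M (\<lambda>p. poly p 0) (2 * n)"
  \<comment> \<open>The correction cancels the alternating sum of the kernel. A multiple of the
    polynomial of degree 2n is used because it is orthogonal to all lower degrees and leaves the
    reproducing property intact.\<close>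
  define c where "c = - apsum ?M K / alt_moment N n"
  define H where "H = K + smult c (cheb ?M (2 * n))"
  have c: "c \<noteq> 0" using apsum_kernel_nonzero[OF n] alt_moment_pos[of N n] by (simp add: c_def K_def)
  have Kd: "deglt (2 * n) K"
    unfolding deglt_def K_def kernel_def
    using cheb_degree(1)[of ?M] by (auto simp: coeff_sum intro!: sum.neutral coeff_eq_0 le_less_trans[OF cheb_degree(1)])
  have "degree K \<le> 2 * n"
  proof -
    have "deglt (Suc (2 * n)) K" using Kd by (auto simp: deglt_def)
    then show ?thesis by (simp add: deglt_Suc)
  qed
  then have 1: "degree H \<le> 2 * n" unfolding H_def using cheb_degree(1)[of ?M "2 * n"]
    by (intro degree_add_le) (auto intro: order_trans[OF degree_smult_le])
  have 2: "coeff H (2 * n) \<noteq> 0"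
    using Kd c cheb_degree(2)[of ?M "2 * n"] by (simp add: H_def deglt_def)
  have 3: "poly H (- s) = poly H s" for s
  proof -
    have "poly K (- s) = poly K s"
      unfolding K_def kernel_def poly_sum
    proof (intro sum.cong refl)
      fix k show "poly (smult (poly (cheb ?M k) 0 / cheb_norm ?M k) (cheb ?M k)) (- s) = poly (smult (poly (cheb ?M k) 0 / cheb_norm ?M k) (cheb ?M k)) s"
        using cheb_odd_at_0[of k ?M] by (cases "odd k") (auto simp: cheb_parity)
    qed
    then show ?thesis by (simp add: H_def cheb_parity)
  qed
  have 4: "apsum ?M H = 0"
    using n alt_moment_pos[of N n] unfolding H_def apsum_add apsum_smult apsum_cheb_even[OF n(2)] by (simp add: c_def)
  have 5: "psum ?M (f * H) = poly f 0" if "degree f < 2 * n" for f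
  proof -
    have f: "deglt (2 * n) f" using that by (auto simp: deglt_def intro: coeff_eq_0)
    have "psum ?M (f * K) = poly f 0" unfolding K_def by (rule psum_kernel[OF _ _ f]) (use n in auto)
    moreover have "psum ?M (f * cheb ?M (2 * n)) = 0" by (rule psum_deglt[OF f]) (use n in auto)
    ultimately show ?thesis unfolding H_def distrib_left mult_smult_right psum_add psum_smult by simp
  qed
  have K0: "poly K 0 = (\<Sum>k<n. (4 * real k + 1) * central_ratio k ^ 2 * rho (2 * real N + 1) k / (2 * real N + 1))"
  proof -
    have "poly K 0 = (\<Sum>k<n. poly (cheb ?M (2 * k)) 0 / cheb_norm ?M (2 * k) * poly (cheb ?M (2 * k)) 0)"
      unfolding K_def poly_kernel_0 by (rule sum_even_indices(1)) (simp add: cheb_odd_at_0)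
    also have "\<dots> = (\<Sum>k<n. (4 * real k + 1) * central_ratio k ^ 2 * rho (2 * real N + 1) k / (2 * real N + 1))"
      using n by (intro sum.cong refl tp_0_square_term) simp
    finally show ?thesis .
  qed
  have "poly H 0 = poly K 0 - (-1) ^ n * central_ratio n * apsum ?M K"
    using alt_moment_pos[of N n] unfolding H_def poly_add poly_smult cheb_at_0[OF n(2)] by (simp add: c_def)
  also have "\<dots> = (\<Sum>k<n. (4 * real k + 1) * (central_ratio k ^ 2 - (-1) ^ (n + k) * central_ratio n * central_ratio k) * rho (2 * real N + 1) k) / (2 * real N + 1)"
  proof -
    have "A * c ^ 2 * r / m - (s * d) * (t * (A * c * r / m)) = A * (c ^ 2 - (s * t) * d * c) * r / m" for A c r m s d t :: real
      by (simp add: algebra_simps diff_divide_distrib)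
    then show ?thesis
      unfolding K0 K_def[symmetric] Ap_ker[OF n(2), folded K_def] sum_distrib_left sum_subtractf[symmetric] sum_divide_distrib power_add
      by (simp only:)
  qed
  finally have 6: "poly H 0 = (\<Sum>k<n. (4 * real k + 1) * (central_ratio k ^ 2 - (-1) ^ (n + k) * central_ratio n * central_ratio k) * rho (2 * real N + 1) k) / (2 * real N + 1)" .
  show thesis using that[of H] 1 2 3 4 5 6 by blast
qed

section \<open>The polynomial \<open>U\<close> by interpolation\<close>

text \<open>The n-term sum for the proportion, multiplied by its common denominator
  \<open>even_factors n M\<close>, up to the factor 1/M. The products are written out so that the
  expression is a polynomial and makes sense at every M.\<close>

definition T_sum :: "nat \<Rightarrow> real \<Rightarrow> real" where
  "T_sum n M = (\<Sum>k<n. (4 * real k + 1) * (central_ratio k ^ 2 - (-1) ^ (n + k) * central_ratio n * central_ratio k) *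
     ((\<Prod>j<k. M ^ 2 - (2 * real j + 1) ^ 2) * (\<Prod>j\<in>{k..<n - 1}. M ^ 2 - (2 * real j + 2) ^ 2)))"

definition even_factors :: "nat \<Rightarrow> real \<Rightarrow> real" where
  "even_factors n M = (\<Prod>j<n - 1. M ^ 2 - (2 * real j + 2) ^ 2)"

lemma rho_split:
  assumes "k < n" "\<And>j. M ^ 2 \<noteq> (2 * real j + 2) ^ 2 \<or> n - 1 \<le> j"
  shows "(\<Prod>j<k. M ^ 2 - (2 * real j + 1) ^ 2) * (\<Prod>j\<in>{k..<n - 1}. M ^ 2 - (2 * real j + 2) ^ 2) = rho M k * even_factors n M"
proof -
  have u: "{..<n - 1} = {..<k} \<union> {k..<n - 1}" using assms(1) by auto
  have "even_factors n M = (\<Prod>j<k. M ^ 2 - (2 * real j + 2) ^ 2) * (\<Prod>j\<in>{k..<n - 1}. M ^ 2 - (2 * real j + 2) ^ 2)"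
    unfolding even_factors_def u by (rule prod.union_disjoint) auto
  moreover have "(\<Prod>j<k. M ^ 2 - (2 * real j + 1) ^ 2) = rho M k * (\<Prod>j<k. M ^ 2 - (2 * real j + 2) ^ 2)"
    unfolding rho_def prod.distrib[symmetric]
  proof (intro prod.cong refl)
    fix j assume "j \<in> {..<k}"
    then have "\<not> n - 1 \<le> j" using assms(1) by auto
    then have "M ^ 2 - (2 * real j + 2) ^ 2 \<noteq> 0" using assms(2)[of j] by simp
    then show "M ^ 2 - (2 * real j + 1) ^ 2 = (M ^ 2 - (2 * real j + 1) ^ 2) / (M ^ 2 - (2 * real j + 2) ^ 2) * (M ^ 2 - (2 * real j + 2) ^ 2)"
      by simp
  qed
  ultimately show ?thesis by simp
qed

lemma odd_square_neq: "(2 * real N + 1) ^ 2 \<noteq> (2 * real j + 2) ^ 2"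
proof
  assume "(2 * real N + 1) ^ 2 = (2 * real j + 2) ^ 2"
  then have "2 * real N + 1 = 2 * real j + 2" by (rule power_eq_imp_eq_base) auto
  then have "real (2 * N + 1) = real (2 * j + 2)" by simp
  then have "2 * N + 1 = 2 * j + 2" by (rule of_nat_eq_iff[THEN iffD1])
  then show False by presburger
qed

lemma T_sum_rho:
  assumes "n - 1 \<le> N" "1 \<le> n"
  shows "T_sum n (2 * real N + 1) = even_factors n (2 * real N + 1) * (\<Sum>k<n. (4 * real k + 1) * (central_ratio k ^ 2 - (-1) ^ (n + k) * central_ratio n * central_ratio k) * rho (2 * real N + 1) k)"
  unfolding T_sum_def sum_distrib_left
  by (intro sum.cong refl, subst rho_split) (use odd_square_neq in auto)

text \<open>For k > N the odd product contains the zero factor with j = N. The terms k \<le> N form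
  the two complete sums over the grid of 2N + 1 points, which are known.\<close>

lemma T_sum_node:
  assumes "N < n"
  shows "T_sum n (2 * real N + 1) = (2 * real N + 1) * even_factors n (2 * real N + 1) * (1 - (-1) ^ (n + N) * central_ratio n)"
proof -
  let ?M = "2 * real N + 1"
  define P where "P k = (\<Prod>j<k. ?M ^ 2 - (2 * real j + 1) ^ 2) * (\<Prod>j\<in>{k..<n - 1}. ?M ^ 2 - (2 * real j + 2) ^ 2)" for k
  have P0: "P k = 0" if "k \<in> {..<n} - {..<Suc N}" for k
  proof -
    have "N \<in> {..<k}" using that by auto
    then have "(\<Prod>j<k. ?M ^ 2 - (2 * real j + 1) ^ 2) = 0" by (intro prod_zero) auto
    then show ?thesis by (simp add: P_def)
  qed
  have "T_sum n ?M = (\<Sum>k<n. (4 * real k + 1) * (central_ratio k ^ 2 - (-1) ^ (n + k) * central_ratio n * central_ratio k) * P k)"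
    by (simp add: T_sum_def P_def)
  also have "\<dots> = (\<Sum>k<Suc N. (4 * real k + 1) * (central_ratio k ^ 2 - (-1) ^ (n + k) * central_ratio n * central_ratio k) * P k)"
    by (rule sum.mono_neutral_right) (use assms P0 in auto)
  also have "\<dots> = (\<Sum>k<Suc N. even_factors n ?M * ((4 * real k + 1) * central_ratio k ^ 2 * rho ?M k) - even_factors n ?M * ((-1) ^ n * central_ratio n) * ((-1) ^ k * (4 * real k + 1) * central_ratio k * rho ?M k))"
  proof (intro sum.cong refl)
    fix k assume "k \<in> {..<Suc N}"
    then have "P k = rho ?M k * even_factors n ?M" unfolding P_def by (intro rho_split) (use assms odd_square_neq in auto)
    moreover have "A * (c ^ 2 - (s * t) * d * c) * (r * p) = p * (A * c ^ 2 * r) - p * (s * d) * (t * A * c * r)" for A c s t d r p :: real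
      by (simp add: algebra_simps)
    ultimately show "(4 * real k + 1) * (central_ratio k ^ 2 - (-1) ^ (n + k) * central_ratio n * central_ratio k) * P k =
      even_factors n ?M * ((4 * real k + 1) * central_ratio k ^ 2 * rho ?M k) - even_factors n ?M * ((-1) ^ n * central_ratio n) * ((-1) ^ k * (4 * real k + 1) * central_ratio k * rho ?M k)"
      unfolding power_add by (simp only:)
  qed
  also have "\<dots> = even_factors n ?M * ?M - even_factors n ?M * ((-1) ^ n * central_ratio n) * ((-1) ^ N * ?M)"
    unfolding sum_subtractf sum_distrib_left[symmetric] sum_full_1 sum_full_2 ..
  finally show ?thesis by (simp add: power_add algebra_simps)
qed

lemma T_sum_minus: "T_sum n (- M) = T_sum n M"
  by (simp add: T_sum_def)

text \<open>The 2m + 1 factors M - 2m, ..., M + 2m pair up around the middle factor M. This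
  identifies the Pochhammer symbols of \<open>U\<close> and \<open>R\<close> with the common
  denominator.\<close>

lemma pochhammer_even_factors:
  "2 ^ (2 * m + 1) * pochhammer ((M + 1) / 2 - real (m + 1) + 1/2) (2 * m + 1) = M * (\<Prod>j<m. M ^ 2 - (2 * real j + 2) ^ 2)"
proof -
  have "(\<Prod>k<2 * m + 1. M + 2 * (real k - real m)) = M * (\<Prod>j<m. M ^ 2 - (2 * real j + 2) ^ 2)"
  proof (induction m)
    case (Suc m)
    define f where "f k = M + 2 * (real k - real m)" for k
    have "(\<Prod>k<2 * Suc m + 1. M + 2 * (real k - real (Suc m))) = (\<Prod>k<Suc (Suc (2 * m + 1)). M + 2 * (real k - real (Suc m)))" by simp
    also have "\<dots> = (M - 2 * real (Suc m)) * (\<Prod>k<Suc (2 * m + 1). f k)"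
      unfolding prod.lessThan_Suc_shift[of _ "Suc (2 * m + 1)"] f_def by simp
    also have "(\<Prod>k<Suc (2 * m + 1). f k) = (\<Prod>k<2 * m + 1. f k) * f (2 * m + 1)" by (rule prod.lessThan_Suc)
    also have "(\<Prod>k<2 * m + 1. f k) = M * (\<Prod>j<m. M ^ 2 - (2 * real j + 2) ^ 2)" unfolding f_def by (rule Suc)
    also have "f (2 * m + 1) = M + 2 * real (Suc m)" by (simp add: f_def)
    also have "(M - 2 * real (Suc m)) * (M * (\<Prod>j<m. M ^ 2 - (2 * real j + 2) ^ 2) * (M + 2 * real (Suc m))) =
        M * ((\<Prod>j<m. M ^ 2 - (2 * real j + 2) ^ 2) * (M ^ 2 - (2 * real m + 2) ^ 2))"
      by (simp add: power2_eq_square algebra_simps)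
    finally show ?case by simp
  qed simp
  moreover have "2 ^ (2 * m + 1) * pochhammer ((M + 1) / 2 - real (m + 1) + 1/2) (2 * m + 1) = (\<Prod>k<2 * m + 1. 2 * ((M + 1) / 2 - real (m + 1) + 1/2 + real k))"
    unfolding prod.distrib pochhammer_prod by (simp add: atLeast0LessThan)
  moreover have "(\<Prod>k<2 * m + 1. 2 * ((M + 1) / 2 - real (m + 1) + 1/2 + real k)) = (\<Prod>k<2 * m + 1. M + 2 * (real k - real m))"
    by (intro prod.cong refl) (simp add: field_simps)
  ultimately show ?thesis by simp
qed

section \<open>Double factorials and \<open>U\<close> as a polynomial in x\<close>

lemma dfact_even: "real (dfact (2 * n)) = 2 ^ n * fact n"
  by (induction n) (auto simp: algebra_simps)

lemma dfact_odd: "1 \<le> n \<Longrightarrow> real (dfact (2 * n - 1)) = central_ratio n * (2 ^ n * fact n)"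
proof (induction n rule: dec_induct)
  case base
  then show ?case by (simp add: central_ratio_def numeral_2_eq_2)
next
  case (step n)
  have 1: "2 * Suc n - 1 = Suc (Suc (2 * n - 1))" using step by simp
  have 2: "real (Suc (Suc (2 * n - 1))) = 2 * real n + 1" using step by (simp add: of_nat_diff)
  have "real (dfact (2 * Suc n - 1)) = (2 * real n + 1) * real (dfact (2 * n - 1))"
    unfolding 1 dfact.simps(3) of_nat_mult 2 ..
  also have "\<dots> = central_ratio (Suc n) * (2 ^ Suc n * fact (Suc n))"
    unfolding step.IH central_ratio_Suc by (simp add: field_simps)
  finally show ?case .
qed

definition U_coeff :: "nat \<Rightarrow> nat \<Rightarrow> real" where
  "U_coeff n i = (real (dfact (2*n - 1)) + (-1) ^ (i + 1) * real (dfact (2*n))) *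
     pochhammer (3/2 - real i) (2*n - 1) / (fact (i - 1) * fact (2*n - i))"

definition rising_poly :: "real \<Rightarrow> nat \<Rightarrow> real poly" where
  "rising_poly a m = (\<Prod>j<m. [:a + real j, 1:])"

definition U_poly :: "nat \<Rightarrow> real poly" where
  "U_poly n = (\<Sum>i=1..n. smult (U_coeff n i)
     (rising_poly 1 (i - 1) * rising_poly (real i + 1) (2*n - i) - rising_poly 1 (2*n - i) * rising_poly (2 * real n + 2 - real i) (i - 1)))"

lemma poly_rising_poly: "poly (rising_poly a m) x = pochhammer (x + a) m"
  by (simp add: rising_poly_def poly_prod pochhammer_prod atLeast0LessThan add_ac)

lemma degree_rising_poly: "degree (rising_poly a m) = m"
  unfolding rising_poly_def by (subst degree_prod_eq_sum_degree) auto

lemma poly_U_poly: "poly (U_poly n) x = (\<Sum>i=1..n. U_coeff n i *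
     (pochhammer (x + 1) (i - 1) * pochhammer (x + real i + 1) (2*n - i)
      - pochhammer (x + 1) (2*n - i) * pochhammer (x + 2 * real n + 2 - real i) (i - 1)))"
  by (simp add: U_poly_def poly_sum poly_rising_poly algebra_simps)

lemma U_eq_poly: "U n x = poly (U_poly n) (real x)"
  by (simp add: U_def poly_U_poly U_coeff_def)

lemma degree_U_poly: "degree (U_poly n) \<le> 2 * n - 1"
  unfolding U_poly_def
proof (rule degree_sum_le)
  fix i assume i: "i \<in> {1..n}"
  have "degree (rising_poly 1 (i - 1) * rising_poly (real i + 1) (2*n - i)) \<le> 2 * n - 1"
    using degree_mult_le[of "rising_poly 1 (i - 1)" "rising_poly (real i + 1) (2*n - i)"] i by (auto simp: degree_rising_poly)
  moreover have "degree (rising_poly 1 (2*n - i) * rising_poly (2 * real n + 2 - real i) (i - 1)) \<le> 2 * n - 1"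
    using degree_mult_le[of "rising_poly 1 (2*n - i)" "rising_poly (2 * real n + 2 - real i) (i - 1)"] i by (auto simp: degree_rising_poly)
  ultimately show "degree (smult (U_coeff n i) (rising_poly 1 (i - 1) * rising_poly (real i + 1) (2*n - i) - rising_poly 1 (2*n - i) * rising_poly (2 * real n + 2 - real i) (i - 1))) \<le> 2 * n - 1"
    by (intro order_trans[OF degree_smult_le] degree_diff_le)
qed simp

lemma pochhammer_neg_zero: "p < m \<Longrightarrow> z = - real p \<Longrightarrow> pochhammer z m = 0"
  by (simp add: pochhammer_of_nat_eq_0_iff)

lemma minus_one_power_cancel:
  assumes "(a :: real) * (-1) ^ k = -1" shows "a = - ((-1) ^ k)"
proof -
  have "a = a * (-1) ^ k * (-1) ^ k" by (simp add: mult.assoc power_mult_distrib[symmetric])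
  then show ?thesis unfolding assms by simp
qed

text \<open>The sum behaves like an interpolation formula: at either node only the term i = m
  survives, from its first product at -m and from its second at the mirrored node. The two sign
  changes, from the subtraction and from the parity of 2n - m, cancel.\<close>

lemma U_poly_node:
  assumes "1 \<le> m" "m \<le> n"
  shows "poly (U_poly n) (- real m) = U_coeff n m * ((-1) ^ (m - 1) * fact (m - 1) * fact (2 * n - m))"
    "poly (U_poly n) (- real (2 * n + 1 - m)) = U_coeff n m * ((-1) ^ (m - 1) * fact (m - 1) * fact (2 * n - m))"
proof -
  define v where "v = (-1) ^ (m - 1) * fact (m - 1) * (fact (2 * n - m) :: real)"
  have "poly (U_poly n) (- real m) = (\<Sum>i=1..n. if i = m then U_coeff n m * v else 0)"
    unfolding poly_U_poly
  proof (intro sum.cong refl)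
    fix i assume i: "i \<in> {1..n}"
    have z2: "pochhammer (- real m + 1) (2 * n - i) = 0"
      by (rule pochhammer_neg_zero[of "m - 1"]) (use i assms in \<open>auto simp: of_nat_diff\<close>)
    show "U_coeff n i * (pochhammer (- real m + 1) (i - 1) * pochhammer (- real m + real i + 1) (2*n - i)
      - pochhammer (- real m + 1) (2*n - i) * pochhammer (- real m + 2 * real n + 2 - real i) (i - 1)) = (if i = m then U_coeff n m * v else 0)"
    proof (cases "i = m")
      case True
      have "- real m + 1 = - real (m - 1)" using assms by (simp add: of_nat_diff)
      then have "pochhammer (- real m + 1) (m - 1) = (-1) ^ (m - 1) * fact (m - 1)" by (simp only: pochhammer_same)
      moreover have "pochhammer (- real m + real m + 1) (2 * n - m) = fact (2 * n - m)" by (simp add: pochhammer_fact)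
      ultimately show ?thesis using True z2 by (simp add: v_def)
    next
      case False
      have "pochhammer (- real m + 1) (i - 1) = 0 \<or> pochhammer (- real m + real i + 1) (2 * n - i) = 0"
      proof (cases "m < i")
        case True
        then have "pochhammer (- real m + 1) (i - 1) = 0"
          by (intro pochhammer_neg_zero[of "m - 1"]) (use assms in \<open>auto simp: of_nat_diff\<close>)
        then show ?thesis ..
      next
        case 2: False
        then have "pochhammer (- real m + real i + 1) (2 * n - i) = 0"
          by (intro pochhammer_neg_zero[of "m - i - 1"]) (use \<open>i \<noteq> m\<close> i assms in \<open>auto simp: of_nat_diff\<close>)
        then show ?thesis ..
      qed
      then show ?thesis using z2 False by auto
    qed
  qed
  then show "poly (U_poly n) (- real m) = U_coeff n m * ((-1) ^ (m - 1) * fact (m - 1) * fact (2 * n - m))"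
    using assms by (simp add: v_def)
  define q where "q = 2 * n + 1 - m"
  have q: "real q = 2 * real n + 1 - real m" "n < q" "q \<le> 2 * n" using assms by (auto simp: q_def of_nat_diff)
  have "poly (U_poly n) (- real q) = (\<Sum>i=1..n. if i = m then U_coeff n m * v else 0)"
    unfolding poly_U_poly
  proof (intro sum.cong refl)
    fix i assume i: "i \<in> {1..n}"
    have z1: "pochhammer (- real q + real i + 1) (2 * n - i) = 0"
      by (rule pochhammer_neg_zero[of "q - i - 1"]) (use i q in \<open>auto simp: of_nat_diff\<close>)
    show "U_coeff n i * (pochhammer (- real q + 1) (i - 1) * pochhammer (- real q + real i + 1) (2*n - i)
      - pochhammer (- real q + 1) (2*n - i) * pochhammer (- real q + 2 * real n + 2 - real i) (i - 1)) = (if i = m then U_coeff n m * v else 0)"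
    proof (cases "i = m")
      case True
      have "- real q + 1 = - real (2 * n - m)" using assms q by (simp add: of_nat_diff)
      then have 1: "pochhammer (- real q + 1) (2 * n - m) = (-1) ^ (2 * n - m) * fact (2 * n - m)" by (simp only: pochhammer_same)
      have "- real q + 2 * real n + 2 - real m = 1" using q by simp
      then have 2: "pochhammer (- real q + 2 * real n + 2 - real m) (m - 1) = fact (m - 1)" by (simp only: pochhammer_fact)
      have "(-1 :: real) ^ (2 * n - m) = - ((-1) ^ (m - 1))"
      proof -
        have "2 * n - m + (m - 1) = 2 * (n - 1) + 1" using assms by simp
        then have "(-1 :: real) ^ (2 * n - m) * (-1) ^ (m - 1) = -1" unfolding power_add[symmetric] by simp
        then show ?thesis by (rule minus_one_power_cancel)
      qed
      then show ?thesis using True z1 1 2 by (simp add: v_def)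
    next
      case False
      have "pochhammer (- real q + 1) (2 * n - i) = 0 \<or> pochhammer (- real q + 2 * real n + 2 - real i) (i - 1) = 0"
      proof (cases "i < m")
        case True
        then have "pochhammer (- real q + 1) (2 * n - i) = 0"
          by (intro pochhammer_neg_zero[of "q - 1"]) (use i q assms in \<open>auto simp: of_nat_diff q_def\<close>)
        then show ?thesis ..
      next
        case 2: False
        then have "pochhammer (- real q + 2 * real n + 2 - real i) (i - 1) = 0"
          by (intro pochhammer_neg_zero[of "i - m - 1"]) (use \<open>i \<noteq> m\<close> i assms q in \<open>auto simp: of_nat_diff\<close>)
        then show ?thesis ..
      qed
      then show ?thesis using z1 False by auto
    qed
  qed
  then show "poly (U_poly n) (- real (2 * n + 1 - m)) = U_coeff n m * ((-1) ^ (m - 1) * fact (m - 1) * fact (2 * n - m))"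
    using assms by (simp add: v_def q_def)
qed

text \<open>The double factorials are 2^n n! times \<open>central_ratio n\<close> and 1, so their
  signed sum yields the factor 1 plus or minus \<open>central_ratio n\<close> of
  \<open>T_sum_node\<close>; the Pochhammer symbol yields the even factors.\<close>

lemma U_coeff_node:
  assumes "1 \<le> m" "m \<le> n"
  shows "2 ^ (n - 1) / fact n * (U_coeff n m * ((-1) ^ (m - 1) * fact (m - 1) * fact (2 * n - m))) = T_sum n (2 * real (n - m) + 1)"
proof -
  let ?M = "2 * real (n - m) + 1"
  have e: "2 * n - 1 = 2 * (n - 1) + 1" using assms by simp
  have "(?M + 1) / 2 - real (n - 1 + 1) + 1/2 = 3/2 - real m" using assms by (simp add: of_nat_diff field_simps)
  then have poch: "2 ^ (2 * n - 1) * pochhammer (3/2 - real m) (2 * n - 1) = ?M * even_factors n ?M"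
    using pochhammer_even_factors[of "n - 1" ?M] unfolding e even_factors_def by simp
  have s: "(-1 :: real) ^ (m + 1) = (-1) ^ (m - 1)" "(-1 :: real) ^ (m - 1) * (-1) ^ (m - 1) = 1"
    "(-1 :: real) ^ (n + (n - m)) = - ((-1) ^ (m - 1))"
  proof -
    obtain m' where m': "m = Suc m'" using assms by (cases m) auto
    show "(-1 :: real) ^ (m + 1) = (-1) ^ (m - 1)" by (simp add: m')
    show 2: "(-1 :: real) ^ (m - 1) * (-1) ^ (m - 1) = 1" by (simp add: power_mult_distrib[symmetric])
    have "n + (n - m) + (m - 1) = 2 * (n - 1) + 1" using assms by simp
    then have "(-1 :: real) ^ (n + (n - m)) * (-1) ^ (m - 1) = -1" unfolding power_add[symmetric] by simp
    then show "(-1 :: real) ^ (n + (n - m)) = - ((-1) ^ (m - 1))" by (rule minus_one_power_cancel)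
  qed
  have p2: "(2::real) ^ (n - 1) * 2 ^ n = 2 ^ (2 * n - 1)" using assms by (simp add: power_add[symmetric])
  have "2 ^ (n - 1) / fact n * (U_coeff n m * ((-1) ^ (m - 1) * fact (m - 1) * fact (2 * n - m))) =
     2 ^ (n - 1) / fact n * ((central_ratio n * (2 ^ n * fact n) + (-1) ^ (m - 1) * (2 ^ n * fact n)) * pochhammer (3/2 - real m) (2 * n - 1)) * (-1) ^ (m - 1)"
    unfolding U_coeff_def dfact_even dfact_odd[OF order_trans[OF assms]] s(1) by simp
  also have "\<dots> = (2 ^ (n - 1) * 2 ^ n) * pochhammer (3/2 - real m) (2 * n - 1) * (central_ratio n * (-1) ^ (m - 1) + (-1) ^ (m - 1) * (-1) ^ (m - 1))"
    by (simp add: field_simps)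
  also have "\<dots> = ?M * even_factors n ?M * (1 + (-1) ^ (m - 1) * central_ratio n)" unfolding p2 poch s(2) by (simp add: algebra_simps)
  also have "\<dots> = T_sum n ?M"
  proof -
    have "n - m < n" using assms by simp
    from T_sum_node[OF this] show ?thesis unfolding s(3) by simp
  qed
  finally show ?thesis .
qed

section \<open>Comparison of the two polynomials and the prefactor of \<open>R\<close>\<close>

definition T_poly :: "nat \<Rightarrow> real poly" where
  "T_poly n = (\<Sum>k<n. smult ((4 * real k + 1) * (central_ratio k ^ 2 - (-1) ^ (n + k) * central_ratio n * central_ratio k))
     ((\<Prod>j<k. [:2 * real n + 1, 2:] ^ 2 - [:(2 * real j + 1) ^ 2:]) * (\<Prod>j\<in>{k..<n - 1}. [:2 * real n + 1, 2:] ^ 2 - [:(2 * real j + 2) ^ 2:])))"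

lemma poly_T_poly: "poly (T_poly n) x = T_sum n (2 * x + 2 * real n + 1)"
  unfolding T_poly_def T_sum_def poly_sum
  by (intro sum.cong refl) (simp add: poly_prod algebra_simps)

lemma degree_T_poly: "degree (T_poly n) \<le> 2 * n - 1"
  unfolding T_poly_def
proof (rule degree_sum_le)
  fix k assume k: "k \<in> {..<n}"
  have d: "degree ([:2 * real n + 1, 2:] ^ 2 - [:c:]) \<le> 2" for c :: real
    by (rule degree_diff_le) (auto simp: degree_power_eq)
  have "degree (\<Prod>j<k. [:2 * real n + 1, 2:] ^ 2 - [:(2 * real j + 1) ^ 2:]) \<le> 2 * k"
    by (rule order_trans[OF degree_prod_sum_le]) (auto intro: order_trans[OF sum_mono[of _ _ "\<lambda>_. 2"]] d)
  moreover have "degree (\<Prod>j\<in>{k..<n - 1}. [:2 * real n + 1, 2:] ^ 2 - [:(2 * real j + 2) ^ 2:]) \<le> 2 * (n - 1 - k)"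
    by (rule order_trans[OF degree_prod_sum_le]) (auto intro: order_trans[OF sum_mono[of _ _ "\<lambda>_. 2"]] d)
  ultimately have "degree ((\<Prod>j<k. [:2 * real n + 1, 2:] ^ 2 - [:(2 * real j + 1) ^ 2:]) * (\<Prod>j\<in>{k..<n - 1}. [:2 * real n + 1, 2:] ^ 2 - [:(2 * real j + 2) ^ 2:])) \<le> 2 * n - 1"
    using degree_mult_le[of "\<Prod>j<k. [:2 * real n + 1, 2:] ^ 2 - [:(2 * real j + 1) ^ 2:]" "\<Prod>j\<in>{k..<n - 1}. [:2 * real n + 1, 2:] ^ 2 - [:(2 * real j + 2) ^ 2:]"] k
    by simp
  then show "degree (smult ((4 * real k + 1) * (central_ratio k ^ 2 - (-1) ^ (n + k) * central_ratio n * central_ratio k)) ((\<Prod>j<k. [:2 * real n + 1, 2:] ^ 2 - [:(2 * real j + 1) ^ 2:]) * (\<Prod>j\<in>{k..<n - 1}. [:2 * real n + 1, 2:] ^ 2 - [:(2 * real j + 2) ^ 2:]))) \<le> 2 * n - 1"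
    by (rule order_trans[OF degree_smult_le])
qed simp

text \<open>Two polynomials of degree at most 2n - 1 agree at 2n nodes. For i \<le> n the node x =
  -i gives M = 2(n - i) + 1; the other nodes give the negatives of these, where evenness in M
  applies.\<close>

lemma U_eq_T_sum:
  assumes "1 \<le> n"
  shows "2 ^ (n - 1) / fact n * U n x = T_sum n (2 * real x + 2 * real n + 1)"
proof -
  have "smult (2 ^ (n - 1) / fact n) (U_poly n) = T_poly n"
  proof (rule poly_eqI_degree[where A = "(\<lambda>i. - real i) ` {1..2 * n}"])
    have "card ((\<lambda>i. - real i) ` {1..2 * n}) = 2 * n" by (subst card_image) (auto simp: inj_on_def)
    then show "degree (smult (2 ^ (n - 1) / fact n) (U_poly n)) < card ((\<lambda>i. - real i) ` {1..2 * n})"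
      "degree (T_poly n) < card ((\<lambda>i. - real i) ` {1..2 * n})"
      using degree_U_poly[of n] degree_T_poly[of n] assms order_trans[OF degree_smult_le degree_U_poly, of "2 ^ (n - 1) / fact n" n] by auto
  next
    fix x assume "x \<in> (\<lambda>i. - real i) ` {1..2 * n}"
    then obtain i where i: "1 \<le> i" "i \<le> 2 * n" "x = - real i" by auto
    show "poly (smult (2 ^ (n - 1) / fact n) (U_poly n)) x = poly (T_poly n) x"
    proof (cases "i \<le> n")
      case True
      have "2 * x + 2 * real n + 1 = 2 * real (n - i) + 1" using True i by (simp add: of_nat_diff)
      then show ?thesis unfolding poly_T_poly poly_smult using U_coeff_node[of i n] U_poly_node(1)[of i n] i True by simp
    next
      case False
      define m where "m = 2 * n + 1 - i"
      have m: "1 \<le> m" "m \<le> n" "2 * n + 1 - m = i" using False i by (auto simp: m_def)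
      have "2 * x + 2 * real n + 1 = - (2 * real (n - m) + 1)" using False i by (simp add: of_nat_diff m_def)
      then have "poly (T_poly n) x = T_sum n (2 * real (n - m) + 1)" unfolding poly_T_poly by (simp only: T_sum_minus)
      then show ?thesis using U_coeff_node[OF m(1,2)] U_poly_node(2)[OF m(1,2)] i(3) unfolding m(3) poly_smult by simp
    qed
  qed
  from arg_cong[OF this, of "\<lambda>p. poly p (real x)"] show ?thesis by (simp add: U_eq_poly poly_T_poly)
qed

text \<open>Legendre duplication: the even factors of the longer factorial form another factorial,
  the odd ones a Pochhammer symbol at a half-integer.\<close>

lemma fact_duplication:
  "(fact (2 * x + 2 + 2 * m) :: real) * fact (x + 1) = 4 ^ m * fact (2 * x + 2) * fact (x + 1 + m) * pochhammer (real x + 3/2) m"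
proof (induction m)
  case (Suc m)
  have "(fact (2 * x + 2 + 2 * Suc m) :: real) * fact (x + 1) =
     (2 * real x + 2 * real m + 4) * (2 * real x + 2 * real m + 3) * (fact (2 * x + 2 + 2 * m) * fact (x + 1))"
    by (simp add: algebra_simps)
  also have "\<dots> = 4 * (real x + real m + 2) * (real x + 3/2 + real m) * (4 ^ m * fact (2 * x + 2) * fact (x + 1 + m) * pochhammer (real x + 3/2) m)"
    unfolding Suc by (simp add: algebra_simps)
  also have "\<dots> = 4 ^ Suc m * fact (2 * x + 2) * ((real x + real m + 2) * fact (x + 1 + m)) * (pochhammer (real x + 3/2) m * (real x + 3/2 + real m))"
    by (simp only: power_Suc mult_ac)
  also have "(real x + real m + 2) * fact (x + 1 + m) = fact (x + 1 + Suc m)" by (simp add: algebra_simps)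
  also have "pochhammer (real x + 3/2) m * (real x + 3/2 + real m) = pochhammer (real x + 3/2) (Suc m)"
    by (simp add: pochhammer_Suc)
  finally show ?case .
qed simp

text \<open>By duplication the factorials in \<open>R\<close> equal 2^(n-1)/n! divided by M times
  the even factors, which is the normalisation lost in passing to \<open>T_sum\<close>.\<close>

theorem R_formula:
  fixes n x :: nat
  assumes "1 \<le> n"
  defines "N \<equiv> n + x"
  shows "R n x = (\<Sum>k<n. (4 * real k + 1) * (central_ratio k ^ 2 - (-1) ^ (n + k) * central_ratio n * central_ratio k) * rho (2 * real N + 1) k) / (2 * real N + 1)"
proof -
  let ?M = "2 * real N + 1"
  define S where "S = (\<Sum>k<n. (4 * real k + 1) * (central_ratio k ^ 2 - (-1) ^ (n + k) * central_ratio n * central_ratio k) * rho ?M k)"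
  have e: "2 * n - 1 = 2 * (n - 1) + 1" using assms(1) by simp
  have M: "?M = 2 * real x + 2 * real n + 1" by (simp add: N_def)
  have T: "2 ^ (n - 1) / fact n * U n x = even_factors n ?M * S"
    unfolding U_eq_T_sum[OF assms(1)] S_def M[symmetric] by (rule T_sum_rho) (use assms in auto)
  have "(?M + 1) / 2 - real (n - 1 + 1) + 1/2 = real x + 3/2" using assms by (simp add: of_nat_diff field_simps)
  then have poch: "2 ^ (2 * n - 1) * pochhammer (real x + 3/2) (2 * n - 1) = ?M * even_factors n ?M"
    using pochhammer_even_factors[of "n - 1" ?M] unfolding e even_factors_def by simp
  define p where "p = pochhammer (real x + 3/2) (2 * n - 1)"
  have p: "p > 0" unfolding p_def by (rule pochhammer_pos) simp
  have even_factors: "even_factors n ?M > 0"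
  proof -
    have "0 < ?M * even_factors n ?M" unfolding poch[symmetric] p_def[symmetric] using p by simp
    then show ?thesis by (rule zero_less_mult_pos) simp
  qed
  have "2 * x + 2 + 2 * (2 * n - 1) = 2 * x + 4 * n" "x + 1 + (2 * n - 1) = x + 2 * n" using assms(1) by auto
  then have dup: "fact (2 * x + 4 * n) * fact (x + 1) = 4 ^ (2 * n - 1) * fact (2 * x + 2) * fact (x + 2 * n) * p"
    using fact_duplication[of x "2 * n - 1"] by (simp only: p_def)
  have four: "(4 :: real) ^ (2 * n - 1) * 2 ^ (n - 1) = 2 ^ (3 * n - 2) * 2 ^ (2 * n - 1)"
  proof -
    have "(4 :: real) ^ (2 * n - 1) = 2 ^ (2 * (2 * n - 1))" by (simp add: power_mult)
    moreover have "2 * (2 * n - 1) + (n - 1) = 3 * n - 2 + (2 * n - 1)" using assms(1) by simp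
    ultimately show ?thesis by (simp only: power_add[symmetric])
  qed
  have "R n x * (?M * even_factors n ?M) = 2 ^ (n - 1) / fact n * U n x"
  proof -
    have "R n x * (?M * even_factors n ?M) = (2 ^ (3 * n - 2) * 2 ^ (2 * n - 1)) * (fact (2 * x + 2) * fact (x + 2 * n) * p) / (fact n * (fact (2 * x + 4 * n) * fact (x + 1))) * U n x"
      unfolding R_def poch[symmetric] p_def[symmetric] by (simp add: mult_ac)
    also have "\<dots> = 2 ^ (n - 1) / fact n * U n x"
      unfolding dup four[symmetric] using p by (simp add: mult_ac)
    finally show ?thesis .
  qed
  then have "R n x * ?M = S" unfolding T using even_factors by simp
  then show ?thesis unfolding S_def[symmetric] by (simp add: eq_divide_eq add_nonneg_pos)
qed

section \<open>Evaluation of the sums over point sets\<close>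

lemma grid_sum_int: "grid_sum (2 * N + 1) f = (\<Sum>s\<in>{- int N..int N}. f (real_of_int s))"
  unfolding grid_sum_def
proof (rule sum.reindex_bij_witness[where i = "\<lambda>s. nat (s + int N)" and j = "\<lambda>i. int i - int N"])
  fix i assume "i \<in> {..<2 * N + 1}"
  show "f (real_of_int (int i - int N)) = f (real i - (real (2 * N + 1) - 1) / 2)" by simp
qed auto

lemma sum_telescope_int:
  fixes \<beta> :: "real \<Rightarrow> real"
  assumes "a \<le> b + 1"
  shows "(\<Sum>t\<in>{a..b}. \<beta> (real_of_int t - 1/2) - \<beta> (real_of_int t + 1/2)) = \<beta> (real_of_int a - 1/2) - \<beta> (real_of_int b + 1/2)"
proof -
  have "a - 1 \<le> b" using assms by simp
  then show ?thesis
  proof (induction b rule: int_ge_induct)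
    case base
    then show ?case by (simp add: algebra_simps)
  next
    case (step b)
    have "{a..b + 1} = insert (b + 1) {a..b}" using step by auto
    moreover have "real_of_int (b + 1) - 1/2 = real_of_int b + 1/2" by simp
    ultimately show ?case using step by (simp add: add.commute)
  qed
qed

text \<open>Solve \<beta>(s + 1/2) + \<beta>(s - 1/2) = H(s) and put g(s) = \<beta>(s - 1/2) -
  \<beta>(s + 1/2). The sums of g on both sides of s telescope and together give H(s), provided that
  \<beta> vanishes half a step beyond the ends of the grid.\<close>

lemma obtain_odd_preimage:
  assumes "\<And>s. poly H (- s) = poly H s" "degree H \<le> 2 * m + 2" "apsum (2 * N + 1) H = 0"
  obtains g where "\<And>s. poly g (- s) = - poly g s" "degree g \<le> 2 * m + 1"
    "coeff g (2 * m + 1) = - (real m + 1) * coeff H (2 * m + 2)"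
    "\<And>s. s \<in> {- int N..int N} \<Longrightarrow> (\<Sum>t\<in>{- int N..int N}. real_of_int (sgn (t - s)) * poly g (real_of_int t)) = poly H (real_of_int s)"
proof -
  obtain B0 where B0: "degree B0 \<le> 2 * m + 2" "cmean B0 = H" using cmean_surj[OF assms(2)] by blast
  \<comment> \<open>Symmetrising preserves the equation because H is even; it makes g odd and the
    two boundary values equal.\<close>
  define \<beta> where "\<beta> = smult (1/2) (B0 + preflect B0)"
  have \<beta>deg: "degree \<beta> \<le> 2 * m + 2"
    unfolding \<beta>_def using B0(1)
    by (intro order_trans[OF degree_smult_le] degree_add_le) (simp_all add: preflect_def degree_pcompose)
  have \<beta>even: "poly \<beta> (- s) = poly \<beta> s" for s by (simp add: \<beta>_def)
  have "cmean \<beta> = H"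
  proof (rule poly_eq_poly_eq_iff[THEN iffD1], rule ext)
    fix s
    have "poly B0 (s + 1/2) + poly B0 (s - 1/2) = poly H s" for s
      using B0(2) poly_cmean[of B0 s] by simp
    from this[of s] this[of "- s"] assms(1)[of s]
    show "poly (cmean \<beta>) s = poly H s" by (simp add: poly_cmean \<beta>_def algebra_simps)
  qed
  then have \<beta>H: "poly \<beta> (s + 1/2) + poly \<beta> (s - 1/2) = poly H s" for s using poly_cmean[of \<beta> s] by simp
  have \<beta>c: "coeff \<beta> (2 * m + 2) = coeff H (2 * m + 2) / 2"
    using cmean_degree(2)[OF \<beta>deg] \<open>cmean \<beta> = H\<close> by simp
  define r where "r = real N + 1/2"
  \<comment> \<open>The alternating sum of H telescopes to twice the common boundary value of
    \<beta>, so its vanishing is exactly the condition needed.\<close>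
  have "alt_grid_sum (Suc (2 * N)) (\<lambda>s. poly \<beta> (s + 1/2) + 1 * poly \<beta> (s - 1/2)) = 2 * poly \<beta> r"
    unfolding alt_grid_sum_telescope using \<beta>even[of "(real (2 * N) + 1) / 2"] by (simp add: r_def add_divide_distrib)
  moreover have "alt_grid_sum (Suc (2 * N)) (\<lambda>s. poly \<beta> (s + 1/2) + 1 * poly \<beta> (s - 1/2)) = 0"
    using assms(3) by (simp add: apsum_def \<beta>H)
  ultimately have \<beta>r: "poly \<beta> r = 0" "poly \<beta> (- r) = 0" using \<beta>even by auto
  define g where "g = - cdiff \<beta>"
  have g: "poly g s = poly \<beta> (s - 1/2) - poly \<beta> (s + 1/2)" for s by (simp add: g_def poly_cdiff)
  show thesis
  proof (rule that[of g])
    show "poly g (- s) = - poly g s" for s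
      using \<beta>even[of "s - 1/2"] \<beta>even[of "s + 1/2"] by (simp add: g)
    have d: "degree \<beta> \<le> Suc (2 * m + 1)" using \<beta>deg by simp
    show "degree g \<le> 2 * m + 1" using cdiff_degree(1)[OF d] by (simp add: g_def)
    show "coeff g (2 * m + 1) = - (real m + 1) * coeff H (2 * m + 2)"
      using cdiff_degree(2)[OF d] \<beta>c by (simp add: g_def field_simps)
    fix s assume s: "s \<in> {- int N..int N}"
    have split: "{- int N..int N} = {- int N..s - 1} \<union> {s} \<union> {s + 1..int N}" using s by auto
    have "(\<Sum>t\<in>{- int N..int N}. real_of_int (sgn (t - s)) * poly g (real_of_int t)) =
       (\<Sum>t\<in>{- int N..s - 1}. real_of_int (sgn (t - s)) * poly g (real_of_int t)) +
       (\<Sum>t\<in>{s + 1..int N}. real_of_int (sgn (t - s)) * poly g (real_of_int t))"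
      unfolding split by (subst sum.union_disjoint, simp, simp, force)+ simp
    also have "(\<Sum>t\<in>{- int N..s - 1}. real_of_int (sgn (t - s)) * poly g (real_of_int t)) = - (\<Sum>t\<in>{- int N..s - 1}. poly g (real_of_int t))"
      unfolding sum_negf[symmetric] by (intro sum.cong refl) simp
    also have "(\<Sum>t\<in>{s + 1..int N}. real_of_int (sgn (t - s)) * poly g (real_of_int t)) = (\<Sum>t\<in>{s + 1..int N}. poly g (real_of_int t))"
      by (intro sum.cong refl) simp
    also have "(\<Sum>t\<in>{- int N..s - 1}. poly g (real_of_int t)) = - poly \<beta> (real_of_int s - 1/2)"
    proof -
      have "real_of_int (- int N) - 1/2 = - r" "real_of_int (s - 1) + 1/2 = real_of_int s - 1/2" by (simp_all add: r_def)
      then show ?thesis unfolding g using s \<beta>r(2) sum_telescope_int[of "- int N" "s - 1" "poly \<beta>"] by simp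
    qed
    also have "(\<Sum>t\<in>{s + 1..int N}. poly g (real_of_int t)) = poly \<beta> (real_of_int s + 1/2)"
    proof -
      have "real_of_int (s + 1) - 1/2 = real_of_int s + 1/2" "real_of_int (int N) + 1/2 = r" by (simp_all add: r_def)
      then show ?thesis unfolding g using s \<beta>r(1) sum_telescope_int[of "s + 1" "int N" "poly \<beta>"] by (simp add: add.commute)
    qed
    finally show "(\<Sum>t\<in>{- int N..int N}. real_of_int (sgn (t - s)) * poly g (real_of_int t)) = poly H (real_of_int s)"
      using \<beta>H[of "real_of_int s"] by simp
  qed
qed

section \<open>The sign form on polynomials\<close>

definition poly_int :: "real poly \<Rightarrow> int \<Rightarrow> real" where
  "poly_int p s = poly p (real_of_int s)"

lemma sgn_form_antisym: "sgn_form X f g = - sgn_form X g f"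
proof -
  have "sgn_form X f g = (\<Sum>s\<in>X. \<Sum>t\<in>X. real_of_int (sgn (t - s)) * (f s * g t))"
    by (simp add: sgn_form_def sum_distrib_left mult_ac)
  also have "\<dots> = (\<Sum>t\<in>X. \<Sum>s\<in>X. real_of_int (sgn (t - s)) * (f s * g t))" by (rule sum.swap)
  also have "\<dots> = (\<Sum>t\<in>X. \<Sum>s\<in>X. - (real_of_int (sgn (s - t)) * (g t * f s)))"
    by (intro sum.cong refl) (simp add: sgn_if)
  also have "\<dots> = - sgn_form X g f"
    by (simp add: sgn_form_def sum_distrib_left sum_negf mult_ac)
  finally show ?thesis .
qed

text \<open>Negating both variables reverses the sign kernel and leaves the product of two functions
  of equal parity unchanged.\<close>

lemma sgn_form_parity:
  assumes "\<And>s. s \<in> X \<Longrightarrow> - s \<in> X" "\<And>s. f (- s) = c * f s" "\<And>s. g (- s) = c * g s" "c * c = 1"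
  shows "sgn_form X f g = 0"
proof -
  have re: "(\<Sum>s\<in>X. h s) = (\<Sum>s\<in>X. h (- s))" for h :: "int \<Rightarrow> real"
    by (rule sum.reindex_bij_witness[where i = uminus and j = uminus]) (use assms(1) in auto)
  have "sgn_form X f g = (\<Sum>s\<in>X. f (- s) * (\<Sum>t\<in>X. real_of_int (sgn (- t - - s)) * g (- t)))"
    unfolding sgn_form_def by (subst re, intro sum.cong refl, subst re) simp
  also have "\<dots> = (\<Sum>s\<in>X. - ((c * c) * (f s * (\<Sum>t\<in>X. real_of_int (sgn (t - s)) * g t))))"
    unfolding assms(2,3) sum_distrib_left sum_negf[symmetric]
    by (intro sum.cong refl) (auto simp: sgn_if)
  also have "\<dots> = - sgn_form X f g" unfolding assms(4) by (simp add: sgn_form_def sum_negf)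
  finally show ?thesis by simp
qed

lemma sgn_form_eq_grid_sum:
  assumes "\<And>s. s \<in> {- int N..int N} \<Longrightarrow> (\<Sum>t\<in>{- int N..int N}. real_of_int (sgn (t - s)) * poly g (real_of_int t)) = poly H (real_of_int s)"
  shows "sgn_form {- int N..int N} (poly_int f) (poly_int g) = psum (2 * N + 1) (f * H)"
  unfolding sgn_form_def psum_def grid_sum_int poly_int_def
  by (intro sum.cong refl) (use assms in simp)

lemma subset_sum_poly:
  assumes "\<And>i. i < m \<Longrightarrow> degree (p i) \<le> i"
  shows "subset_sum (map (\<lambda>i. poly_int (p i)) [0..<m]) X = (\<Prod>i<m. coeff (p i) i) * subset_sum (map (\<lambda>i s. real_of_int s ^ i) [0..<m]) X"
  unfolding subset_sum_def sum_distrib_left poly_int_def by (intro sum.cong refl alt_det_poly assms)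

lemma prod_even_odd: "(\<Prod>i<2 * n. f i) = (\<Prod>j<n. f (2 * j) * f (2 * j + 1))" for f :: "nat \<Rightarrow> real"
  by (induction n) (simp_all add: mult_ac)

definition monomials :: "nat \<Rightarrow> (int \<Rightarrow> real) list" where
  "monomials m = map (\<lambda>i s. real_of_int s ^ i) [0..<m]"

text \<open>The powers are replaced by a basis that alternates even orthogonal polynomials with odd
  preimages g_j. Parity and orthogonality leave each even polynomial paired only with its neighbour
  among the later entries, so the expansion is one product; the leading coefficients of the basis
  form the denominator.\<close>

theorem subset_sum_monomials:
  assumes "n \<le> N"
  shows "subset_sum (monomials (2 * n)) {- int N..int N} =
    (\<Prod>j<n. alt_moment N (Suc j) / alt_moment N j * cheb_norm (2 * N + 1) (2 * j) /
      ((real j + 1) * real ((2 * (2 * j)) choose (2 * j)) * real ((2 * (2 * j + 2)) choose (2 * j + 2))))"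
proof -
  let ?M = "2 * N + 1" and ?X = "{- int N..int N}"
  \<comment> \<open>The combination of two neighbouring even polynomials whose alternating sums
    cancel, as a preimage requires. It is orthogonal to all degrees below 2j.\<close>
  define H where "H j = smult (alt_moment N j) (cheb ?M (2 * j + 2)) - smult (alt_moment N (Suc j)) (cheb ?M (2 * j))" for j
  define \<tau> where "\<tau> k = real ((2 * k) choose k)" for k
  have \<tau>: "\<tau> k > 0" for k by (simp add: \<tau>_def)
  define P where "P j g \<longleftrightarrow> (\<forall>s. poly g (- s) = - poly g s) \<and> degree g \<le> 2 * j + 1 \<and>
    coeff g (2 * j + 1) = - (real j + 1) * (alt_moment N j * \<tau> (2 * j + 2)) \<and>
    (\<forall>s\<in>?X. (\<Sum>t\<in>?X. real_of_int (sgn (t - s)) * poly g (real_of_int t)) = poly (H j) (real_of_int s))" for j g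
  have "\<exists>g. P j g" if "j < n" for j
  proof -
    have 1: "poly (H j) (- s) = poly (H j) s" for s by (simp add: H_def cheb_parity)
    have 2: "degree (H j) \<le> 2 * j + 2"
      unfolding H_def using cheb_degree(1)[of ?M "2 * j + 2"] cheb_degree(1)[of ?M "2 * j"]
      by (intro degree_diff_le order_trans[OF degree_smult_le]) auto
    have 3: "apsum ?M (H j) = 0"
    proof -
      have "H j = smult (alt_moment N j) (cheb ?M (2 * Suc j)) + smult (- alt_moment N (Suc j)) (cheb ?M (2 * j))" by (simp add: H_def)
      then show ?thesis using that assms by (simp only: apsum_add apsum_smult) (simp only: apsum_cheb_even, simp)
    qed
    have 4: "coeff (H j) (2 * j + 2) = alt_moment N j * \<tau> (2 * j + 2)"
      using cheb_degree(2)[of ?M "2 * j + 2"] cheb_degree(1)[of ?M "2 * j"]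
      unfolding H_def \<tau>_def by (simp add: coeff_eq_0 del: binomial_Suc_Suc)
    show ?thesis
    proof (rule obtain_odd_preimage[OF 1 2 3])
      fix g assume "\<And>s. poly g (- s) = - poly g s" "degree g \<le> 2 * j + 1"
        "coeff g (2 * j + 1) = - (real j + 1) * coeff (H j) (2 * j + 2)"
        "\<And>s. s \<in> ?X \<Longrightarrow> (\<Sum>t\<in>?X. real_of_int (sgn (t - s)) * poly g (real_of_int t)) = poly (H j) (real_of_int s)"
      then have "P j g" unfolding P_def 4 by blast
      then show ?thesis by blast
    qed
  qed
  then have "\<exists>g. \<forall>j<n. P j (g j)" by (intro choice) blast
  then obtain g where Pg: "\<And>j. j < n \<Longrightarrow> P j (g j)" by blast
  have g: "\<And>j s. j < n \<Longrightarrow> poly (g j) (- s) = - poly (g j) s"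
    "\<And>j. j < n \<Longrightarrow> degree (g j) \<le> 2 * j + 1"
    "\<And>j. j < n \<Longrightarrow> coeff (g j) (2 * j + 1) = - (real j + 1) * (alt_moment N j * \<tau> (2 * j + 2))"
    "\<And>j s. j < n \<Longrightarrow> s \<in> ?X \<Longrightarrow> (\<Sum>t\<in>?X. real_of_int (sgn (t - s)) * poly (g j) (real_of_int t)) = poly (H j) (real_of_int s)"
    using Pg unfolding P_def by blast+
  define p where "p i = (if even i then cheb ?M i else g (i div 2))" for i
  have pe: "p (2 * j) = cheb ?M (2 * j)" and po: "p (2 * j + 1) = g j" for j by (simp_all add: p_def)
  have pdeg: "degree (p i) \<le> i" if "i < 2 * n" for i
  proof (cases "even i")
    case True
    then show ?thesis by (simp add: p_def cheb_degree)
  next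
    case False
    then obtain j where "i = 2 * j + 1" using oddE by blast
    then show ?thesis using that g(2)[of j] po[of j] by simp
  qed
  have Qg: "sgn_form ?X (poly_int f) (poly_int (g j)) = psum ?M (f * H j)" if "j < n" for f j
    by (rule sgn_form_eq_grid_sum) (use g(4)[OF that] in blast)
  have QH: "psum ?M (cheb ?M (2 * i) * H j) = (if i = j then - alt_moment N (Suc j) * cheb_norm ?M (2 * j) else 0)" if "i \<le> j" "j < n" for i j
  proof -
    have "cheb ?M (2 * i) * H j = smult (alt_moment N j) (cheb ?M (2 * i) * cheb ?M (2 * j + 2)) - smult (alt_moment N (Suc j)) (cheb ?M (2 * i) * cheb ?M (2 * j))"
      by (simp add: H_def algebra_simps)
    moreover have "psum ?M (cheb ?M (2 * i) * cheb ?M (2 * j + 2)) = 0" using that assms by (intro psum_cheb_less) auto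
    moreover have "psum ?M (cheb ?M (2 * i) * cheb ?M (2 * j)) = (if i = j then cheb_norm ?M (2 * j) else 0)"
      using that assms psum_cheb_less[of "2 * i" "2 * j" ?M] psum_cheb_square[of "2 * j" ?M] by auto
    ultimately show ?thesis by (simp add: psum_diff psum_smult)
  qed
  have sym: "s \<in> ?X \<Longrightarrow> - s \<in> ?X" for s by auto
  have "subset_sum (map (\<lambda>i. poly_int (p i)) [2 * k..<2 * n]) ?X = (\<Prod>j\<in>{k..<n}. - alt_moment N (Suc j) * cheb_norm ?M (2 * j))" if "k \<le> n" for k
    using that
  proof (induction k rule: inc_induct)
    case base
    have "(\<Sum>T\<in>Pow ?X. if T = {} then 1 else 0 :: real) = 1" by (subst sum.delta) auto
    then show ?case by (simp add: subset_sum_def)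
  next
    case (step k)
    have up: "[2 * k..<2 * n] = 2 * k # (2 * k + 1) # [2 * Suc k..<2 * n]" using step by (simp add: upt_conv_Cons)
    have "subset_sum (map (\<lambda>i. poly_int (p i)) [2 * k..<2 * n]) ?X = sgn_form ?X (poly_int (p (2 * k))) (poly_int (p (2 * k + 1))) * subset_sum (map (\<lambda>i. poly_int (p i)) [2 * Suc k..<2 * n]) ?X"
      unfolding up list.map
    proof (rule subset_sum_expand_first[OF _ _ _ refl])
      show "finite ?X" by simp
      show "odd (length (poly_int (p (2 * k + 1)) # map (\<lambda>i. poly_int (p i)) [2 * Suc k..<2 * n]))" by simp
      fix j assume j: "0 < j" "j \<le> length (map (\<lambda>i. poly_int (p i)) [2 * Suc k..<2 * n])"
      have nth: "(poly_int (p (2 * k + 1)) # map (\<lambda>i. poly_int (p i)) [2 * Suc k..<2 * n]) ! j = poly_int (p (2 * k + 1 + j))"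
        using j by (cases j) (auto simp: add_ac)
      show "sgn_form ?X (poly_int (p (2 * k))) ((poly_int (p (2 * k + 1)) # map (\<lambda>i. poly_int (p i)) [2 * Suc k..<2 * n]) ! j) = 0"
      proof (cases "even j")
        case False
        then have "even (2 * k + 1 + j)" by simp
        then have "poly_int (p (2 * k + 1 + j)) (- s) = 1 * poly_int (p (2 * k + 1 + j)) s" for s
          by (simp add: p_def poly_int_def cheb_parity)
        moreover have "poly_int (p (2 * k)) (- s) = 1 * poly_int (p (2 * k)) s" for s by (simp add: pe poly_int_def cheb_parity)
        ultimately show ?thesis unfolding nth by (intro sgn_form_parity[where c = 1] sym) auto
      next
        case True
        then obtain l where l: "j = 2 * l" by blast
        then have "2 * k + 1 + j = 2 * (k + l) + 1" "k < k + l" "k + l < n" using j step by auto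
        then show ?thesis unfolding nth by (simp only: pe po Qg QH) simp
      qed
    qed
    also have "sgn_form ?X (poly_int (p (2 * k))) (poly_int (p (2 * k + 1))) = - alt_moment N (Suc k) * cheb_norm ?M (2 * k)"
      unfolding pe po Qg[OF \<open>k < n\<close>] QH[OF order_refl \<open>k < n\<close>] by simp
    finally show ?case using step by (simp add: prod.atLeast_Suc_lessThan)
  qed
  from this[of 0] have 1: "subset_sum (map (\<lambda>i. poly_int (p i)) [0..<2 * n]) ?X = (\<Prod>j<n. - alt_moment N (Suc j) * cheb_norm ?M (2 * j))"
    by (simp add: atLeast0LessThan)
  have "(\<Prod>i<2 * n. coeff (p i) i) = (\<Prod>j<n. \<tau> (2 * j) * (- (real j + 1) * (alt_moment N j * \<tau> (2 * j + 2))))"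
    unfolding prod_even_odd pe po cheb_degree(2) \<tau>_def[symmetric] by (intro prod.cong refl) (simp only: g(3) lessThan_iff)
  then have 2: "(\<Prod>j<n. \<tau> (2 * j) * (- (real j + 1) * (alt_moment N j * \<tau> (2 * j + 2)))) * subset_sum (monomials (2 * n)) ?X = (\<Prod>j<n. - alt_moment N (Suc j) * cheb_norm ?M (2 * j))"
    using subset_sum_poly[of "2 * n" p ?X, OF pdeg] 1 by (simp add: monomials_def)
  have nz: "(\<Prod>j<n. \<tau> (2 * j) * (- (real j + 1) * (alt_moment N j * \<tau> (2 * j + 2)))) \<noteq> 0"
    using \<tau> alt_moment_pos[of N] by (auto simp: less_imp_neq[symmetric] add_nonneg_eq_0_iff)
  have "subset_sum (monomials (2 * n)) ?X = (\<Prod>j<n. - alt_moment N (Suc j) * cheb_norm ?M (2 * j)) / (\<Prod>j<n. \<tau> (2 * j) * (- (real j + 1) * (alt_moment N j * \<tau> (2 * j + 2))))"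
    using 2 nz by (simp add: field_simps)
  also have "\<dots> = (\<Prod>j<n. alt_moment N (Suc j) / alt_moment N j * cheb_norm ?M (2 * j) / ((real j + 1) * \<tau> (2 * j) * \<tau> (2 * j + 2)))"
    unfolding prod_dividef[symmetric]
  proof (intro prod.cong refl)
    fix j
    show "- alt_moment N (Suc j) * cheb_norm ?M (2 * j) / (\<tau> (2 * j) * (- (real j + 1) * (alt_moment N j * \<tau> (2 * j + 2)))) =
       alt_moment N (Suc j) / alt_moment N j * cheb_norm ?M (2 * j) / ((real j + 1) * \<tau> (2 * j) * \<tau> (2 * j + 2))"
      using \<tau>[of "2 * j"] \<tau>[of "2 * j + 2"] alt_moment_pos[of N j]
      by (simp add: divide_simps) (simp add: algebra_simps)
  qed
  finally show ?thesis unfolding \<tau>_def .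
qed

theorem subset_sum_containing_0:
  assumes n: "1 \<le> n" "n \<le> N"
  shows "subset_sum (monomials (2 * n)) {- int N..int N} - subset_sum (monomials (2 * n)) ({- int N..int N} - {0}) =
    (\<Sum>k<n. (4 * real k + 1) * (central_ratio k ^ 2 - (-1) ^ (n + k) * central_ratio n * central_ratio k) * rho (2 * real N + 1) k) / (2 * real N + 1)
     * subset_sum (monomials (2 * n)) {- int N..int N}"
proof -
  let ?M = "2 * N + 1" and ?X = "{- int N..int N}"
  let ?X' = "?X - {0}"
  obtain H where H: "degree H \<le> 2 * n" "coeff H (2 * n) \<noteq> 0" "\<And>s. poly H (- s) = poly H s"
    "apsum ?M H = 0" "\<And>f. degree f < 2 * n \<Longrightarrow> psum ?M (f * H) = poly f 0"
    "poly H 0 = (\<Sum>k<n. (4 * real k + 1) * (central_ratio k ^ 2 - (-1) ^ (n + k) * central_ratio n * central_ratio k) * rho (2 * real N + 1) k) / (2 * real N + 1)"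
    using obtain_evaluation_poly[OF n] by blast
  obtain m where m: "n = Suc m" using n(1) by (cases n) auto
  have "degree H \<le> 2 * m + 2" using H(1) m by simp
  then obtain h where h: "\<And>s. poly h (- s) = - poly h s" "degree h \<le> 2 * m + 1"
    "coeff h (2 * m + 1) = - (real m + 1) * coeff H (2 * m + 2)"
    "\<And>s. s \<in> ?X \<Longrightarrow> (\<Sum>t\<in>?X. real_of_int (sgn (t - s)) * poly h (real_of_int t)) = poly H (real_of_int s)"
    by (rule obtain_odd_preimage[OF H(3) _ H(4)]) blast+
  define c where "c = coeff h (2 * m + 1)"
  have c: "c \<noteq> 0" using H(2) unfolding c_def h(3) by (simp add: m)
  define mon :: "nat \<Rightarrow> int \<Rightarrow> real" where "mon i s = real_of_int s ^ i" for i s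
  define gs where "gs = map mon [1..<2 * m + 1]"
  have h0: "poly h 0 = 0" using h(1)[of 0] by simp
  have len: "length gs = 2 * m" by (simp add: gs_def)
  \<comment> \<open>The preimage h replaces the top power, at the cost of its leading coefficient c.
    Moving it to the front passes 2m + 1 rows, an odd number, hence the sign.\<close>
  have list: "c * subset_sum (monomials (2 * n)) Y = - subset_sum (poly_int h # mon 0 # gs) Y" for Y
  proof -
    define p where "p i = (if i < 2 * m + 1 then monom 1 i else h)" for i
    have pd: "degree (p i) \<le> i" if "i < 2 * n" for i
      using that h(2) m by (auto simp: p_def degree_monom_eq not_less intro: order_trans)
    have "(\<Prod>i<2 * n. coeff (p i) i) = (\<Prod>i<2 * m + 1. coeff (p i) i) * coeff (p (2 * m + 1)) (2 * m + 1)"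
      using m by simp
    also have "(\<Prod>i<2 * m + 1. coeff (p i) i) = 1" by (rule prod.neutral) (simp add: p_def)
    finally have "subset_sum (map (\<lambda>i. poly_int (p i)) [0..<2 * n]) Y = c * subset_sum (monomials (2 * n)) Y"
      using subset_sum_poly[of "2 * n" p Y, OF pd] by (simp add: p_def c_def monomials_def)
    moreover have "map (\<lambda>i. poly_int (p i)) [0..<2 * n] = (mon 0 # gs) @ [poly_int h]"
    proof -
      have "2 * n = Suc (2 * m + 1)" using m by simp
      then have "[0..<2 * n] = [0..<2 * m + 1] @ [2 * m + 1]" by (simp only: upt_Suc_append[OF le0])
      moreover have "[0..<2 * m + 1] = 0 # [1..<2 * m + 1]" by (subst upt_conv_Cons) simp_all
      moreover have "poly_int (p i) = mon i" if "i < 2 * m + 1" for i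
        using that by (simp add: p_def poly_int_def mon_def fun_eq_iff poly_monom)
      then have "map (\<lambda>i. poly_int (p i)) [0..<2 * m + 1] = map mon [0..<2 * m + 1]" by (intro map_cong refl) auto
      moreover have "p (2 * m + 1) = h" by (simp add: p_def)
      ultimately show ?thesis by (simp only: gs_def map_append list.map)
    qed
    moreover have "subset_sum ((mon 0 # gs) @ [poly_int h]) Y = - subset_sum (poly_int h # mon 0 # gs) Y"
      unfolding subset_sum_def alt_det_rotate using len by (simp add: sum_negf)
    ultimately show ?thesis by simp
  qed
  have Qh: "sgn_form ?X (poly_int f) (poly_int h) = psum ?M (f * H)" for f by (rule sgn_form_eq_grid_sum[OF h(4)])
  have mon_pf: "mon i = poly_int (monom 1 i)" for i by (simp add: mon_def poly_int_def fun_eq_iff poly_monom)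
  have hodd: "poly_int h (- s) = -1 * poly_int h s" for s by (simp add: poly_int_def h(1))
  have drop0: "(\<Sum>s\<in>?X'. k s) = (\<Sum>s\<in>?X. k s)" if "k 0 = 0" for k :: "int \<Rightarrow> real"
    by (rule sum.mono_neutral_left) (use that in auto)
  have pf0: "poly_int h 0 = 0" "0 < i \<Longrightarrow> mon i 0 = 0" for i using h0 by (simp_all add: poly_int_def mon_def)
  have Q1: "sgn_form ?X (poly_int h) (mon i) = 0" if "0 < i" "i < 2 * n" for i
  proof (cases "even i")
    case True
    have "sgn_form ?X (poly_int h) (mon i) = - psum ?M (monom 1 i * H)"
      unfolding mon_pf Qh[symmetric] by (rule sgn_form_antisym)
    also have "psum ?M (monom 1 i * H) = 0" using H(5)[of "monom 1 i"] that by (simp add: degree_monom_eq poly_monom)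
    finally show ?thesis by simp
  next
    case False
    then have "mon i (- s) = -1 * mon i s" for s by (simp add: mon_def)
    then show ?thesis by (intro sgn_form_parity[where c = "-1"] hodd) auto
  qed
  \<comment> \<open>Both arguments vanish at 0, so deleting that point from either sum changes
    nothing.\<close>
  have Q1': "sgn_form ?X' (poly_int h) (mon i) = sgn_form ?X (poly_int h) (mon i)" if "0 < i" for i
    unfolding sgn_form_def using pf0 that by (simp add: drop0)
  have Q2: "sgn_form ?X (poly_int h) (mon 0) = - 1"
  proof -
    have "sgn_form ?X (poly_int h) (mon 0) = - psum ?M (monom 1 0 * H)"
      unfolding mon_pf Qh[symmetric] by (rule sgn_form_antisym)
    then show ?thesis using H(5)[of "monom 1 0"] n by (simp add: degree_monom_eq poly_monom)
  qed
  have Q2': "sgn_form ?X' (poly_int h) (mon 0) = poly H 0 - 1"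
  proof -
    have "sgn_form ?X' (mon 0) (poly_int h) = (\<Sum>s\<in>?X'. poly H (real_of_int s))"
      unfolding sgn_form_def
    proof (intro sum.cong refl)
      fix s assume s: "s \<in> ?X'"
      have "(\<Sum>t\<in>?X'. real_of_int (sgn (t - s)) * poly_int h t) = (\<Sum>t\<in>?X. real_of_int (sgn (t - s)) * poly_int h t)"
        by (rule drop0) (simp add: pf0)
      then show "mon 0 s * (\<Sum>t\<in>?X'. real_of_int (sgn (t - s)) * poly_int h t) = poly H (real_of_int s)"
        using h(4)[of s] s by (simp add: mon_def poly_int_def)
    qed
    also have "\<dots> = (\<Sum>s\<in>?X. poly H (real_of_int s)) - poly H 0"
      by (subst sum.remove[of ?X 0]) auto
    \<comment> \<open>The reproducing property applied to the constant 1.\<close>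
    also have "(\<Sum>s\<in>?X. poly H (real_of_int s)) = 1"
    proof -
      have "psum ?M (1 * H) = poly 1 0" by (rule H(5)) (use n in simp)
      then show ?thesis unfolding psum_def grid_sum_int by simp
    qed
    finally show ?thesis using sgn_form_antisym[of ?X' "poly_int h" "mon 0"] by simp
  qed
  have nth: "(mon 0 # gs) ! j = mon j" if "j \<le> length gs" for j
  proof -
    have "[0..<2 * m + 1] = 0 # [1..<2 * m + 1]" by (subst upt_conv_Cons) simp_all
    then have "mon 0 # gs = map mon [0..<2 * m + 1]" by (simp only: gs_def list.map)
    then show ?thesis using that len by (simp del: upt_Suc)
  qed
  have L1: "subset_sum (poly_int h # mon 0 # gs) ?X = - 1 * subset_sum gs ?X"
    unfolding Q2[symmetric]
  proof (rule subset_sum_expand_first[OF _ _ _ refl])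
    fix j assume "0 < j" "j \<le> length gs"
    then show "sgn_form ?X (poly_int h) ((mon 0 # gs) ! j) = 0" unfolding nth[OF \<open>j \<le> length gs\<close>] using len m by (intro Q1) auto
  qed (use len in auto)
  have L2: "subset_sum (poly_int h # mon 0 # gs) ?X' = (poly H 0 - 1) * subset_sum gs ?X'"
    unfolding Q2'[symmetric]
  proof (rule subset_sum_expand_first[OF _ _ _ refl])
    fix j assume j: "0 < j" "j \<le> length gs"
    then show "sgn_form ?X' (poly_int h) ((mon 0 # gs) ! j) = 0"
      unfolding nth[OF j(2)] Q1'[OF j(1)] using len m by (intro Q1) auto
  qed (use len in auto)
  \<comment> \<open>All remaining rows are positive powers, so a set containing 0 has a zero
    column.\<close>
  have L3: "subset_sum gs ?X' = subset_sum gs ?X"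
    unfolding subset_sum_def
  proof (rule sum.mono_neutral_left)
    show "\<forall>T\<in>Pow ?X - Pow ?X'. alt_det gs T = 0"
    proof
      fix T assume "T \<in> Pow ?X - Pow ?X'"
      then have "0 \<in> T" by auto
      then show "alt_det gs T = 0" by (intro alt_det_all_zero[where t = 0]) (auto simp: gs_def mon_def)
    qed
  qed auto
  have "c * (subset_sum (monomials (2 * n)) ?X - subset_sum (monomials (2 * n)) ?X') = c * (poly H 0 * subset_sum (monomials (2 * n)) ?X)"
  proof -
    have a: "subset_sum gs ?X = c * subset_sum (monomials (2 * n)) ?X" using list[of ?X] unfolding L1 by simp
    have b: "c * subset_sum (monomials (2 * n)) ?X' = (1 - poly H 0) * subset_sum gs ?X" using list[of ?X'] unfolding L2 L3 by (simp add: algebra_simps)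
    show ?thesis unfolding right_diff_distrib b a by (simp add: algebra_simps)
  qed
  then show ?thesis using c unfolding H(6)[symmetric] by simp
qed

section \<open>The product formula for symmetric plane partitions\<close>

lemma ST_Suc:
  "ST (Suc a) b = ST a b * (fact (2 * a + b + 1) * fact a / (fact (a + b) * fact (2 * a + 1)))"
proof -
  let ?f = "\<lambda>i j. (real i + real j + real b - 1) / (real i + real j - 1)"
  have "(\<Prod>i=1..Suc a. \<Prod>j=i+1..Suc a. ?f i j) = (\<Prod>i=1..a. (\<Prod>j=i+1..a. ?f i j) * ?f i (Suc a))"
  proof -
    have "(\<Prod>i=1..Suc a. \<Prod>j=i+1..Suc a. ?f i j) = (\<Prod>i=1..a. \<Prod>j=i+1..Suc a. ?f i j)" by simp
    also have "\<dots> = (\<Prod>i=1..a. (\<Prod>j=i+1..a. ?f i j) * ?f i (Suc a))"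
      by (intro prod.cong refl) auto
    finally show ?thesis .
  qed
  also have "\<dots> = (\<Prod>i=1..a. \<Prod>j=i+1..a. ?f i j) * (\<Prod>i=1..a. ?f i (Suc a))" by (rule prod.distrib)
  also have "(\<Prod>i=1..a. ?f i (Suc a)) = (\<Prod>i=1..a. real (a + b + i)) / (\<Prod>i=1..a. real (a + i))"
    unfolding prod_dividef[symmetric] by (intro prod.cong refl) (simp add: algebra_simps)
  finally have 1: "ST (Suc a) b = ST a b * ((2 * real (Suc a) + real b - 1) / (2 * real (Suc a) - 1)) *
     ((\<Prod>i=1..a. real (a + b + i)) / (\<Prod>i=1..a. real (a + i)))"
    unfolding ST_def by (simp add: mult_ac)
  have f: "fact (c + a) = fact c * (\<Prod>i=1..a. real (c + i))" for c
    by (induction a) (simp_all add: algebra_simps)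
  have 2: "(\<Prod>i=1..a. real (a + b + i)) = fact (2 * a + b) / fact (a + b)"
    using f[of "a + b"] by (simp add: mult_2 add_ac)
  have 3: "(\<Prod>i=1..a. real (a + i)) = fact (2 * a) / fact a"
    using f[of a] by (simp add: mult_2)
  have 4: "(2 * real (Suc a) + real b - 1) * fact (2 * a + b) = fact (2 * a + b + 1)"
    "(2 * real (Suc a) - 1) * fact (2 * a) = fact (2 * a + 1)" by (simp_all add: algebra_simps)
  show ?thesis unfolding 1 2 3 4[symmetric] by (simp add: mult_ac)
qed

lemma ST_prod: "ST a b = (\<Prod>j<a. fact (2 * j + b + 1) * fact j / (fact (j + b) * fact (2 * j + 1)))"
  by (induction a) (simp_all add: ST_Suc del: fact_Suc, simp add: ST_def)

text \<open>Trades two units of b for two of a. With a = 2n and b = 2(N - n) + 1 this raises n while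
  N, and with it the grid, stays fixed.\<close>

lemma ST_shift:
  "ST (a + 2) b = ST a (b + 2) * (fact (2 * a + b + 3) / fact b * (fact a * fact (a + 1) / (fact (2 * a + 1) * fact (2 * a + 3))))"
proof -
  define P where "P f = (\<Prod>j<a. f j)" for f :: "nat \<Rightarrow> real"
  have sh: "(\<Prod>j<a + 2. f j) = f 0 * f 1 * (\<Prod>j<a. f (j + 2))" for f :: "nat \<Rightarrow> real"
    by (simp add: numeral_2_eq_2 prod.lessThan_Suc_shift del: prod.lessThan_Suc)
  have sh1: "(\<Prod>j<a + 2. f j) = f 0 * (\<Prod>j<a. f (j + 1)) * f (a + 1)" for f :: "nat \<Rightarrow> real"
    using prod.lessThan_Suc_shift[of f "Suc a"] by (simp add: mult_ac)
  have "ST (a + 2) b = (\<Prod>j<a + 2. fact (2 * j + b + 1)) * (\<Prod>j<a + 2. fact j) / ((\<Prod>j<a + 2. fact (j + b)) * (\<Prod>j<a + 2. fact (2 * j + 1)))"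
    unfolding ST_prod prod_dividef prod.distrib ..
  also have "(\<Prod>j<a + 2. fact (2 * j + b + 1) :: real) = fact (b + 1) * P (\<lambda>j. fact (2 * j + (b + 2) + 1)) * fact (2 * a + b + 3)"
    unfolding sh1 P_def by (simp add: algebra_simps numeral_eq_Suc del: fact_Suc)
  also have "(\<Prod>j<a + 2. fact j :: real) = P fact * fact a * fact (a + 1)"
    unfolding P_def by (simp add: numeral_2_eq_2 del: fact_Suc)
  also have "(\<Prod>j<a + 2. fact (j + b) :: real) = fact b * fact (b + 1) * P (\<lambda>j. fact (j + (b + 2)))"
    unfolding sh P_def by (simp add: add_ac del: fact_Suc)
  also have "(\<Prod>j<a + 2. fact (2 * j + 1) :: real) = P (\<lambda>j. fact (2 * j + 1)) * fact (2 * a + 1) * fact (2 * a + 3)"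
    unfolding P_def by (simp add: numeral_eq_Suc del: fact_Suc)
  finally have 1: "ST (a + 2) b = fact (b + 1) * P (\<lambda>j. fact (2 * j + (b + 2) + 1)) * fact (2 * a + b + 3) * (P fact * fact a * fact (a + 1)) /
     (fact b * fact (b + 1) * P (\<lambda>j. fact (j + (b + 2))) * (P (\<lambda>j. fact (2 * j + 1)) * fact (2 * a + 1) * fact (2 * a + 3)))" .
  have 2: "ST a (b + 2) = P (\<lambda>j. fact (2 * j + (b + 2) + 1)) * P fact / (P (\<lambda>j. fact (j + (b + 2))) * P (\<lambda>j. fact (2 * j + 1)))"
    unfolding ST_prod prod_dividef prod.distrib P_def ..
  show ?thesis unfolding 1 2 by (simp add: mult_ac del: fact_Suc)
qed

text \<open>Induction on n with N fixed: both products gain the same factor from n to n + 1. The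
  factorials convert Vandermonde products into numbers of patterns.\<close>

theorem ST_subset_sum:
  "n \<le> N \<Longrightarrow> ST (2 * n) (2 * (N - n) + 1) = subset_sum (monomials (2 * n)) {- int N..int N} / (\<Prod>i<2 * n. fact i)"
proof (induction n)
  case 0
  have "(\<Sum>T\<in>Pow {- int N..int N}. if T = {} then 1 else 0 :: real) = 1" by (subst sum.delta) auto
  then show ?case by (simp add: ST_def monomials_def subset_sum_def)
next
  case (Suc n)
  define b where "b = 2 * (N - Suc n) + 1"
  have b: "2 * (N - n) + 1 = b + 2" "b = 2 * N - 2 * n - 1" using Suc.prems by (auto simp: b_def)
  define A where "A = alt_moment N (Suc n) / alt_moment N n * cheb_norm (2 * N + 1) (2 * n) /
      ((real n + 1) * real ((2 * (2 * n)) choose (2 * n)) * real ((2 * (2 * n + 2)) choose (2 * n + 2)))"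
  have subset_sum: "subset_sum (monomials (2 * Suc n)) {- int N..int N} = subset_sum (monomials (2 * n)) {- int N..int N} * A"
    using Suc.prems unfolding subset_sum_monomials[OF Suc.prems] A_def by (subst subset_sum_monomials) auto
  have F: "(\<Prod>i<2 * Suc n. fact i :: real) = (\<Prod>i<2 * n. fact i) * (fact (2 * n) * fact (2 * n + 1))"
    by (simp del: fact_Suc)
  have A: "A / (fact (2 * n) * fact (2 * n + 1)) = fact (2 * (2 * n) + b + 3) / fact b * (fact (2 * n) * fact (2 * n + 1) / (fact (2 * (2 * n) + 1) * fact (2 * (2 * n) + 3)))"
  proof -
    have nN: "n < N" using Suc.prems by simp
    have 1: "alt_moment N (Suc n) / alt_moment N n = (2 * real N + 2 * real n + 2) * (2 * real N - 2 * real n)"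
    proof -
      have nz: "alt_moment N n \<noteq> 0" using alt_moment_pos[of N n] by simp
      show ?thesis unfolding alt_moment_Suc[OF nN] nonzero_mult_div_cancel_right[OF nz] by (simp add: algebra_simps)
    qed
    have 2: "cheb_norm (2 * N + 1) (2 * n) = fact (2 * N + 1 + 2 * n) / ((2 * real N - 2 * real n) * fact b) / (4 * real n + 1)"
    proof -
      have "fact (2 * N - 2 * n) = (real (2 * N) - real (2 * n)) * fact (2 * N - Suc (2 * n))"
        by (rule fact_diff_Suc) (use nN in simp)
      then have "fact (2 * N - 2 * n) = (2 * real N - 2 * real n) * fact b" unfolding b(2) by simp
      then show ?thesis using cheb_norm_even[of n N] nN by (simp add: norm_fact_def)
    qed
    have 3: "real ((2 * (2 * n)) choose (2 * n)) = fact (2 * (2 * n)) / (fact (2 * n) * fact (2 * n))"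
      by (simp add: binomial_fact)
    have 4: "real ((2 * (2 * n + 2)) choose (2 * n + 2)) = fact (2 * (2 * n) + 4) / (fact (2 * n + 2) * fact (2 * n + 2))"
    proof -
      have a: "2 * (2 * n + 2) - (2 * n + 2) = 2 * n + 2" and b: "2 * n + 2 \<le> 2 * (2 * n + 2)" and c: "2 * (2 * n + 2) = 2 * (2 * n) + 4" by simp_all
      show ?thesis using binomial_fact[OF b, where 'a = real] unfolding a unfolding c .
    qed
    have 5: "fact (2 * (2 * n) + b + 3) = (2 * real N + 2 * real n + 2) * fact (2 * N + 1 + 2 * n)"
    proof -
      have "2 * (2 * n) + b + 3 = Suc (2 * N + 1 + 2 * n)" using nN by (simp add: b(2))
      then show ?thesis by (simp only: fact_Suc) (simp add: algebra_simps)
    qed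
    have 6: "fact (2 * (2 * n) + 1) = (4 * real n + 1) * fact (2 * (2 * n))" by (simp add: algebra_simps)
    have 7: "fact (2 * n + 2) = 2 * (real n + 1) * fact (2 * n + 1)" by (simp add: algebra_simps)
    have 8: "fact (2 * (2 * n) + 4) = 4 * (real n + 1) * fact (2 * (2 * n) + 3)"
    proof -
      have "2 * (2 * n) + 4 = Suc (2 * (2 * n) + 3)" by simp
      then show ?thesis by (simp only: fact_Suc) (simp add: algebra_simps)
    qed
    have pos: "2 * real N - 2 * real n > 0" using nN by simp
    have alg: "x * y * (p / (y * q) / z) / (w * (r / (s * s)) * (4 * w * t / (2 * w * u * (2 * w * u)))) / (s * u) =
       x * p / q * (s * u / (z * r * t))"
      if "x > 0" "y > 0" "z > 0" "p > 0" "q > 0" "w > 0" "r > 0" "s > 0" "t > 0" "u > 0" for x y z p q w r s t u :: real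
      using that by (simp add: field_simps)
    show ?thesis unfolding A_def 1 2 3 4 5 6 7 8
      by (rule alg) (use pos in \<open>simp_all del: fact_Suc add: add_nonneg_pos\<close>)
  qed
  have "ST (2 * Suc n) (2 * (N - Suc n) + 1) = ST (2 * n + 2) b" by (simp add: b_def)
  also have "\<dots> = ST (2 * n) (2 * (N - n) + 1) * (A / (fact (2 * n) * fact (2 * n + 1)))"
    unfolding ST_shift A b(1) ..
  also have "\<dots> = subset_sum (monomials (2 * Suc n)) {- int N..int N} / (\<Prod>i<2 * Suc n. fact i)"
    using Suc unfolding subset_sum F by simp
  finally show ?case .
qed

text \<open>After translation by any \<open>v\<close>, \<open>rising i\<close> is a polynomial of
  degree i with leading coefficient 1/i!, and only leading coefficients enter a triangular change of
  basis. This allows the edges to be centred at 0.\<close>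

lemma alt_det_rising:
  "alt_det (map rising [0..<m]) ((\<lambda>s. s + v) ` T) = alt_det (monomials m) T / (\<Prod>i<m. fact i)"
proof -
  define p where "p i = smult (1 / fact i) (rising_poly (real_of_int v) i)" for i
  have d: "degree (p i) \<le> i" for i by (simp add: p_def degree_rising_poly)
  have "lead_coeff (rising_poly (real_of_int v) i) = 1" for i
    unfolding rising_poly_def by (subst lead_coeff_prod) simp
  then have "coeff (rising_poly (real_of_int v) i) i = 1" for i by (simp only: degree_rising_poly)
  then have c: "coeff (p i) i = 1 / fact i" for i by (simp add: p_def)
  have "alt_det (map rising [0..<m]) ((\<lambda>s. s + v) ` T) = alt_det (map (\<lambda>i s. poly (p i) (real_of_int s)) [0..<m]) T"
    by (subst alt_det_reindex) (auto simp: strict_mono_def rising_def p_def poly_rising_poly o_def)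
  also have "\<dots> = (\<Prod>i<m. coeff (p i) i) * alt_det (monomials m) T"
    unfolding monomials_def by (rule alt_det_poly) (rule d)
  finally show ?thesis by (simp add: c prod_dividef)
qed

theorem theorem3:
  fixes n x :: nat
  assumes "n \<ge> 1"
  shows "real (card (centered_sym_tilings (2*n) (2*x+1))) = R n x * ST (2*n) (2*x+1)"
proof -
  define N where "N = n + x"
  \<comment> \<open>The edges on the axis run from -2n to 2x; their midpoint is the central edge and
    becomes 0.\<close>
  define v where "v = int x - int n"
  let ?X = "{- int N..int N}" and ?e = "edges (int (2 * x + 1)) (int (2 * n))"
  have v: "(int (2 * x + 1) - 1 - int (2 * n)) div 2 = v" by (simp add: v_def)
  have e: "?e = (\<lambda>s. s + v) ` ?X"
  proof -
    have "(\<lambda>s. s + v) ` ?X = {- int N + v..int N + v}" by simp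
    then show ?thesis using assms by (auto simp: edges_def N_def v_def)
  qed
  have "real (card (centered_sym_tilings (2 * n) (2 * x + 1))) =
      (\<Sum>S | S \<in> Pow ?e \<and> v \<in> S. alt_det (map rising [0..<2 * n]) S)"
    unfolding card_centered_sym_tilings v of_nat_sum
    by (intro sum.cong refl card_tilings_of_left_part) simp_all
  \<comment> \<open>The translated sets that contain 0 are written as a difference of two power
    sets, to match the two sums over all subsets evaluated before.\<close>
  also have "\<dots> = (\<Sum>T\<in>Pow ?X - Pow (?X - {0}). alt_det (map rising [0..<2 * n]) ((\<lambda>s. s + v) ` T))"
  proof (rule sum.reindex_bij_witness[where i = "\<lambda>T. (\<lambda>s. s + v) ` T" and j = "\<lambda>S. (\<lambda>s. s - v) ` S"])
    fix S assume "S \<in> {S. S \<in> Pow ?e \<and> v \<in> S}"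
    then have S: "S \<subseteq> (\<lambda>s. s + v) ` ?X" "v \<in> S" unfolding e by auto
    have "(\<lambda>s. s - v) ` S \<subseteq> (\<lambda>s. s - v) ` (\<lambda>s. s + v) ` ?X" using S(1) by (rule image_mono)
    moreover have "0 \<in> (\<lambda>s. s - v) ` S" using S(2) by (intro image_eqI[where x = v]) auto
    ultimately show "(\<lambda>s. s - v) ` S \<in> Pow ?X - Pow (?X - {0})" by (auto simp: image_image)
  next
    fix T assume "T \<in> Pow ?X - Pow (?X - {0})"
    then have "T \<subseteq> ?X" "0 \<in> T" by auto
    then show "(\<lambda>s. s + v) ` T \<in> {S. S \<in> Pow ?e \<and> v \<in> S}" unfolding e by (auto intro!: image_eqI[where x = 0])
  qed (simp_all add: image_image)
  also have "\<dots> = (\<Sum>T\<in>Pow ?X - Pow (?X - {0}). alt_det (monomials (2 * n)) T) / (\<Prod>i<2 * n. fact i)"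
    unfolding alt_det_rising sum_divide_distrib ..
  also have "(\<Sum>T\<in>Pow ?X - Pow (?X - {0}). alt_det (monomials (2 * n)) T) = subset_sum (monomials (2 * n)) ?X - subset_sum (monomials (2 * n)) (?X - {0})"
    unfolding subset_sum_def by (rule sum_diff) auto
  also have "\<dots> = R n x * subset_sum (monomials (2 * n)) ?X"
    using subset_sum_containing_0[of n N] R_formula[of n x] assms by (simp add: N_def)
  also have "R n x * subset_sum (monomials (2 * n)) ?X / (\<Prod>i<2 * n. fact i) = R n x * ST (2 * n) (2 * x + 1)"
    using ST_subset_sum[of n N] by (simp add: N_def)
  finally show ?thesis .
qed

end
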